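(* Fix $\varepsilon\leq\frac{1}{120}$. There is a constant $C_0=C_0(\varepsilon)$ such that the following holds whenever $np\geq C_0$. Let $G=(V,E)$ be a random graph drawn from $\mathcal{G}_{n,p,3}$ with planted coloring $\varphi^*$, and let $\varphi$ be any $3$-coloring of $V$ that differs from $\varphi^*$ on at most $\varepsilon n$ vertices. Run the algorithm $\mathsf{Gallager}$ for colorability on $G$ with input $\alpha=\varphi$ and threshold $\tau=1$. Then with probability $1-e^{-\Theta(np)}$ all of the following hold: (1) $\mathsf{Gallager}(G,\varphi)$ converges (no message changes) after at most $O(\log n)$ iterations, returning a partial coloring $\varphi'$ (given by the final values $B_v$); (2) letting $V_A=\{v\in V:\varphi'(v)=\varphi^*(v)\}$, we have $|V_A|\geq(1-e^{-\Theta(np)})n$, and every vertex of $V\setminus V_A$ is $\textsc{Undecided}$ (uncolored) in $\varphi'$; (3) the coloring of $G[V\setminus V_A]$ can be completed to a proper $3$-coloring of $G$ extending the proper coloring $\varphi'|_{V_A}$ of $G[V_A]$, in time $O(n)$.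
   Context: The planted distribution $\mathcal{G}_{n,p,k}$: the vertex set $V=\{1,\dots,n\}$ is partitioned uniformly at random into $k$ classes $V_1,\dots,V_k$ of size $n/k$ each; then for every $i\neq j$ each pair $\{u,v\}$ with $u\in V_i$, $v\in V_j$ is included as an edge independently with probability $p=p(n)$. The planted coloring is $\varphi^*(v)=i$ for $v\in V_i$. A partial coloring is a map assigning each vertex a color in $\{1,\dots,k\}$ or the value $\textsc{Undecided}$. The algorithm $\mathsf{Gallager}$ for colorability with input coloring $\alpha:V\to\{1,\dots,k\}$ and integer threshold $\tau\ge 0$ works on the factor graph whose variable nodes are the vertices of $G$, whose constraint nodes are the edges of $G$, with a vertex $x$ adjacent to an edge $C$ iff $x\in C$. For each incident pair there are messages $x\to C$ and $C\to x$. For a vertex $x$, an edge $C\ni x$ and a color $b$, let $\mathcal{C}^{x,b}_C$ be the set of edges $C'\ni x$, $C'\neq C$, with current message $C'\to x$ equal to $b$. The update rules are: $x\to C$ equals $\textsc{Undecided}$ if there exist two distinct colors $l\neq m$ with $|\mathcal{C}^{x,l}_C|<\tau$ and $|\mathcal{C}^{x,m}_C|<\tau$; otherwise it equals a color $l$ minimizing $|\mathcal{C}^{x,t}_C|$ over $t$. For an edge $C=\{x,y\}$, the message $C\to x$ equals the current message $y\to C$. The algorithm: (1) initialize $x\to C:=\alpha(x)$ for every incident pair; (2) repeat until no message changes: (a) update in parallel all messages $C\to x$, (b) update in parallel all messages $x\to C$; (3) output for each vertex $x$ the value $B_x$, which is $\textsc{Undecided}$ if there exist distinct colors $l\neq m$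 with $|\{C\ni x: C\to x=l\}|<\tau$ and $|\{C\ni x: C\to x=m\}|<\tau$, and otherwise a color $l$ minimizing $|\{C\ni x: C\to x=t\}|$ over $t$. The algorithm converges if it terminates. *)

theory Defs
  imports "HOL-Probability.Probability"
begin

section \<open>Graphs, colorings and the planted distribution\<close>

text \<open>A graph on the vertex set \<open>{1..n}\<close> is given by its set of edges, which are two-element
  sets of vertices. A partial coloring has values in \<^typ>\<open>nat option\<close>, where \<^term>\<open>None\<close> stands
  for Undecided.\<close>

definition proper_coloring :: "nat \<Rightarrow> nat set \<Rightarrow> nat set set \<Rightarrow> (nat \<Rightarrow> nat) \<Rightarrow> bool" where
  "proper_coloring k W E \<psi> \<longleftrightarrow>
     (\<forall>v\<in>W. \<psi> v \<in> {1..k}) \<and> (\<forall>u\<in>W. \<forall>v\<in>W. {u, v} \<in> E \<longrightarrow> \<psi> u \<noteq> \<psi> v)"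

text \<open>Only meaningful if \<open>k\<close> divides \<open>n\<close>: otherwise no balanced coloring exists.\<close>

definition balanced_colorings :: "nat \<Rightarrow> nat \<Rightarrow> (nat \<Rightarrow> nat) set" where
  "balanced_colorings n k =
     {f \<in> {1..n} \<rightarrow>\<^sub>E {1..k}. \<forall>i\<in>{1..k}. card {v\<in>{1..n}. f v = i} = n div k}"

definition cross_pairs :: "nat \<Rightarrow> (nat \<Rightarrow> nat) \<Rightarrow> nat set set" where
  "cross_pairs n f = {{u, v} | u v. u \<in> {1..n} \<and> v \<in> {1..n} \<and> f u \<noteq> f v}"

text \<open>The joint distribution of the planted coloring and the edge set.\<close>

definition planted :: "nat \<Rightarrow> real \<Rightarrow> nat \<Rightarrow> ((nat \<Rightarrow> nat) \<times> nat set set) pmf" where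
  "planted n p k =
     bind_pmf (pmf_of_set (balanced_colorings n k)) (\<lambda>f.
       map_pmf (\<lambda>b. (f, {C \<in> cross_pairs n f. b C}))
         (Pi_pmf (cross_pairs n f) False (\<lambda>_. bernoulli_pmf p)))"


section \<open>The algorithm Gallager for colorability\<close>

text \<open>\<open>to_edge s x C\<close> is the message from the vertex \<open>x\<close> to the edge \<open>C\<close> and
  \<open>to_vertex s C x\<close> the message from \<open>C\<close> to \<open>x\<close>. Only incident pairs matter.\<close>

record messages =
  to_edge :: "nat \<Rightarrow> nat set \<Rightarrow> nat option"
  to_vertex :: "nat set \<Rightarrow> nat \<Rightarrow> nat option"

text \<open>The rule shared by the vertex messages and the output, where \<open>N b\<close> is the number of
  incoming messages equal to \<open>b\<close>. It is a relation, because the color minimizing \<open>N\<close> need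
  not be unique: ties may be broken arbitrarily, and differently each time.\<close>

definition decision :: "nat \<Rightarrow> nat \<Rightarrow> (nat \<Rightarrow> nat) \<Rightarrow> nat option \<Rightarrow> bool" where
  "decision k \<tau> N r \<longleftrightarrow>
     (if \<exists>l\<in>{1..k}. \<exists>m\<in>{1..k}. l \<noteq> m \<and> N l < \<tau> \<and> N m < \<tau> then r = None
      else \<exists>l\<in>{1..k}. r = Some l \<and> (\<forall>t\<in>{1..k}. N l \<le> N t))"

text \<open>No message from an edge to a vertex exists before the first iteration, which is
  represented by \<^term>\<open>None\<close>. Since \<open>\<alpha>\<close> is total, the first iteration therefore counts as a
  change whenever there is an edge.\<close>

definition gallager_init :: "nat set set \<Rightarrow> (nat \<Rightarrow> nat) \<Rightarrow> messages \<Rightarrow> bool" where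
  "gallager_init E \<alpha> s \<longleftrightarrow>
     (\<forall>C\<in>E. \<forall>x\<in>C. to_edge s x C = Some (\<alpha> x) \<and> to_vertex s C x = None)"

definition gallager_step ::
    "nat \<Rightarrow> nat \<Rightarrow> nat set set \<Rightarrow> messages \<Rightarrow> messages \<Rightarrow> bool" where
  "gallager_step k \<tau> E s s' \<longleftrightarrow>
     (\<forall>C\<in>E. \<forall>x\<in>C. \<forall>y\<in>C. x \<noteq> y \<longrightarrow> to_vertex s' C x = to_edge s y C) \<and>
     (\<forall>C\<in>E. \<forall>x\<in>C. decision k \<tau>
        (\<lambda>b. card {C'\<in>E. x \<in> C' \<and> C' \<noteq> C \<and> to_vertex s' C' x = Some b})
        (to_edge s' x C))"

definition gallager_output ::
    "nat \<Rightarrow> nat \<Rightarrow> nat \<Rightarrow> nat set set \<Rightarrow> messages \<Rightarrow> (nat \<Rightarrow> nat option) \<Rightarrow> bool" where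
  "gallager_output n k \<tau> E s B \<longleftrightarrow>
     (\<forall>x\<in>{1..n}. decision k \<tau> (\<lambda>b. card {C\<in>E. x \<in> C \<and> to_vertex s C x = Some b}) (B x))"

definition same_messages :: "nat set set \<Rightarrow> messages \<Rightarrow> messages \<Rightarrow> bool" where
  "same_messages E s s' \<longleftrightarrow>
     (\<forall>C\<in>E. \<forall>x\<in>C. to_edge s x C = to_edge s' x C \<and> to_vertex s C x = to_vertex s' C x)"

text \<open>\<open>\<rho> t\<close> are the messages after \<open>t\<close> iterations. A sequence \<open>\<rho>\<close> also continues after the
  point where the algorithm stops; that point is determined by \<open>halts_after\<close>.\<close>

definition gallager_execution ::
    "nat \<Rightarrow> nat \<Rightarrow> nat set set \<Rightarrow> (nat \<Rightarrow> nat) \<Rightarrow> (nat \<Rightarrow> messages) \<Rightarrow> bool" where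
  "gallager_execution k \<tau> E \<alpha> \<rho> \<longleftrightarrow>
     gallager_init E \<alpha> (\<rho> 0) \<and> (\<forall>t. gallager_step k \<tau> E (\<rho> t) (\<rho> (Suc t)))"

definition halts_after :: "nat set set \<Rightarrow> (nat \<Rightarrow> messages) \<Rightarrow> nat \<Rightarrow> bool" where
  "halts_after E \<rho> T \<longleftrightarrow>
     (\<exists>t. T = Suc t \<and> same_messages E (\<rho> t) (\<rho> (Suc t)) \<and>
        (\<forall>r<t. \<not> same_messages E (\<rho> r) (\<rho> (Suc r))))"


section \<open>Running time\<close>

text \<open>Running time is measured on a random access machine, presented as a small imperative
  language whose memory consists of arrays of natural numbers. A program mentions only finitely
  many arrays and contains only expressions of bounded size, so charging one time unit for each
  executed assignment and test amounts, up to a constant factor, to the uniform cost measure.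
  The only arithmetic is increment and decrement, so that the numbers occurring in a run exceed
  those in the input and in the program by at most a constant times the running time.\<close>

type_synonym store = "nat \<Rightarrow> nat \<Rightarrow> nat"

datatype expr = Num nat | At nat expr | Inc expr | Dec expr

datatype test = Less expr expr | Equal expr expr | Neg test

datatype prog =
    Skip
  | Assign nat expr expr
  | Seq prog prog
  | Cond test prog prog
  | Loop test prog

primrec eval_expr :: "expr \<Rightarrow> store \<Rightarrow> nat" where
  "eval_expr (Num i) st = i"
| "eval_expr (At a e) st = st a (eval_expr e st)"
| "eval_expr (Inc e) st = eval_expr e st + 1"
| "eval_expr (Dec e) st = eval_expr e st - 1"

primrec eval_test :: "test \<Rightarrow> store \<Rightarrow> bool" where
  "eval_test (Less e e') st \<longleftrightarrow> eval_expr e st < eval_expr e' st"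
| "eval_test (Equal e e') st \<longleftrightarrow> eval_expr e st = eval_expr e' st"
| "eval_test (Neg b) st \<longleftrightarrow> \<not> eval_test b st"

text \<open>\<open>exec P st t st'\<close>: started in \<open>st\<close>, the program \<open>P\<close> terminates in \<open>st'\<close> after
  exactly \<open>t\<close> time units.\<close>

inductive exec :: "prog \<Rightarrow> store \<Rightarrow> nat \<Rightarrow> store \<Rightarrow> bool" where
  Skip: "exec Skip st 1 st"
| Assign: "exec (Assign a e e') st 1 (st(a := (st a)(eval_expr e st := eval_expr e' st)))"
| Seq: "exec P st t st' \<Longrightarrow> exec Q st' t' st'' \<Longrightarrow> exec (Seq P Q) st (t + t') st''"
| CondTrue: "eval_test b st \<Longrightarrow> exec P st t st' \<Longrightarrow> exec (Cond b P Q) st (Suc t) st'"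
| CondFalse: "\<not> eval_test b st \<Longrightarrow> exec Q st t st' \<Longrightarrow> exec (Cond b P Q) st (Suc t) st'"
| LoopFalse: "\<not> eval_test b st \<Longrightarrow> exec (Loop b P) st 1 st"
| LoopTrue: "eval_test b st \<Longrightarrow> exec P st t st' \<Longrightarrow> exec (Loop b P) st' t' st'' \<Longrightarrow>
    exec (Loop b P) st (Suc (t + t')) st''"

definition adjacency_lists :: "nat \<Rightarrow> nat set set \<Rightarrow> (nat \<Rightarrow> nat list) \<Rightarrow> bool" where
  "adjacency_lists n E adj \<longleftrightarrow>
     (\<forall>v\<in>{1..n}. distinct (adj v) \<and> set (adj v) = {w. {v, w} \<in> E})"

text \<open>Array 0 holds the number of vertices, array 1 the partial coloring (0 for Undecided),
  array 3 the concatenation of all adjacency lists. The list of \<open>v\<close> occupies the positions of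
  array 3 from the one stored in cell \<open>v\<close> of array 2 up to, but excluding, the one stored in
  cell \<open>v + 1\<close>. All other cells are initially 0.\<close>

definition input_store ::
    "nat \<Rightarrow> (nat \<Rightarrow> nat list) \<Rightarrow> (nat \<Rightarrow> nat option) \<Rightarrow> store" where
  "input_store n adj B a i =
     (let L = concat (map adj [1..<Suc n]) in
      if a = 0 \<and> i = 0 then n
      else if a = 1 \<and> i \<in> {1..n} then (case B i of None \<Rightarrow> 0 | Some c \<Rightarrow> c)
      else if a = 2 \<and> i \<in> {1..Suc n} then (\<Sum>u\<in>{1..<i}. length (adj u))
      else if a = 3 \<and> i < length L then L ! i
      else 0)"

text \<open>The resulting coloring is read off array 1.\<close>

definition completes_within ::
    "prog \<Rightarrow> real \<Rightarrow> nat \<Rightarrow> nat \<Rightarrow> nat set set \<Rightarrow> nat set \<Rightarrow> (nat \<Rightarrow> nat option) \<Rightarrow> bool" where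
  "completes_within P bound n k E A B \<longleftrightarrow>
     (\<forall>adj. adjacency_lists n E adj \<longrightarrow>
        (\<exists>t st. exec P (input_store n adj B) t st \<and> real t \<le> bound \<and>
           proper_coloring k {1..n} E (st 1) \<and> (\<forall>v\<in>A. B v = Some (st 1 v))))"

end

(* A vertex is low if it has fewer than d/4 neighbors, d = n p, in some other class. With high
   probability, for every set F of at most n/120 vertices, the set of vertices with at least d/17
   neighbors in F has at most half the size of F (expansion). Hence there is a set Z consisting
   of the low vertices and of all vertices with at least d/17 neighbors in Z, of at most twice as
   many vertices as are low.

   Outside Z, a vertex sending a wrong message has at least d/17 neighbors outside Z that sent a
   wrong message one iteration earlier, so by expansion the number of such vertices halves in each
   iteration. After O(log n) iterations only the messages sent by Z may be wrong.

   By expansion at least half of the vertices of a component K of G[Z] are low. A union bound over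
   spanning trees of K and sets of low vertices shows that G[Z] is a forest with components of
   size O(log n): for |K| = s there are at most (e n / s)^s sets and s^s parent maps, each tree is
   present with probability p^(s-1), lowness costs exp(-d/240)^s, and an additional edge costs a
   factor s^2 p. In a forest the messages become correct or Undecided from the leaves
   upwards and then from the roots downwards.

   The neighbors of an undecided vertex that are colored all have the same color, so two colors
   remain for it. As each newly visited vertex of a forest has only one vertex visited before among
   its neighbors, coloring greedily in the order of a search never fails. *)

theory Submission
  imports Defs "HOL-Real_Asymp.Real_Asymp"
begin

section \<open>Coloring a forest greedily in linear time\<close>

text \<open>Randomness enters only through properties of the graph that do not mention
  \<open>\<phi>\<close>, so an adversarial \<open>\<phi>\<close> costs no union bound over
  colorings. Tie-breaking is harmless: each decision that is used has a strict minimum or, with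
  threshold 1, count zero at the correct color.

  The constants interlock. Outside \<open>Z\<close> the own color gets fewer than 2d/17 messages and
  every other color at least d/4 - 2d/17 - 1, and 17 is the least integer q with 4/q < 1/4. An edge
  may be counted from both ends, whence 34 = 2 * 17, and expansion of sets of size n/120 rests on ln
  (120/34) > 1.

  Two obstacles are not visible in the overview. The algorithm may halt before the estimated time,
  and since the rules are nondeterministic the given sequence need not stay constant afterwards; the
  run frozen at the halting point is analyzed instead. And the graph has about d n edges with d
  unbounded, so linear time forbids reading all adjacency lists: only those of undecided vertices
  are scanned, and an exponential moment of the degrees bounds their total length by O(n).\<close>

primrec loop_free :: "prog \<Rightarrow> bool" where
  "loop_free Skip \<longleftrightarrow> True"
| "loop_free (Assign a e e') \<longleftrightarrow> True"
| "loop_free (Seq P Q) \<longleftrightarrow> loop_free P \<and> loop_free Q"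
| "loop_free (Cond b P Q) \<longleftrightarrow> loop_free P \<and> loop_free Q"
| "loop_free (Loop b P) \<longleftrightarrow> False"

text \<open>Without loops, execution is a function of the store and \<open>cost\<close> bounds its
  time for every store, so derivations of \<open>exec\<close> reduce to simplification.
  \<open>Loop\<close> gets default values, since \<open>exec_loop_free\<close> excludes it.\<close>

primrec run :: "prog \<Rightarrow> store \<Rightarrow> store" where
  "run Skip st = st"
| "run (Assign a e e') st = st(a := (st a)(eval_expr e st := eval_expr e' st))"
| "run (Seq P Q) st = run Q (run P st)"
| "run (Cond b P Q) st = (if eval_test b st then run P st else run Q st)"
| "run (Loop b P) st = st"

primrec cost :: "prog \<Rightarrow> nat" where
  "cost Skip = 1"
| "cost (Assign a e e') = 1"
| "cost (Seq P Q) = cost P + cost Q"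
| "cost (Cond b P Q) = Suc (max (cost P) (cost Q))"
| "cost (Loop b P) = 0"

lemma exec_loop_free: "loop_free P \<Longrightarrow> \<exists>t\<le>cost P. exec P st t (run P st)"
proof (induction P arbitrary: st)
  case (Seq P Q)
  obtain t where t: "t \<le> cost P" "exec P st t (run P st)" using Seq by auto
  obtain t' where t': "t' \<le> cost Q" "exec Q (run P st) t' (run Q (run P st))" using Seq by auto
  show ?case using exec.Seq[OF t(2) t'(2)] t t' by (intro exI[of _ "t + t'"]) auto
next
  case (Cond b P Q)
  show ?case
  proof (cases "eval_test b st")
    case True
    obtain t where t: "t \<le> cost P" "exec P st t (run P st)" using Cond by auto
    show ?thesis using exec.CondTrue[OF True t(2)] t True by (intro exI[of _ "Suc t"]) auto
  next
    case False
    obtain t where t: "t \<le> cost Q" "exec Q st t (run Q st)" using Cond by auto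
    show ?thesis using exec.CondFalse[OF False t(2)] t False by (intro exI[of _ "Suc t"]) auto
  qed
next
  case Skip
  then show ?case using exec.Skip[of st] by (intro exI[of _ 1]) auto
next
  case (Assign a e e')
  show ?case by (metis exec.Assign run.simps(2) cost.simps(2) order_refl)
qed auto

text \<open>Amortized analysis: the strict decrease of \<open>\<Phi>\<close> leaves one unit per
  round for the loop test, and the final \<open>Suc\<close> pays for the test that fails.\<close>

lemma exec_loop_potential:
  fixes \<Phi> :: "store \<Rightarrow> nat"
  assumes step: "\<And>st. I st \<Longrightarrow> eval_test b st \<Longrightarrow>
      \<exists>t st'. exec P st t st' \<and> I st' \<and> t + \<Phi> st' < \<Phi> st"
    and "I st"
  shows "\<exists>t st'. exec (Loop b P) st t st' \<and> I st' \<and> \<not> eval_test b st' \<and> t \<le> Suc (\<Phi> st)"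
  using \<open>I st\<close>
proof (induction "\<Phi> st" arbitrary: st rule: less_induct)
  case less
  show ?case
  proof (cases "eval_test b st")
    case True
    obtain t st' where 1: "exec P st t st'" "I st'" "t + \<Phi> st' < \<Phi> st"
      using step[OF less(2) True] by blast
    obtain t' st'' where 2: "exec (Loop b P) st' t' st''" "I st''" "\<not> eval_test b st''"
        "t' \<le> Suc (\<Phi> st')"
      using less(1)[OF _ 1(2)] 1(3) by auto
    show ?thesis using exec.LoopTrue[OF True 1(1) 2(1)] 2 1(3)
      by (intro exI[of _ "Suc (t + t')"] exI[of _ st'']) auto
  next
    case False
    show ?thesis using exec.LoopFalse[OF False] less(2) False
      by (intro exI[of _ 1] exI[of _ st]) auto
  qed
qed

section \<open>The coloring program and its cost\<close>

abbreviation "cur \<equiv> At 4 (Num 0)"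
abbreviation "top_ix \<equiv> At 6 (Num 0)"
abbreviation "node \<equiv> At 7 (Num 0)"
abbreviation "pos \<equiv> At 8 (Num 0)"

text \<open>Depth-first search with an explicit stack (array 5, height in cell 0 of array 6). A popped
  vertex is colored at once; array 9 flags the colors seen at its neighbors.\<close>

definition pop_prog :: prog where
  "pop_prog = Seq (Assign 7 (Num 0) (At 5 top_ix)) (Seq (Assign 6 (Num 0) (Dec top_ix))
     (Seq (Assign 9 (Num 1) (Num 0)) (Seq (Assign 9 (Num 2) (Num 0)) (Seq (Assign 9 (Num 3) (Num 0))
     (Assign 8 (Num 0) (At 2 node))))))"

definition scan_body :: prog where
  "scan_body = Seq (Assign 9 (At 1 (At 3 pos)) (Num 1))
     (Seq (Cond (Equal (At 1 (At 3 pos)) (Num 0))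
        (Seq (Assign 6 (Num 0) (Inc top_ix)) (Assign 5 top_ix (At 3 pos))) Skip)
     (Assign 8 (Num 0) (Inc pos)))"

definition scan_prog :: prog where
  "scan_prog = Loop (Less pos (At 2 (Inc node))) scan_body"

definition color_prog :: prog where
  "color_prog = Cond (Equal (At 9 (Num 1)) (Num 0)) (Assign 1 node (Num 1))
     (Cond (Equal (At 9 (Num 2)) (Num 0)) (Assign 1 node (Num 2)) (Assign 1 node (Num 3)))"

text \<open>An uncolored vertex at the cursor becomes a new root without moving the cursor; the
  cursor passes it once its component has been colored.\<close>

definition restart_prog :: prog where
  "restart_prog = Cond (Equal (At 1 cur) (Num 0))
     (Seq (Assign 6 (Num 0) (Num 1)) (Assign 5 (Num 1) cur)) (Assign 4 (Num 0) (Inc cur))"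

definition greedy_body :: prog where
  "greedy_body = Cond (Less (Num 0) top_ix) (Seq pop_prog (Seq scan_prog color_prog)) restart_prog"

definition greedy_prog :: prog where
  "greedy_prog = Seq (Assign 4 (Num 0) (Num 1)) (Loop (Neg (Less (At 0 (Num 0)) cur)) greedy_body)"

definition stack :: "store \<Rightarrow> nat list" where
  "stack st = map (st 5) [1..<Suc (st 6 0)]"

lemma stack_eq_Nil_iff: "stack st = [] \<longleftrightarrow> st 6 0 = 0"
  by (auto simp: stack_def)

text \<open>Six units per neighbor: five for \<open>scan_body\<close> and one for the test.
  Uncolored neighbors set cell 0 of array 9, which \<open>color_prog\<close> does not read.\<close>

lemma exec_scan:
  assumes "\<And>k. k < length ws \<Longrightarrow> st 3 (st 8 0 + k) = ws ! k"
    and "st 2 (Suc (st 7 0)) = st 8 0 + length ws"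
  shows "\<exists>t st'. exec scan_prog st t st' \<and> t \<le> 6 * length ws + 1 \<and>
    (\<forall>a\<in>{0,1,2,3,4,7}. st' a = st a) \<and>
    stack st' = stack st @ filter (\<lambda>w. st 1 w = 0) ws \<and>
    (\<forall>c. st' 9 c = (if \<exists>w\<in>set ws. st 1 w = c then 1 else st 9 c))"
  using assms
proof (induction ws arbitrary: st)
  case Nil
  have "exec scan_prog st 1 st" unfolding scan_prog_def
    by (rule exec.LoopFalse) (use Nil in simp)
  then show ?case by fastforce
next
  case (Cons w ws)
  let ?st = "run scan_body st"
  have w: "st 3 (st 8 0) = w" using Cons.prems(1)[of 0] by simp
  have st: "?st 8 0 = Suc (st 8 0)" "\<forall>a\<in>{0,1,2,3,4,7}. ?st a = st a"
    "stack ?st = stack st @ filter (\<lambda>w. st 1 w = 0) [w]"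
    "\<forall>c. ?st 9 c = (if st 1 w = c then 1 else st 9 c)"
    by (auto simp: scan_body_def w stack_def)
  have "\<exists>t st'. exec scan_prog ?st t st' \<and> t \<le> 6 * length ws + 1 \<and>
    (\<forall>a\<in>{0,1,2,3,4,7}. st' a = ?st a) \<and>
    stack st' = stack ?st @ filter (\<lambda>w. ?st 1 w = 0) ws \<and>
    (\<forall>c. st' 9 c = (if \<exists>w\<in>set ws. ?st 1 w = c then 1 else ?st 9 c))"
  proof (rule Cons.IH)
    show "?st 3 (?st 8 0 + k) = ws ! k" if "k < length ws" for k
      using Cons.prems(1)[of "Suc k"] that st by simp
    show "?st 2 (Suc (?st 7 0)) = ?st 8 0 + length ws"
      using Cons.prems(2) st by simp
  qed
  then obtain t st' where t: "exec scan_prog ?st t st'" "t \<le> 6 * length ws + 1"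
    "\<forall>a\<in>{0,1,2,3,4,7}. st' a = ?st a"
    "stack st' = stack ?st @ filter (\<lambda>w. ?st 1 w = 0) ws"
    "\<forall>c. st' 9 c = (if \<exists>w\<in>set ws. ?st 1 w = c then 1 else ?st 9 c)"
    by blast
  have "loop_free scan_body" "cost scan_body = 5" by (auto simp: scan_body_def)
  then obtain t0 where t0: "t0 \<le> 5" "exec scan_body st t0 ?st"
    using exec_loop_free by metis
  have "eval_test (Less pos (At 2 (Inc node))) st"
    using Cons.prems(2) by simp
  then have "exec scan_prog st (Suc (t0 + t)) st'"
    unfolding scan_prog_def using exec.LoopTrue t0(2) t(1)[unfolded scan_prog_def] by blast
  moreover have "Suc (t0 + t) \<le> 6 * length (w # ws) + 1" using t0 t by simp
  moreover have "\<forall>a\<in>{0,1,2,3,4,7}. st' a = st a" using t(3) st(2) by simp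
  moreover have "stack st' = stack st @ filter (\<lambda>w. st 1 w = 0) (w # ws)"
    using t(4) st by simp
  moreover have "\<forall>c. st' 9 c = (if \<exists>v\<in>set (w # ws). st 1 v = c then 1 else st 9 c)"
    using t(5) st by simp
  ultimately show ?case by blast
qed

lemma run_pop:
  assumes "st 6 0 > 0"
  obtains x where "stack st = stack (run pop_prog st) @ [x]"
    "run pop_prog st 7 0 = x" "run pop_prog st 8 0 = st 2 x"
    "\<forall>a\<in>{0,1,2,3,4}. run pop_prog st a = st a" "\<forall>c\<in>{1,2,3}. run pop_prog st 9 c = 0"
proof
  let ?x = "st 5 (st 6 0)"
  obtain k where k: "st 6 0 = Suc k" using assms gr0_implies_Suc by blast
  show "stack st = stack (run pop_prog st) @ [?x]"
    by (simp add: stack_def pop_prog_def k)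
qed (simp_all add: pop_prog_def)

lemma exec_visit:
  assumes "st 6 0 > 0" "stack st = q @ [x]"
    and "\<And>k. k < length ws \<Longrightarrow> st 3 (st 2 x + k) = ws ! k"
    and "st 2 (Suc x) = st 2 x + length ws"
    and free: "\<exists>c\<in>{1,2,3}. \<forall>w\<in>set ws. st 1 w \<noteq> c"
  shows "\<exists>t st' c. exec greedy_body st t st' \<and> t \<le> 6 * length ws + 12 \<and>
    (\<forall>a\<in>{0,2,3,4}. st' a = st a) \<and> st' 1 = (st 1)(x := c) \<and>
    stack st' = q @ filter (\<lambda>w. st 1 w = 0) ws \<and>
    c \<in> {1,2,3} \<and> (\<forall>w\<in>set ws. st 1 w \<noteq> c)"
proof -
  let ?s1 = "run pop_prog st"
  obtain x' where x': "stack st = stack (run pop_prog st) @ [x']"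
    "run pop_prog st 7 0 = x'" "run pop_prog st 8 0 = st 2 x'"
    "\<forall>a\<in>{0,1,2,3,4}. run pop_prog st a = st a" "\<forall>c\<in>{1,2,3}. run pop_prog st 9 c = 0"
    using run_pop[where st=st] assms(1) by blast
  have [simp]: "x' = x" and q: "stack ?s1 = q" using x'(1) assms(2) by auto
  have "loop_free pop_prog" "cost pop_prog = 6" by (auto simp: pop_prog_def)
  then obtain t1 where t1: "t1 \<le> 6" "exec pop_prog st t1 ?s1"
    using exec_loop_free by metis
  have "\<exists>t s2. exec scan_prog ?s1 t s2 \<and> t \<le> 6 * length ws + 1 \<and>
    (\<forall>a\<in>{0,1,2,3,4,7}. s2 a = ?s1 a) \<and>
    stack s2 = stack ?s1 @ filter (\<lambda>w. ?s1 1 w = 0) ws \<and>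
    (\<forall>c. s2 9 c = (if \<exists>w\<in>set ws. ?s1 1 w = c then 1 else ?s1 9 c))"
    by (rule exec_scan) (use assms x' in simp_all)
  then obtain t2 s2 where t2: "exec scan_prog ?s1 t2 s2" "t2 \<le> 6 * length ws + 1"
    "\<forall>a\<in>{0,1,2,3,4,7}. s2 a = ?s1 a"
    "stack s2 = stack ?s1 @ filter (\<lambda>w. ?s1 1 w = 0) ws"
    "\<forall>c. s2 9 c = (if \<exists>w\<in>set ws. ?s1 1 w = c then 1 else ?s1 9 c)"
    by blast
  have flag: "s2 9 c = 0 \<longleftrightarrow> (\<forall>w\<in>set ws. st 1 w \<noteq> c)" if "c \<in> {1,2,3}" for c
    using t2(5) x'(4,5) that by auto
  let ?s3 = "run color_prog s2"
  have "loop_free color_prog" "cost color_prog = 3" by (auto simp: color_prog_def)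
  then obtain t3 where t3: "t3 \<le> 3" "exec color_prog s2 t3 ?s3"
    using exec_loop_free by metis
  have 7: "s2 7 0 = x" "s2 1 = st 1" using t2(3) x' by auto
  define c where "c = (if s2 9 1 = 0 then 1 else if s2 9 2 = 0 then 2 else 3::nat)"
  have s3: "?s3 = s2(1 := (st 1)(x := c))"
    using 7 by (simp add: color_prog_def c_def)
  have c: "c \<in> {1,2,3}" "s2 9 c = 0"
    using free flag by (auto simp: c_def)
  have "exec greedy_body st (Suc (t1 + (t2 + t3))) ?s3"
    unfolding greedy_body_def
    by (intro exec.CondTrue exec.Seq[OF t1(2)] exec.Seq[OF t2(1)] t3(2)) (use assms in simp)
  moreover have "Suc (t1 + (t2 + t3)) \<le> 6 * length ws + 12" using t1 t2 t3 by simp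
  moreover have "\<forall>a\<in>{0,2,3,4}. ?s3 a = st a" using t2(3) x'(4) s3 by simp
  moreover have "?s3 1 = (st 1)(x := c)" using s3 by simp
  moreover have "stack ?s3 = q @ filter (\<lambda>w. st 1 w = 0) ws"
    using t2(4) q x'(4) by (simp add: s3 stack_def)
  moreover have "\<forall>w\<in>set ws. st 1 w \<noteq> c" using flag c by auto
  ultimately show ?thesis using c(1) by blast
qed

lemma exec_restart:
  assumes "st 6 0 = 0"
  shows "\<exists>t st'. exec greedy_body st t st' \<and> t \<le> 4 \<and> (\<forall>a\<in>{0,1,2,3}. st' a = st a) \<and>
    (if st 1 (st 4 0) = 0 then st' 4 = st 4 \<and> stack st' = [st 4 0]
     else st' 4 0 = Suc (st 4 0) \<and> stack st' = [])"
proof -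
  have "loop_free restart_prog" "cost restart_prog = 3" by (auto simp: restart_prog_def)
  then obtain t where t: "t \<le> 3" "exec restart_prog st t (run restart_prog st)"
    using exec_loop_free by metis
  have "exec greedy_body st (Suc t) (run restart_prog st)"
    unfolding greedy_body_def by (rule exec.CondFalse) (use assms t in simp_all)
  moreover have "(\<forall>a\<in>{0,1,2,3}. run restart_prog st a = st a) \<and>
    (if st 1 (st 4 0) = 0 then run restart_prog st 4 = st 4 \<and> stack (run restart_prog st) = [st 4 0]
     else run restart_prog st 4 0 = Suc (st 4 0) \<and> stack (run restart_prog st) = [])"
    by (auto simp: restart_prog_def stack_def assms)
  ultimately show ?thesis using t(1)
    by (intro exI[of _ "Suc t"] exI[of _ "run restart_prog st"]) auto
qed


text \<open>\<open>D\<close> holds the vertices of \<open>U\<close> colored so far, \<open>T\<close>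
  those of the component being explored, \<open>Q\<close> the stack. The bound on
  \<open>card T\<close> expresses connectedness by counting: in a forest it forces exactly
  \<open>card T - 1\<close> edges inside a nonempty \<open>T\<close>. The last clause admits a fresh
  root, which is not attached to anything yet.\<close>

definition search_inv :: "nat set set \<Rightarrow> nat set \<Rightarrow> nat set \<Rightarrow> nat set \<Rightarrow> nat set \<Rightarrow> bool" where
  "search_inv E U D T Q \<longleftrightarrow> T \<subseteq> D \<and> D \<subseteq> U \<and> Q \<subseteq> U - D \<and>
     (\<forall>x\<in>D - T. \<forall>y\<in>U. {x, y} \<in> E \<longrightarrow> y \<in> D - T) \<and>
     (\<forall>x\<in>T. \<forall>y\<in>U. {x, y} \<in> E \<longrightarrow> y \<in> T \<union> Q) \<and>
     card T \<le> Suc (card {e\<in>E. e \<subseteq> T}) \<and>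
     (\<forall>q\<in>Q. (\<exists>x\<in>T. {x, q} \<in> E) \<or> T = {} \<and> Q = {q})"

text \<open>Acyclicity by counting instead of by paths: a cycle has as many edges as vertices. The
  property passes to subsets of \<open>U\<close> at once.\<close>

definition forest_on :: "nat set set \<Rightarrow> nat set \<Rightarrow> bool" where
  "forest_on E U \<longleftrightarrow> (\<forall>S\<subseteq>U. S \<noteq> {} \<longrightarrow> card {e\<in>E. e \<subseteq> S} < card S)"

lemma card_edges_insert:
  assumes "finite E" "x \<notin> S" "N \<subseteq> S" "\<And>y. y \<in> N \<Longrightarrow> {x, y} \<in> E"
  shows "card {e\<in>E. e \<subseteq> S} + card N \<le> card {e\<in>E. e \<subseteq> insert x S}"
proof -
  have inj: "inj_on (\<lambda>y. {x, y}) N" by (auto simp: inj_on_def doubleton_eq_iff)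
  have fin: "finite ((\<lambda>y. {x, y}) ` N)"
    using assms by (intro finite_subset[OF _ assms(1)]) auto
  have "card {e\<in>E. e \<subseteq> S} + card N = card {e\<in>E. e \<subseteq> S} + card ((\<lambda>y. {x, y}) ` N)"
    using inj by (simp add: card_image)
  also have "\<dots> = card ({e\<in>E. e \<subseteq> S} \<union> (\<lambda>y. {x, y}) ` N)"
    using assms fin by (intro card_Un_disjoint[symmetric]) auto
  also have "\<dots> \<le> card {e\<in>E. e \<subseteq> insert x S}"
    using assms by (intro card_mono) auto
  finally show ?thesis .
qed

context
  fixes E :: "nat set set" and U D T Q :: "nat set" and x :: nat
  assumes fin: "finite E" "finite U" and forest: "forest_on E U" and loop: "{x} \<notin> E"
    and inv: "search_inv E U D T Q" and x: "x \<in> Q"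
begin

private lemma sub: "T \<subseteq> D" "D \<subseteq> U" "Q \<subseteq> U - D"
  and card_T: "card T \<le> Suc (card {e\<in>E. e \<subseteq> T})"
  and finished: "\<And>u w. u \<in> D - T \<Longrightarrow> w \<in> U \<Longrightarrow> {u, w} \<in> E \<Longrightarrow> w \<in> D - T"
  and active: "\<And>u w. u \<in> T \<Longrightarrow> w \<in> U \<Longrightarrow> {u, w} \<in> E \<Longrightarrow> w \<in> T \<union> Q"
  and stacked: "\<And>q. q \<in> Q \<Longrightarrow> (\<exists>u\<in>T. {u, q} \<in> E) \<or> T = {} \<and> Q = {q}"
  by (insert inv, unfold search_inv_def, (elim conjE, (assumption | erule bspec mp | blast))+)

private lemma finite_T: "finite T" and x_notin_T: "x \<notin> T" and insert_T: "insert x T \<subseteq> U"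
  using sub fin(2) finite_subset[of T U] x by auto

text \<open>\<open>D - T\<close> consists of finished components and is closed under adjacency in
  \<open>U\<close>, so it cannot touch the unvisited \<open>x\<close>.\<close>

private lemma nbr: "y \<in> T" if "y \<in> D" "{x, y} \<in> E"
proof (rule ccontr)
  assume "y \<notin> T"
  moreover have "{y, x} \<in> E" using that by (simp add: insert_commute)
  ultimately have "x \<in> D - T" using that x sub finished[of y x] by blast
  then show False using sub x by blast
qed

text \<open>Two neighbors in \<open>T\<close> would put at least \<open>card T + 1\<close> edges
  inside \<open>insert x T\<close>, a set of just that size. Hence the search itself forbids at most
  one color at \<open>x\<close>.\<close>

lemma search_unique_neighbor:
  assumes "y \<in> D" "y' \<in> D" "{x, y} \<in> E" "{x, y'} \<in> E"
  shows "y = y'"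
proof (rule ccontr)
  assume "y \<noteq> y'"
  have "y \<in> T" "y' \<in> T"
    using nbr assms by blast+
  then have "card {e\<in>E. e \<subseteq> T} + card {y, y'} \<le> card {e\<in>E. e \<subseteq> insert x T}"
    using assms x_notin_T fin by (intro card_edges_insert) auto
  moreover have "card {e\<in>E. e \<subseteq> insert x T} < card (insert x T)"
    using forest insert_T unfolding forest_on_def by blast
  ultimately show False using \<open>y \<noteq> y'\<close> finite_T x_notin_T card_T by simp
qed

text \<open>Both vertices are attached to \<open>T\<close>, so an edge between them would add three
  edges along with only two vertices. Consequently no vertex is pushed twice, the stack stays
  distinct and each vertex is visited once.\<close>

lemma search_stack_independent:
  assumes "w \<in> Q" "{x, w} \<in> E"
  shows False
proof -
  have "w \<noteq> x" using assms loop by auto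
  then have "Q \<noteq> {x}" "Q \<noteq> {w}" using x assms(1) by auto
  then obtain y z where y: "y \<in> T" "{y, x} \<in> E" and z: "z \<in> T" "{z, w} \<in> E"
    using stacked[OF x] stacked[OF assms(1)] by blast
  have y': "{x, y} \<in> E" and z': "{w, z} \<in> E" and w': "{w, x} \<in> E"
    using y z assms by (simp_all add: insert_commute)
  have "card {e\<in>E. e \<subseteq> T} + card {y} \<le> card {e\<in>E. e \<subseteq> insert x T}"
    using y y' x_notin_T fin by (intro card_edges_insert) auto
  moreover have w: "w \<notin> insert x T" "insert w (insert x T) \<subseteq> U"
    using sub assms(1) \<open>w \<noteq> x\<close> insert_T by auto
  then have "card {e\<in>E. e \<subseteq> insert x T} + card {x, z} \<le> card {e\<in>E. e \<subseteq> insert w (insert x T)}"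
    using z z' w' fin by (intro card_edges_insert) auto
  moreover have "card {e\<in>E. e \<subseteq> insert w (insert x T)} < card (insert w (insert x T))"
    using forest w(2) unfolding forest_on_def by blast
  moreover have "x \<noteq> z" using z x_notin_T by auto
  ultimately show False using finite_T x_notin_T w(1) card_T by simp
qed

lemma search_inv_step:
  "search_inv E U (insert x D) (insert x T) (Q - {x} \<union> {y\<in>U - D. {x, y} \<in> E})"
proof -
  let ?Q = "Q - {x} \<union> {y\<in>U - D. {x, y} \<in> E}"
  have card_le: "card (insert x T) \<le> Suc (card {e\<in>E. e \<subseteq> insert x T})"
  proof (cases "T = {}")
    case False
    then obtain y where y: "y \<in> T" "{y, x} \<in> E"
      using stacked[OF x] by blast
    then have "{x, y} \<in> E" by (simp add: insert_commute)
    then have "card {e\<in>E. e \<subseteq> T} + card {y} \<le> card {e\<in>E. e \<subseteq> insert x T}"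
      using y x_notin_T fin by (intro card_edges_insert) auto
    then show ?thesis using finite_T x_notin_T card_T by simp
  qed simp
  have D_T: "insert x D - insert x T = D - T" using sub x by auto
  have 1: "\<forall>z\<in>insert x D - insert x T. \<forall>y\<in>U. {z, y} \<in> E \<longrightarrow> y \<in> insert x D - insert x T"
    unfolding D_T by (intro ballI impI) (rule finished)
  have 2: "\<forall>z\<in>insert x T. \<forall>y\<in>U. {z, y} \<in> E \<longrightarrow> y \<in> insert x T \<union> ?Q"
    using active nbr by blast
  have 3: "?Q \<subseteq> U - insert x D"
    using sub loop by auto
  have 4: "\<forall>q\<in>?Q. (\<exists>z\<in>insert x T. {z, q} \<in> E) \<or> insert x T = {} \<and> ?Q = {q}"
    using stacked x by blast
  have 5: "insert x T \<subseteq> insert x D" "insert x D \<subseteq> U" using sub x by auto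
  show ?thesis unfolding search_inv_def
    by (intro conjI 1 2 3 4 5 card_le)
qed

end

text \<open>With an empty stack \<open>T\<close> is closed under adjacency in \<open>U\<close>;
  replacing it by the empty set moves its vertices to the finished ones.\<close>

lemma search_inv_restart:
  assumes "search_inv E U D T {}" "v \<in> U - D"
  shows "search_inv E U D {} {v}"
proof -
  have 1: "D \<subseteq> U" "T \<subseteq> D" and 2: "\<forall>x\<in>D - T. \<forall>y\<in>U. {x, y} \<in> E \<longrightarrow> y \<in> D - T"
    and 3: "\<forall>x\<in>T. \<forall>y\<in>U. {x, y} \<in> E \<longrightarrow> y \<in> T \<union> {}"
    by (insert assms(1), unfold search_inv_def, (elim conjE, (assumption | blast))+)
  have "\<forall>x\<in>D - {}. \<forall>y\<in>U. {x, y} \<in> E \<longrightarrow> y \<in> D - {}"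
    using 1 2 3 by blast
  then show ?thesis using 1(1) assms(2) unfolding search_inv_def by (intro conjI) simp_all
qed

lemma input_store_adjacency:
  assumes x: "x \<in> {1..n}"
  shows "input_store n adj B 2 (Suc x) = input_store n adj B 2 x + length (adj x)"
    and "k < length (adj x) \<Longrightarrow> input_store n adj B 3 (input_store n adj B 2 x + k) = adj x ! k"
proof -
  let ?off = "\<Sum>u\<in>{1..<x}. length (adj u)"
  have off: "input_store n adj B 2 x = ?off"
    using x by (simp add: input_store_def)
  have "{1..<Suc x} = insert x {1..<x}" using x by auto
  then show "input_store n adj B 2 (Suc x) = input_store n adj B 2 x + length (adj x)"
    using x by (simp add: input_store_def)
  have "[1..<Suc n] = [1..<x] @ x # [Suc x..<Suc n]"
    using x upt_add_eq_append[of 1 x "Suc n - x"] upt_conv_Cons[of x "Suc n"] by auto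
  then have concat: "concat (map adj [1..<Suc n]) =
      concat (map adj [1..<x]) @ adj x @ concat (map adj [Suc x..<Suc n])"
    by simp
  have len: "length (concat (map adj [1..<x])) = ?off"
    by (simp add: length_concat comp_def interv_sum_list_conv_sum_set_nat)
  show "input_store n adj B 3 (input_store n adj B 2 x + k) = adj x ! k"
    if "k < length (adj x)"
  proof -
    have "input_store n adj B 3 i = (if i < length L then L ! i else 0)"
      if "L = concat (map adj [1..<Suc n])" for i L
      unfolding input_store_def that by (simp add: Let_def)
    from this[OF concat[symmetric]] show ?thesis
      using that off len by (simp add: nth_append)
  qed
qed

section \<open>Correctness and running time of the greedy coloring\<close>

context
  fixes n :: nat and E :: "nat set set" and adj :: "nat \<Rightarrow> nat list" and B :: "nat \<Rightarrow> nat option"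
    and U :: "nat set"
  assumes edges: "\<And>e. e \<in> E \<Longrightarrow> \<exists>u\<in>{1..n}. \<exists>v\<in>{1..n}. u \<noteq> v \<and> e = {u, v}"
    and adj: "adjacency_lists n E adj"
    and B_range: "\<And>v c. v \<in> {1..n} \<Longrightarrow> B v = Some c \<Longrightarrow> c \<in> {1..3}"
    and B_proper: "\<And>u v c. {u, v} \<in> E \<Longrightarrow> B u = Some c \<Longrightarrow> B v \<noteq> Some c"
    and B_list: "\<And>x y y' c c'. x \<in> {1..n} \<Longrightarrow> B x = None \<Longrightarrow> {x, y} \<in> E \<Longrightarrow> {x, y'} \<in> E \<Longrightarrow>
       B y = Some c \<Longrightarrow> B y' = Some c' \<Longrightarrow> c = c'"
    and U_def: "U = {v\<in>{1..n}. B v = None}"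
    and forest: "forest_on E U"
begin

private definition done_set :: "store \<Rightarrow> nat set" where
  "done_set st = {v\<in>U. st 1 v \<noteq> 0}"

text \<open>Color 0 means uncolored, so the clause on edges is properness of the partial coloring.
  Array 1 extends \<open>B\<close> throughout, and all vertices before the cursor are
  colored.\<close>

private definition prog_inv :: "store \<Rightarrow> bool" where
  "prog_inv st \<longleftrightarrow> (\<forall>a\<in>{0,2,3}. st a = input_store n adj B a) \<and> 1 \<le> st 4 0 \<and>
     (\<forall>u\<in>{1..n}. u < st 4 0 \<longrightarrow> st 1 u \<noteq> 0) \<and>
     (\<forall>v\<in>{1..n}. st 1 v \<le> 3) \<and> (\<forall>v\<in>{1..n}. \<forall>c. B v = Some c \<longrightarrow> st 1 v = c) \<and>
     (\<forall>u v. {u, v} \<in> E \<longrightarrow> st 1 u = st 1 v \<longrightarrow> st 1 u = 0) \<and>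
     distinct (stack st) \<and> (\<exists>T. search_inv E U (done_set st) T (set (stack st)))"

text \<open>A visit costs at most \<open>6 * length (adj x) + 12\<close> and may empty the stack,
  which restores the bonus 5; hence 18 > 12 + 5. A restart costs at most 4 and releases 5, either by
  advancing the cursor or by filling the stack.\<close>

private definition potential :: "store \<Rightarrow> nat" where
  "potential st = 5 * (Suc n - st 4 0) + (\<Sum>x\<in>U - done_set st. 6 * length (adj x) + 18) +
     (if st 6 0 = 0 then 5 else 0)"

private lemma mem_U: "v \<in> U \<longleftrightarrow> v \<in> {1..n} \<and> B v = None"
  unfolding U_def by simp

private lemma finite_E: "finite E"
proof (rule finite_subset)
  show "E \<subseteq> Pow {1..n}" using edges by blast
qed simp

private lemma no_loop: "{x} \<notin> E"
  using edges[of "{x}"] by (auto simp: doubleton_eq_iff)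

private lemma edge_range: "{x, y} \<in> E \<Longrightarrow> x \<in> {1..n} \<and> y \<in> {1..n}"
  using edges[of "{x, y}"] by (auto simp: doubleton_eq_iff)

private lemma prog_inv_color: "prog_inv st \<Longrightarrow> v \<in> {1..n} \<Longrightarrow> B v = Some c \<Longrightarrow> st 1 v = c"
  and prog_inv_proper: "prog_inv st \<Longrightarrow> {u, v} \<in> E \<Longrightarrow> st 1 u = st 1 v \<Longrightarrow> st 1 u = 0"
  and prog_inv_input: "prog_inv st \<Longrightarrow> a \<in> {0,2,3} \<Longrightarrow> st a = input_store n adj B a"
  and prog_inv_distinct: "prog_inv st \<Longrightarrow> distinct (stack st)"
  unfolding prog_inv_def by blast+

private lemma prog_inv_undecided:
  assumes "prog_inv st" "v \<in> {1..n}" "st 1 v = 0" shows "B v = None"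
proof (cases "B v")
  case (Some c)
  then have "c \<in> {1..3}" "st 1 v = c" using B_range prog_inv_color assms by blast+
  then show ?thesis using assms(3) by simp
qed simp

private lemma visit_step:
  assumes inv: "prog_inv st" and top: "st 6 0 > 0"
  shows "\<exists>t st'. exec greedy_body st t st' \<and> prog_inv st' \<and> t + potential st' < potential st"
proof -
  let ?D = "done_set st"
  obtain q x where q: "stack st = q @ [x]"
    using top stack_eq_Nil_iff[of st] by (cases "stack st" rule: rev_cases) auto
  obtain T where T: "search_inv E U ?D T (set (stack st))"
    using inv unfolding prog_inv_def by blast
  have x: "x \<in> U" "x \<notin> ?D" "x \<in> set (stack st)" "x \<in> {1..n}" "B x = None"
    using T q unfolding search_inv_def by (auto simp: mem_U)
  have finU: "finite U" unfolding U_def by simp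
  note search = finite_E finU forest no_loop T x(3)
  have adj_x: "distinct (adj x)" "set (adj x) = {w. {x, w} \<in> E}"
    using adj x(4) unfolding adjacency_lists_def by auto
  have nbr_cases: "w \<in> ?D \<or> (\<exists>c. B w = Some c \<and> st 1 w = c) \<or> st 1 w = 0" if "{x, w} \<in> E" for w
    using inv edge_range[OF that] unfolding prog_inv_def done_set_def by (cases "B w") (auto simp: mem_U)
  \<comment> \<open>The neighbors of \<open>x\<close> visited by the search forbid one color
    \<open>a\<close>, those decided by \<open>B\<close> one color \<open>b\<close>; a third color is
    always left.\<close>
  have "\<exists>a. \<forall>w. {x, w} \<in> E \<longrightarrow> w \<in> ?D \<longrightarrow> st 1 w = a"
    using search_unique_neighbor[OF search] by (metis (no_types))
  then obtain a where a: "\<And>w. {x, w} \<in> E \<Longrightarrow> w \<in> ?D \<Longrightarrow> st 1 w = a" by blast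
  have "\<exists>b. \<forall>w c. {x, w} \<in> E \<longrightarrow> B w = Some c \<longrightarrow> c = b"
    using B_list[OF x(4,5)] by (metis (no_types))
  then obtain b where b: "\<And>w c. {x, w} \<in> E \<Longrightarrow> B w = Some c \<Longrightarrow> c = b" by blast
  have "\<exists>c\<in>{1,2,3}. c \<noteq> a \<and> c \<noteq> b" by auto
  then obtain c0 where c0: "c0 \<in> {1,2,3}" "c0 \<noteq> a" "c0 \<noteq> b" by blast
  have "\<forall>w\<in>set (adj x). st 1 w \<noteq> c0"
  proof
    fix w assume "w \<in> set (adj x)"
    then have "{x, w} \<in> E" using adj_x by simp
    then show "st 1 w \<noteq> c0" using nbr_cases[of w] a[of w] b[of w] c0 by auto
  qed
  then have free: "\<exists>c\<in>{1,2,3}. \<forall>w\<in>set (adj x). st 1 w \<noteq> c" using c0(1) by blast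
  have input: "\<forall>a\<in>{0,2,3}. st a = input_store n adj B a" using prog_inv_input[OF inv] by blast
  have "\<exists>t st' c. exec greedy_body st t st' \<and> t \<le> 6 * length (adj x) + 12 \<and>
    (\<forall>a\<in>{0,2,3,4}. st' a = st a) \<and> st' 1 = (st 1)(x := c) \<and>
    stack st' = q @ filter (\<lambda>w. st 1 w = 0) (adj x) \<and>
    c \<in> {1,2,3} \<and> (\<forall>w\<in>set (adj x). st 1 w \<noteq> c)"
    by (rule exec_visit[OF top q _ _ free])
       (use input input_store_adjacency[OF x(4), where adj = adj and B = B] in simp_all)
  then obtain t st' c where st': "exec greedy_body st t st'" "t \<le> 6 * length (adj x) + 12"
    "\<forall>a\<in>{0,2,3,4}. st' a = st a" "st' 1 = (st 1)(x := c)"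
    "stack st' = q @ filter (\<lambda>w. st 1 w = 0) (adj x)"
    "c \<in> {1,2,3}" "\<forall>w\<in>set (adj x). st 1 w \<noteq> c" by blast
  have D': "done_set st' = insert x ?D"
    using x st'(4,6) unfolding done_set_def by auto
  have pushed: "set (filter (\<lambda>w. st 1 w = 0) (adj x)) = {y\<in>U - ?D. {x, y} \<in> E}"
  proof -
    have "w \<in> U - ?D" if "{x, w} \<in> E" "st 1 w = 0" for w
    proof -
      have "w \<in> {1..n}" using edge_range that by blast
      moreover from this have "B w = None" using prog_inv_undecided[OF inv] that by blast
      ultimately show ?thesis using that unfolding done_set_def by (simp add: mem_U)
    qed
    then show ?thesis using adj_x unfolding done_set_def by auto
  qed
  note dist = prog_inv_distinct[OF inv]
  have Q: "set q = set (stack st) - {x}" using dist q by auto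
  have "set q \<inter> {y\<in>U - ?D. {x, y} \<in> E} = {}"
    using search_stack_independent[OF search] Q by auto
  then have "distinct (stack st')"
    unfolding st'(5) using dist q adj_x pushed by (auto simp: distinct_filter)
  moreover have "search_inv E U (done_set st') (insert x T) (set (stack st'))"
    unfolding D' st'(5) set_append pushed Q by (rule search_inv_step[OF search])
  moreover have "st' 1 u = 0" if "{u, v} \<in> E" "st' 1 u = st' 1 v" for u v
  proof -
    have "u \<noteq> v" using that(1) no_loop by auto
    have "{v, u} \<in> E" using that(1) by (simp add: insert_commute)
    then have "u = x \<Longrightarrow> st' 1 v \<noteq> c" "v = x \<Longrightarrow> st' 1 u \<noteq> c"
      using that(1) \<open>u \<noteq> v\<close> st'(4,7) adj_x(2) by auto
    then have "u \<noteq> x" "v \<noteq> x" using that(2) st'(4) by auto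
    then show ?thesis using that prog_inv_proper[OF inv that(1)] st'(4) by simp
  qed
  moreover have "st' 1 v = c'" if "v \<in> {1..n}" "B v = Some c'" for v c'
    using that prog_inv_color[OF inv that] x(5) st'(4) by auto
  moreover have "\<forall>u\<in>{1..n}. u < st' 4 0 \<longrightarrow> st' 1 u \<noteq> 0" "\<forall>v\<in>{1..n}. st' 1 v \<le> 3" "1 \<le> st' 4 0"
    using inv st'(3,4,6) unfolding prog_inv_def by auto
  moreover have "\<forall>a\<in>{0,2,3}. st' a = input_store n adj B a" using st'(3) input by simp
  ultimately have "prog_inv st'" unfolding prog_inv_def by blast
  moreover have "t + potential st' < potential st"
  proof -
    have "(\<Sum>x\<in>U - ?D. 6 * length (adj x) + 18) =
        6 * length (adj x) + 18 + (\<Sum>x\<in>U - ?D - {x}. 6 * length (adj x) + 18)"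
      using x finU by (intro sum.remove) auto
    moreover have "U - ?D - {x} = U - done_set st'" unfolding D' by auto
    ultimately show ?thesis unfolding potential_def using st'(2,3) top by simp
  qed
  ultimately show ?thesis using st'(1) by blast
qed

private lemma restart_step:
  assumes inv: "prog_inv st" and top: "st 6 0 = 0" and cur: "st 4 0 \<le> n"
  shows "\<exists>t st'. exec greedy_body st t st' \<and> prog_inv st' \<and> t + potential st' < potential st"
proof -
  obtain t st' where st': "exec greedy_body st t st'" "t \<le> 4" "\<forall>a\<in>{0,1,2,3}. st' a = st a"
    "if st 1 (st 4 0) = 0 then st' 4 = st 4 \<and> stack st' = [st 4 0]
     else st' 4 0 = Suc (st 4 0) \<and> stack st' = []"
    using exec_restart[where st=st] top by blast
  have D': "done_set st' = done_set st" using st'(3) unfolding done_set_def by simp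
  have "stack st = []" using top stack_eq_Nil_iff by blast
  then obtain T where T: "search_inv E U (done_set st) T {}"
    using inv unfolding prog_inv_def by auto
  have v: "st 4 0 \<in> {1..n}" using inv cur unfolding prog_inv_def by auto
  have "\<exists>T. search_inv E U (done_set st') T (set (stack st'))"
  proof (cases "st 1 (st 4 0) = 0")
    case True
    have "B (st 4 0) = None" using prog_inv_undecided[OF inv v True] .
    then have "st 4 0 \<in> U - done_set st" using v True unfolding done_set_def by (simp add: mem_U)
    then show ?thesis using search_inv_restart[OF T] st'(4) True D' by auto
  next
    case False
    then show ?thesis using T st'(4) D' by auto
  qed
  moreover have "\<forall>u\<in>{1..n}. u < st' 4 0 \<longrightarrow> st' 1 u \<noteq> 0" "1 \<le> st' 4 0" "distinct (stack st')"
    using inv st'(3,4) unfolding prog_inv_def by (auto split: if_splits simp: less_Suc_eq)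
  moreover have "\<forall>a\<in>{0,2,3}. st' a = input_store n adj B a" "st' 1 = st 1"
    using inv st'(3) unfolding prog_inv_def by auto
  ultimately have "prog_inv st'" using inv unfolding prog_inv_def by simp
  moreover have "t + potential st' < potential st"
  proof -
    have "st' 6 0 \<noteq> 0 \<and> st' 4 = st 4 \<or> st' 6 0 = 0 \<and> st' 4 0 = Suc (st 4 0)"
      using st'(4) stack_eq_Nil_iff[of st'] by (auto split: if_splits)
    then show ?thesis unfolding potential_def D' using st'(2) top v by auto
  qed
  ultimately show ?thesis using st'(1) by blast
qed

lemma greedy_prog_correct:
  "\<exists>t st. exec greedy_prog (input_store n adj B) t st \<and>
     t \<le> 23 * n + 7 + 6 * (\<Sum>x\<in>U. length (adj x)) \<and>
     proper_coloring 3 {1..n} E (st 1) \<and> (\<forall>v\<in>{1..n}. \<forall>c. B v = Some c \<longrightarrow> st 1 v = c)"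
proof -
  let ?in = "input_store n adj B"
  define st where "st = run (Assign 4 (Num 0) (Num 1)) ?in"
  have init: "exec (Assign 4 (Num 0) (Num 1)) ?in 1 st"
    unfolding st_def using exec.Assign[of 4 "Num 0" "Num 1" ?in] by simp
  have st: "st 1 = (\<lambda>i. if i \<in> {1..n} then (case B i of None \<Rightarrow> 0 | Some c \<Rightarrow> c) else 0)"
    "st 4 0 = 1" "st 6 0 = 0" "\<forall>a\<in>{0,2,3}. st a = ?in a"
    by (auto simp: st_def input_store_def fun_eq_iff)
  have stk: "stack st = []" using st(3) stack_eq_Nil_iff by blast
  have B3: "v \<in> {1..n} \<Longrightarrow> B v = Some c \<Longrightarrow> 1 \<le> c \<and> c \<le> 3" for v c
    using B_range[of v c] by auto
  have D: "done_set st = {}" unfolding done_set_def st(1) by (auto simp: mem_U split: option.splits)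
  have "search_inv E U (done_set st) {} (set (stack st))"
    unfolding D stk search_inv_def by simp
  moreover have "\<forall>v\<in>{1..n}. st 1 v \<le> 3" "\<forall>v\<in>{1..n}. \<forall>c. B v = Some c \<longrightarrow> st 1 v = c"
    unfolding st(1) using B3 by (auto split: option.splits)
  moreover have "\<forall>u v. {u, v} \<in> E \<longrightarrow> st 1 u = st 1 v \<longrightarrow> st 1 u = 0"
    unfolding st(1) using B_proper edge_range by (auto split: option.splits)
  ultimately have inv: "prog_inv st"
    unfolding prog_inv_def using st(2,4) stk by auto
  have "\<exists>t st'. exec (Loop (Neg (Less (At 0 (Num 0)) cur)) greedy_body) st t st' \<and>
      prog_inv st' \<and> \<not> eval_test (Neg (Less (At 0 (Num 0)) cur)) st' \<and> t \<le> Suc (potential st)"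
  proof (rule exec_loop_potential[where I = prog_inv, OF _ inv])
    fix s assume s: "prog_inv s" "eval_test (Neg (Less (At 0 (Num 0)) cur)) s"
    have "s 0 0 = n" using s(1) unfolding prog_inv_def by (simp add: input_store_def)
    then have "s 4 0 \<le> n" using s(2) by simp
    then show "\<exists>t st'. exec greedy_body s t st' \<and> prog_inv st' \<and> t + potential st' < potential s"
      using visit_step[OF s(1)] restart_step[OF s(1)] by (cases "s 6 0 = 0") auto
  qed
  then obtain t st' where st': "exec (Loop (Neg (Less (At 0 (Num 0)) cur)) greedy_body) st t st'"
    "prog_inv st'" "\<not> eval_test (Neg (Less (At 0 (Num 0)) cur)) st'" "t \<le> Suc (potential st)"
    by blast
  have "exec greedy_prog ?in (1 + t) st'"
    unfolding greedy_prog_def by (rule exec.Seq[OF init st'(1)])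
  \<comment> \<open>The initial potential contributes 5n + 5 and at most 18n beyond the list
    lengths; the assignment and the failing test contribute 2.\<close>
  moreover have "1 + t \<le> 23 * n + 7 + 6 * (\<Sum>x\<in>U. length (adj x))"
  proof -
    have "card U \<le> card {1..n}" unfolding U_def by (intro card_mono) auto
    then have "(\<Sum>x\<in>U. 6 * length (adj x) + 18) \<le> 6 * (\<Sum>x\<in>U. length (adj x)) + 18 * n"
      by (simp add: sum.distrib sum_distrib_left)
    then show ?thesis using st'(4) unfolding potential_def D st by simp
  qed
  moreover have "st' 0 0 = n" using st'(2) unfolding prog_inv_def by (simp add: input_store_def)
  then have all: "u \<in> {1..n} \<Longrightarrow> st' 1 u \<noteq> 0" for u
    using st'(2,3) unfolding prog_inv_def by simp
  have "proper_coloring 3 {1..n} E (st' 1)"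
    unfolding proper_coloring_def
  proof (intro conjI ballI impI)
    fix v assume "v \<in> {1..n}"
    then show "st' 1 v \<in> {1..3}"
      using all[of v] st'(2) unfolding prog_inv_def by auto
  next
    fix u v assume "u \<in> {1..n}" "{u, v} \<in> E"
    then show "st' 1 u \<noteq> st' 1 v" using all[of u] prog_inv_proper[OF st'(2), of u v] by auto
  qed
  moreover have "\<forall>v\<in>{1..n}. \<forall>c. B v = Some c \<longrightarrow> st' 1 v = c"
    using st'(2) unfolding prog_inv_def by blast
  ultimately show ?thesis by blast
qed

end

section \<open>Convergence of the message passing\<close>

definition nbs :: "nat set set \<Rightarrow> nat \<Rightarrow> nat set" where
  "nbs E x = {y. {x, y} \<in> E}"

definition msg :: "messages \<Rightarrow> nat \<Rightarrow> nat \<Rightarrow> nat option" where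
  "msg s x y = to_edge s x {x, y}"

text \<open>\<open>None\<close> would need two zero counts, but only the strict minimum can be zero;
  and a strict minimum leaves no tie to break.\<close>

lemma decision_strict_min:
  assumes "decision 3 1 N r" "i \<in> {1..3}" "\<And>j. j \<in> {1..3} \<Longrightarrow> j \<noteq> i \<Longrightarrow> N i < N j"
  shows "r = Some i"
proof -
  have "\<not> (\<exists>l\<in>{1..3}. \<exists>m\<in>{1..3}. l \<noteq> m \<and> N l < 1 \<and> N m < 1)"
    using assms(3) by (metis less_one not_less_zero)
  then obtain l where "l \<in> {1..3}" "r = Some l" "\<forall>t\<in>{1..3}. N l \<le> N t"
    using assms(1) unfolding decision_def by (metis (no_types, lifting))
  then show ?thesis using assms(2,3) by (metis leD)
qed

text \<open>Once no message carries the color \<open>i\<close>, the nondeterministic rule has a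
  single outcome: either \<open>i\<close> is the only color with count zero, or there are two such
  colors and the result is \<open>None\<close>.\<close>

lemma decision_zero:
  assumes "decision 3 1 N r" "i \<in> {1..3}" "N i = 0"
  shows "r = (if \<forall>j\<in>{1..3}. j \<noteq> i \<longrightarrow> N j \<noteq> 0 then Some i else None)"
proof (cases "\<forall>j\<in>{1..3}. j \<noteq> i \<longrightarrow> N j \<noteq> 0")
  case True
  then show ?thesis using decision_strict_min[OF assms(1,2)] assms(3) by auto
next
  case False
  then obtain j where "j \<in> {1..3}" "i \<noteq> j" "N j = 0" by auto
  then have "\<exists>l\<in>{1..3}. \<exists>m\<in>{1..3}. l \<noteq> m \<and> N l < 1 \<and> N m < 1"
    using assms(2,3) by (intro bexI[of _ i] bexI[of _ j]) auto
  then have "r = None" using assms(1) unfolding decision_def by meson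
  then show ?thesis using False by auto
qed

lemma gallager_step_same:
  assumes "gallager_step k \<tau> E s s'" "same_messages E s s'"
  shows "gallager_step k \<tau> E s' s'"
proof -
  have "to_edge s' y C = to_edge s y C" if "C \<in> E" "y \<in> C" for C y
    using assms(2) that unfolding same_messages_def by simp
  then show ?thesis using assms(1) unfolding gallager_step_def by simp
qed

text \<open>Because of ties, a repeated state need not be repeated again in \<open>\<rho>\<close>;
  but repeating it forever is a legal continuation, as a step reads only the messages to edges of
  its starting state.\<close>

lemma execution_freeze:
  assumes "gallager_execution k \<tau> E \<alpha> \<rho>" "same_messages E (\<rho> t) (\<rho> (Suc t))"
  shows "gallager_execution k \<tau> E \<alpha> (\<lambda>r. if r \<le> t then \<rho> r else \<rho> (Suc t))"
  using assms gallager_step_same[of k \<tau> E "\<rho> t" "\<rho> (Suc t)"]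
  unfolding gallager_execution_def by (auto simp: not_less_eq_eq le_Suc_eq)

text \<open>The deterministic situation. \<open>h\<close> is a depth in a rooted forest on
  \<open>Z\<close>: by \<open>h_edge\<close> and \<open>h_unique\<close> each edge inside
  \<open>Z\<close> joins a vertex to its parent, and there is at most one parent.\<close>

locale planted_core =
  fixes n :: nat and E :: "nat set set" and f :: "nat \<Rightarrow> nat" and Z :: "nat set"
    and h :: "nat \<Rightarrow> nat" and M :: nat and d :: real
  assumes cross: "E \<subseteq> cross_pairs n f"
    and f_range: "\<And>x. x \<in> {1..n} \<Longrightarrow> f x \<in> {1..3}"
    and Z_sub: "Z \<subseteq> {1..n}"
    and high: "\<And>x j. x \<in> {1..n} - Z \<Longrightarrow> j \<in> {1..3} \<Longrightarrow> j \<noteq> f x \<Longrightarrow>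
      d / 4 \<le> real (card {y\<in>nbs E x. f y = j})"
    and few: "\<And>x. x \<in> {1..n} - Z \<Longrightarrow> real (card (nbs E x \<inter> Z)) < d / 17"
    and expansion: "\<And>F. F \<subseteq> {1..n} \<Longrightarrow> 120 * card F \<le> n \<Longrightarrow>
      2 * card {x\<in>{1..n}. d / 17 \<le> real (card (nbs E x \<inter> F))} \<le> card F"
    and h_edge: "\<And>x y. x \<in> Z \<Longrightarrow> y \<in> Z \<Longrightarrow> {x, y} \<in> E \<Longrightarrow> h x \<noteq> h y"
    and h_unique: "\<And>x y y'. x \<in> Z \<Longrightarrow> y \<in> nbs E x \<inter> Z \<Longrightarrow> y' \<in> nbs E x \<inter> Z \<Longrightarrow>
      h y < h x \<Longrightarrow> h y' < h x \<Longrightarrow> y = y'"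
    and h_bound: "\<And>x. x \<in> Z \<Longrightarrow> h x \<le> M"
    and d_large: "d \<ge> 100"
begin

lemma edge:
  assumes "{x, y} \<in> E"
  shows "x \<in> {1..n}" "y \<in> {1..n}" "f x \<noteq> f y" "x \<noteq> y" "{y, x} \<in> E"
  using assms subsetD[OF cross assms]
  unfolding cross_pairs_def by (auto simp: doubleton_eq_iff insert_commute)

lemma nbs_iff: "y \<in> nbs E x \<longleftrightarrow> {x, y} \<in> E"
  by (simp add: nbs_def)

lemma finite_nbs [simp]: "finite (nbs E x)"
  by (rule finite_subset[of _ "{1..n}"]) (use edge in \<open>auto simp: nbs_iff\<close>)

lemma card_incident: "card {C\<in>E. x \<in> C \<and> P C} = card {w\<in>nbs E x. P {x, w}}"
proof -
  have "{C\<in>E. x \<in> C \<and> P C} = (\<lambda>w. {x, w}) ` {w\<in>nbs E x. P {x, w}}"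
  proof (intro equalityI subsetI)
    fix C assume C: "C \<in> {C\<in>E. x \<in> C \<and> P C}"
    then obtain u v where "C = {u, v}" using cross unfolding cross_pairs_def by blast
    then obtain w where "C = {x, w}" using C by (metis (no_types, lifting) CollectD empty_iff insert_commute insert_iff)
    then show "C \<in> (\<lambda>w. {x, w}) ` {w\<in>nbs E x. P {x, w}}" using C by (auto simp: nbs_def)
  qed (auto simp: nbs_def)
  moreover have "inj_on (\<lambda>w. {x, w}) {w\<in>nbs E x. P {x, w}}"
    by (auto simp: inj_on_def doubleton_eq_iff)
  ultimately show ?thesis by (simp add: card_image)
qed

definition tally :: "messages \<Rightarrow> nat \<Rightarrow> nat \<Rightarrow> nat \<Rightarrow> nat" where
  "tally s x y b = card {w\<in>nbs E x. w \<noteq> y \<and> msg s w x = Some b}"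

lemma step_to_vertex:
  assumes "gallager_step 3 1 E s s'" "{x, w} \<in> E"
  shows "to_vertex s' {x, w} x = msg s w x"
  using assms edge(4)[OF assms(2)]
  unfolding gallager_step_def msg_def by (auto simp: insert_commute)

lemma step_msg:
  assumes "gallager_step 3 1 E s s'" "{x, y} \<in> E"
  shows "decision 3 1 (tally s x y) (msg s' x y)"
proof -
  have "decision 3 1 (\<lambda>b. card {C'\<in>E. x \<in> C' \<and> C' \<noteq> {x, y} \<and> to_vertex s' C' x = Some b})
      (msg s' x y)"
    using assms unfolding gallager_step_def msg_def by simp
  moreover have "card {C'\<in>E. x \<in> C' \<and> C' \<noteq> {x, y} \<and> to_vertex s' C' x = Some b} = tally s x y b" for b
  proof -
    have "{w\<in>nbs E x. {x, w} \<noteq> {x, y} \<and> to_vertex s' {x, w} x = Some b} =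
        {w\<in>nbs E x. w \<noteq> y \<and> msg s w x = Some b}"
      using step_to_vertex[OF assms(1)] by (auto simp: nbs_def doubleton_eq_iff)
    then show ?thesis
      unfolding tally_def using card_incident[of x "\<lambda>C'. C' \<noteq> {x, y} \<and> to_vertex s' C' x = Some b"]
      by simp
  qed
  ultimately show ?thesis by simp
qed

end

section \<open>Errors die out outside \<open>Z\<close>, then messages settle inside
  \<open>Z\<close>\<close>

locale planted_execution = planted_core +
  fixes \<phi> :: "nat \<Rightarrow> nat" and \<rho> :: "nat \<Rightarrow> messages"
  assumes close: "120 * card {v\<in>{1..n}. \<phi> v \<noteq> f v} \<le> n"
    and exec: "gallager_execution 3 1 E \<phi> \<rho>"
begin

lemma step: "gallager_step 3 1 E (\<rho> t) (\<rho> (Suc t))"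
  using exec unfolding gallager_execution_def by blast

text \<open>Senders in \<open>Z\<close> are left out: nothing is known about them during the halving
  phase, and \<open>few\<close> accounts for them as if all were wrong.\<close>

definition bad :: "nat \<Rightarrow> nat set" where
  "bad t = {x\<in>{1..n} - Z. \<exists>y. {x, y} \<in> E \<and> msg (\<rho> t) x y \<noteq> Some (f x)}"

lemma bad_0: "bad 0 \<subseteq> {v\<in>{1..n}. \<phi> v \<noteq> f v}"
  using exec unfolding gallager_execution_def gallager_init_def bad_def msg_def by auto

lemma finite_bad [simp]: "finite (bad t)"
  unfolding bad_def by simp

text \<open>Otherwise fewer than 2d/17 neighbors lie in \<open>Z\<close> or are bad, and only these
  can send \<open>f x\<close>. Each other color loses at most these and the recipient
  \<open>y\<close> from its d/4 neighbors. As 4d/17 + 1 < d/4 for d >= 100, the own color is the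
  strict minimum.\<close>

lemma bad_Suc: "bad (Suc t) \<subseteq> {x\<in>{1..n}. d / 17 \<le> real (card (nbs E x \<inter> bad t))}"
proof
  fix x assume x: "x \<in> bad (Suc t)"
  then obtain y where y: "{x, y} \<in> E" "msg (\<rho> (Suc t)) x y \<noteq> Some (f x)" "x \<in> {1..n} - Z"
    unfolding bad_def by auto
  have "d / 17 \<le> real (card (nbs E x \<inter> bad t))"
  proof (rule ccontr)
    assume "\<not> ?thesis"
    then have a: "real (card (nbs E x \<inter> bad t)) + real (card (nbs E x \<inter> Z)) < 2 * d / 17"
      using few[OF y(3)] by simp
    have fin: "finite (nbs E x \<inter> bad t)" "finite (nbs E x \<inter> Z)" by auto
    let ?N = "tally (\<rho> t) x y"
    have good: "msg (\<rho> t) w x = Some (f w)" if "{x, w} \<in> E" "w \<notin> Z" "w \<notin> bad t" for w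
      using that edge[OF that(1)] unfolding bad_def by auto
    have "?N (f x) \<le> card ((nbs E x \<inter> bad t) \<union> (nbs E x \<inter> Z))"
      unfolding tally_def
    proof (intro card_mono subsetI)
      fix w assume "w \<in> {w\<in>nbs E x. w \<noteq> y \<and> msg (\<rho> t) w x = Some (f x)}"
      then have w: "{x, w} \<in> E" "msg (\<rho> t) w x = Some (f x)" by (auto simp: nbs_iff)
      then have "w \<in> Z \<or> w \<in> bad t" using good[OF w(1)] edge(3)[OF w(1)] by auto
      then show "w \<in> (nbs E x \<inter> bad t) \<union> (nbs E x \<inter> Z)" using w by (auto simp: nbs_iff)
    qed simp
    also have "\<dots> \<le> card (nbs E x \<inter> bad t) + card (nbs E x \<inter> Z)" by (rule card_Un_le)
    finally have Ni: "real (?N (f x)) < 2 * d / 17" using a by linarith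
    have "?N (f x) < ?N j" if j: "j \<in> {1..3}" "j \<noteq> f x" for j
    proof -
      \<comment> \<open>\<open>{y}\<close> stands for the recipient, whose own message to
        \<open>x\<close> is excluded from the tally.\<close>
      have "card {w\<in>nbs E x. f w = j} \<le>
          card ({w\<in>nbs E x. w \<noteq> y \<and> msg (\<rho> t) w x = Some j} \<union> ({y} \<union> ((nbs E x \<inter> bad t) \<union> (nbs E x \<inter> Z))))"
        using good by (intro card_mono) (auto simp flip: nbs_iff)
      also have "\<dots> \<le> ?N j + card ({y} \<union> ((nbs E x \<inter> bad t) \<union> (nbs E x \<inter> Z)))"
        unfolding tally_def by (rule card_Un_le)
      also have "card ({y} \<union> ((nbs E x \<inter> bad t) \<union> (nbs E x \<inter> Z))) \<le>
          card {y} + card ((nbs E x \<inter> bad t) \<union> (nbs E x \<inter> Z))" by (rule card_Un_le)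
      also have "card ((nbs E x \<inter> bad t) \<union> (nbs E x \<inter> Z)) \<le> card (nbs E x \<inter> bad t) + card (nbs E x \<inter> Z)"
        by (rule card_Un_le)
      finally have "real (card {w\<in>nbs E x. f w = j}) \<le>
          real (?N j + (card {y} + (card (nbs E x \<inter> bad t) + card (nbs E x \<inter> Z))))"
        by (simp only: of_nat_le_iff add_left_mono)
      then have "d / 4 \<le> real (?N j) + 1 + 2 * d / 17"
        using high[OF y(3) j] a by simp
      then show ?thesis using Ni d_large by simp
    qed
    then have "msg (\<rho> (Suc t)) x y = Some (f x)"
      using decision_strict_min[OF step_msg[OF step y(1)]] f_range y(3) by blast
    then show False using y(2) by simp
  qed
  then show "x \<in> {x\<in>{1..n}. d / 17 \<le> real (card (nbs E x \<inter> bad t))}"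
    using y(3) by simp
qed

text \<open>The first conjunct keeps \<open>bad t\<close> small enough for \<open>expansion\<close>
  to apply in the next round.\<close>

lemma bad_halves: "120 * card (bad t) \<le> n \<and> 2 ^ t * card (bad t) \<le> n"
proof (induction t)
  case 0
  have "card (bad 0) \<le> card {v\<in>{1..n}. \<phi> v \<noteq> f v}"
    by (intro card_mono bad_0) simp
  then show ?case using close by simp
next
  case (Suc t)
  have "card (bad (Suc t)) \<le> card {x\<in>{1..n}. d / 17 \<le> real (card (nbs E x \<inter> bad t))}"
    by (intro card_mono bad_Suc) simp
  moreover have "2 * card {x\<in>{1..n}. d / 17 \<le> real (card (nbs E x \<inter> bad t))} \<le> card (bad t)"
    using Suc by (intro expansion) (auto simp: bad_def)
  ultimately have *: "2 * card (bad (Suc t)) \<le> card (bad t)" by linarith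
  have "2 ^ Suc t * card (bad (Suc t)) = 2 ^ t * (2 * card (bad (Suc t)))" by simp
  also have "\<dots> \<le> 2 ^ t * card (bad t)" using * by (intro mult_left_mono) auto
  finally show ?case using Suc * by linarith
qed

lemma core_correct:
  assumes "n < 2 ^ L" "L \<le> t" "{x, y} \<in> E" "x \<notin> Z"
  shows "msg (\<rho> t) x y = Some (f x)"
proof -
  have "(2::nat) ^ L \<le> 2 ^ t" using assms(2) by (intro power_increasing) auto
  then have "n < 2 ^ t" using assms(1) by linarith
  then have "card (bad t) = 0" using bad_halves[of t]
    by (cases "card (bad t)") auto
  then have "bad t = {}" by simp
  then show ?thesis using assms edge(1)[OF assms(3)] unfolding bad_def by blast
qed

text \<open>The number of iterations after which the message from \<open>x\<close> to the edge between \<open>x\<close> and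
  \<open>y\<close> is final: messages towards the root of a tree settle from the leaves upwards, and
  afterwards the other ones settle from the root downwards.\<close>

definition delay :: "nat \<Rightarrow> nat \<Rightarrow> nat" where
  "delay x y = (if y \<in> Z \<and> h y < h x then Suc M - h x else M + 2 + h x)"

text \<open>A message to the parent depends only on messages from children, whose larger
  \<open>h\<close> gives a smaller \<open>Suc M - h\<close>. A message away from the root depends on
  the parent, of smaller \<open>h\<close>, and on upward messages from other children, all of delay
  at most \<open>M + 1\<close>; the offset \<open>M + 2\<close> separates the two phases.\<close>

lemma delay_less:
  assumes "x \<in> Z" "w \<in> Z" "{x, w} \<in> E" "{x, y} \<in> E" "w \<noteq> y"
  shows "delay w x < delay x y"
proof -
  have "h w \<noteq> h x" using h_edge assms by metis
  moreover have "h x < h w" if "y \<in> Z" "h y < h x"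
    using h_unique[of x w y] assms that \<open>h w \<noteq> h x\<close> by (force simp: nbs_iff)
  ultimately show ?thesis
    using h_bound[OF assms(1)] h_bound[OF assms(2)] assms(1) unfolding delay_def by auto
qed

text \<open>By induction the other messages reaching \<open>x\<close> are constant and correct or
  \<open>None\<close>. Neighbors have a color other than \<open>f x\<close>, so the tally at
  \<open>f x\<close> is zero and \<open>decision_zero\<close> fixes the result, with no room for
  ties.\<close>

lemma msg_settles:
  assumes L: "n < 2 ^ L" and "{x, y} \<in> E" "x \<in> Z" "delay x y \<le> j" "L + j \<le> t"
  shows "msg (\<rho> t) x y = msg (\<rho> (L + j)) x y \<and> msg (\<rho> t) x y \<in> {None, Some (f x)}"
  using assms(2-)
proof (induction j arbitrary: x y t)
  case 0
  \<comment> \<open>Every delay is positive because \<open>h x \<le> M\<close>, so this case is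
    vacuous.\<close>
  then show ?case using h_bound[OF 0(2)] unfolding delay_def by (auto split: if_splits)
next
  case (Suc j)
  have in_fixed: "msg (\<rho> r) w x = msg (\<rho> (L + j)) w x \<and> msg (\<rho> r) w x \<in> {None, Some (f w)}"
    if w: "{x, w} \<in> E" "w \<noteq> y" and r: "L + j \<le> r" for w r
  proof (cases "w \<in> Z")
    case True
    have "delay w x \<le> j" using delay_less[of x w y] Suc.prems True w by simp
    then show ?thesis using Suc.IH[of w x r] True edge(5)[OF w(1)] r by blast
  next
    case False
    then show ?thesis using core_correct[OF L _ edge(5)[OF w(1)]] r by simp
  qed
  have N: "tally (\<rho> r) x y = tally (\<rho> (L + j)) x y" "tally (\<rho> r) x y (f x) = 0"
    if r: "L + j \<le> r" for r
  proof -
    have "{w\<in>nbs E x. w \<noteq> y \<and> msg (\<rho> r) w x = Some b} =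
        {w\<in>nbs E x. w \<noteq> y \<and> msg (\<rho> (L + j)) w x = Some b}" for b
      using in_fixed[OF _ _ r] by (auto simp: nbs_iff)
    then show "tally (\<rho> r) x y = tally (\<rho> (L + j)) x y"
      unfolding tally_def by (intro ext) simp
    have "{w\<in>nbs E x. w \<noteq> y \<and> msg (\<rho> r) w x = Some (f x)} = {}"
      using in_fixed[OF _ _ r] edge(3) by (fastforce simp: nbs_iff)
    then show "tally (\<rho> r) x y (f x) = 0" unfolding tally_def by simp
  qed
  have val: "msg (\<rho> (Suc r)) x y =
      (if \<forall>b\<in>{1..3}. b \<noteq> f x \<longrightarrow> tally (\<rho> (L + j)) x y b \<noteq> 0 then Some (f x) else None)"
    if r: "L + j \<le> r" for r
    using decision_zero[OF step_msg[OF step Suc.prems(1)] f_range[OF edge(1)[OF Suc.prems(1)]] N(2)[OF r]]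
    unfolding N(1)[OF r] .
  obtain r where r: "t = Suc r" "L + j \<le> r"
    using Suc.prems(4) by (cases t) auto
  show ?case using val[OF r(2)] val[of "L + j"] r(1) by auto
qed

lemma msg_final:
  assumes L: "n < 2 ^ L" and "{x, y} \<in> E" "L + 2 * M + 2 \<le> t"
  shows "msg (\<rho> t) x y = msg (\<rho> (L + 2 * M + 2)) x y" "msg (\<rho> t) x y \<in> {None, Some (f x)}"
    "x \<notin> Z \<Longrightarrow> msg (\<rho> t) x y = Some (f x)"
proof -
  have "delay x y \<le> 2 * M + 2" if "x \<in> Z"
    using h_bound[OF that] unfolding delay_def by auto
  then show "msg (\<rho> t) x y = msg (\<rho> (L + 2 * M + 2)) x y" "msg (\<rho> t) x y \<in> {None, Some (f x)}"
    "x \<notin> Z \<Longrightarrow> msg (\<rho> t) x y = Some (f x)"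
    using msg_settles[OF L assms(2), of "2 * M + 2" t] core_correct[OF L _ assms(2)] assms(3)
    by (cases "x \<in> Z"; simp)+
qed

definition final :: "messages \<Rightarrow> bool" where
  "final s \<longleftrightarrow> gallager_step 3 1 E s s \<and>
     (\<forall>x y. {x, y} \<in> E \<longrightarrow> msg s x y \<in> {None, Some (f x)} \<and> (x \<notin> Z \<longrightarrow> msg s x y = Some (f x)))"

text \<open>One iteration beyond \<open>msg_final\<close>, since a message to a vertex repeats the
  message to the edge from the preceding iteration.\<close>

lemma final_late:
  assumes L: "n < 2 ^ L" and t: "L + 2 * M + 3 \<le> t"
  shows "same_messages E (\<rho> t) (\<rho> (Suc t))" "final (\<rho> (Suc t))"
proof -
  obtain r where r: "t = Suc r" "L + 2 * M + 2 \<le> r" using t by (cases t) auto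
  show same: "same_messages E (\<rho> t) (\<rho> (Suc t))"
    unfolding same_messages_def
  proof (intro ballI)
    fix C x assume C: "C \<in> E" "x \<in> C"
    then obtain u v where "C = {u, v}" using cross unfolding cross_pairs_def by blast
    then obtain y where y: "C = {x, y}" using C by auto
    then have xy: "{x, y} \<in> E" using C by simp
    have "msg (\<rho> t) x y = msg (\<rho> (Suc t)) x y" "msg (\<rho> r) y x = msg (\<rho> t) y x"
      using msg_final(1)[OF L xy, of t] msg_final(1)[OF L xy, of "Suc t"]
        msg_final(1)[OF L edge(5)[OF xy], of r] msg_final(1)[OF L edge(5)[OF xy], of t] r
      by (simp_all del: One_nat_def)
    then show "to_edge (\<rho> t) x C = to_edge (\<rho> (Suc t)) x C \<and>
        to_vertex (\<rho> t) C x = to_vertex (\<rho> (Suc t)) C x"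
      using step_to_vertex[OF step xy, of t] step_to_vertex[OF step xy, of r] r(1)
      unfolding y msg_def by simp
  qed
  show "final (\<rho> (Suc t))"
    unfolding final_def
    using gallager_step_same[OF step same] msg_final(2,3)[OF L, where t = "Suc t"] t by simp
qed

text \<open>The first repetition may come before the time at which \<open>final_late\<close> applies
  to \<open>\<rho>\<close>. The run frozen there is an execution too, and its late states coincide
  with the halting state.\<close>

lemma halts:
  assumes L: "n < 2 ^ L"
  shows "\<exists>T\<le>L + 2 * M + 4. halts_after E \<rho> T \<and> final (\<rho> T)"
proof -
  define stable where "stable = (\<lambda>t. same_messages E (\<rho> t) (\<rho> (Suc t)))"
  define t where "t = (LEAST t. stable t)"
  let ?T0 = "L + 2 * M + 3"
  have s0: "stable ?T0" unfolding stable_def using final_late(1)[OF L order_refl] .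
  have "stable t" unfolding t_def by (rule LeastI[where P = stable, OF s0])
  then have t: "same_messages E (\<rho> t) (\<rho> (Suc t))" unfolding stable_def .
  have t_le: "t \<le> ?T0" unfolding t_def by (rule Least_le[where P = stable, OF s0])
  have "\<not> same_messages E (\<rho> r) (\<rho> (Suc r))" if "r < t" for r
    using not_less_Least[of r stable] that unfolding t_def stable_def by simp
  then have "halts_after E \<rho> (Suc t)"
    unfolding halts_after_def using t by blast
  moreover have "final (\<rho> (Suc t))"
  proof -
    interpret frozen: planted_execution n E f Z h M d \<phi> "\<lambda>r. if r \<le> t then \<rho> r else \<rho> (Suc t)"
      by unfold_locales (use close execution_freeze[OF exec t] in auto)
    show ?thesis using frozen.final_late(2)[OF L order_refl] t_le by simp
  qed
  ultimately show ?thesis using t_le by (intro exI[of _ "Suc t"]) auto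
qed

end

section \<open>The output of a stationary state\<close>

context planted_core begin

context
  fixes s :: messages and B :: "nat \<Rightarrow> nat option"
  assumes step: "gallager_step 3 1 E s s"
    and correct: "\<And>x y. {x, y} \<in> E \<Longrightarrow> msg s x y \<in> {None, Some (f x)}"
    and core: "\<And>x y. {x, y} \<in> E \<Longrightarrow> x \<notin> Z \<Longrightarrow> msg s x y = Some (f x)"
    and out: "gallager_output n 3 1 E s B"
begin

lemma output_decision:
  assumes "x \<in> {1..n}"
  shows "decision 3 1 (\<lambda>b. card {w\<in>nbs E x. msg s w x = Some b}) (B x)"
proof -
  have "card {C\<in>E. x \<in> C \<and> to_vertex s C x = Some b} = card {w\<in>nbs E x. msg s w x = Some b}" for b
    using card_incident[of x "\<lambda>C. to_vertex s C x = Some b"] step_to_vertex[OF step]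
    by (simp add: nbs_def cong: conj_cong)
  then have "(\<lambda>b. card {C\<in>E. x \<in> C \<and> to_vertex s C x = Some b}) =
      (\<lambda>b. card {w\<in>nbs E x. msg s w x = Some b})"
    by (rule ext)
  moreover have "decision 3 1 (\<lambda>b. card {C\<in>E. x \<in> C \<and> to_vertex s C x = Some b}) (B x)"
    using out assms unfolding gallager_output_def by blast
  ultimately show ?thesis by (simp only:)
qed

lemma output_eq:
  assumes "x \<in> {1..n}"
  shows "B x = (if \<forall>j\<in>{1..3}. j \<noteq> f x \<longrightarrow> (\<exists>w. {x, w} \<in> E \<and> msg s w x = Some j) then Some (f x) else None)"
proof -
  have zero: "card {w\<in>nbs E x. msg s w x = Some j} = 0 \<longleftrightarrow> \<not> (\<exists>w. {x, w} \<in> E \<and> msg s w x = Some j)" for j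
    by (auto simp: nbs_def[symmetric] nbs_iff)
  \<comment> \<open>A neighbor sends its planted color or nothing, and its planted color differs
    from \<open>f x\<close>.\<close>
  have "card {w\<in>nbs E x. msg s w x = Some (f x)} = 0"
    unfolding zero using correct edge(3,5) by fastforce
  from decision_zero[OF output_decision[OF assms] f_range[OF assms] this]
  show ?thesis unfolding zero by simp
qed

lemma output_correct: "x \<in> {1..n} \<Longrightarrow> B x = None \<or> B x = Some (f x)"
  using output_eq by auto

text \<open>If a color \<open>j\<close> did not reach \<open>x\<close>, all neighbors of class
  \<open>j\<close> would lie in \<open>Z\<close>: at least d/4 of them, against fewer than
  d/17.\<close>

lemma output_core:
  assumes "x \<in> {1..n}" "x \<notin> Z"
  shows "B x = Some (f x)"
proof -
  have "\<exists>w. {x, w} \<in> E \<and> msg s w x = Some j" if j: "j \<in> {1..3}" "j \<noteq> f x" for j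
  proof (rule ccontr)
    assume no: "\<not> ?thesis"
    have "card {w\<in>nbs E x. f w = j} \<le> card (nbs E x \<inter> Z)"
    proof (intro card_mono subsetI)
      fix w assume "w \<in> {w\<in>nbs E x. f w = j}"
      then have w: "{x, w} \<in> E" "f w = j" by (auto simp: nbs_iff)
      then show "w \<in> nbs E x \<inter> Z" using no core[OF edge(5)[OF w(1)]] by (auto simp: nbs_iff)
    qed simp
    then show False using high[of x j] few[of x] assms j d_large by simp
  qed
  then show ?thesis using output_eq[OF assms(1)] by simp
qed

text \<open>An undecided \<open>x\<close> also sends Undecided to every neighbor \<open>y\<close>. Hence if \<open>y\<close> is decided, it
  would be so without \<open>x\<close>, and therefore sends its color to \<open>x\<close>.\<close>

lemma decided_neighbor_msg:
  assumes xy: "{x, y} \<in> E" and "B x = None" "B y \<noteq> None"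
  shows "msg s y x = Some (f y)"
proof -
  have range: "x \<in> {1..n}" "y \<in> {1..n}" "{y, x} \<in> E" using edge[OF xy] by auto
  have z: "tally s u v (f u) = 0" for u v
  proof -
    have "msg s w u \<noteq> Some (f u)" if "{u, w} \<in> E" for w
      using correct[OF edge(5)[OF that]] edge(3)[OF that] by auto
    then have "{w\<in>nbs E u. w \<noteq> v \<and> msg s w u = Some (f u)} = {}" by (auto simp: nbs_iff)
    then show ?thesis unfolding tally_def by (simp only: card.empty)
  qed
  obtain j where j: "j \<in> {1..3}" "j \<noteq> f x" "\<not> (\<exists>w. {x, w} \<in> E \<and> msg s w x = Some j)"
    using assms(2) unfolding output_eq[OF range(1)] by (metis option.distinct(1))
  then have "{w\<in>nbs E x. w \<noteq> y \<and> msg s w x = Some j} = {}" by (auto simp: nbs_iff)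
  then have "tally s x y j = 0" unfolding tally_def by (simp only: card.empty)
  then have None: "msg s x y = None"
    using decision_zero[OF step_msg[OF step xy] f_range[OF range(1)] z] j(1,2) by (metis (full_types))
  have "tally s y x b \<noteq> 0" if b: "b \<in> {1..3}" "b \<noteq> f y" for b
  proof -
    obtain w where w: "{y, w} \<in> E" "msg s w y = Some b"
      using assms(3) b unfolding output_eq[OF range(2)] by metis
    then have "{w\<in>nbs E y. w \<noteq> x \<and> msg s w y = Some b} \<noteq> {}" using None by (auto simp: nbs_iff)
    then show ?thesis unfolding tally_def by (simp add: card_eq_0_iff del: Collect_empty_eq)
  qed
  then show ?thesis
    using decision_zero[OF step_msg[OF step range(3)] f_range[OF range(2)] z] by simp
qed

text \<open>Two different colors would be the two colors other than \<open>f x\<close>. By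
  \<open>decided_neighbor_msg\<close> both are sent to \<open>x\<close>, which would then be
  decided.\<close>

lemma undecided_neighbors:
  assumes "B x = None" "{x, y} \<in> E" "{x, y'} \<in> E" "B y = Some c" "B y' = Some c'"
  shows "c = c'"
proof (rule ccontr)
  assume "c \<noteq> c'"
  have y: "y \<in> {1..n}" "y' \<in> {1..n}" "x \<in> {1..n}" "f x \<noteq> f y" "f x \<noteq> f y'"
    using edge[OF assms(2)] edge[OF assms(3)] by auto
  have c: "c = f y" "c' = f y'" using output_correct y assms by force+
  have m: "msg s y x = Some c" "msg s y' x = Some c'"
    using decided_neighbor_msg assms c by auto
  have "c \<in> {1..3}" "c' \<in> {1..3}" "f x \<in> {1..3}" using f_range y c by auto
  then have third: "j = c \<or> j = c'" if "j \<in> {1..3}" "j \<noteq> f x" for j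
    using that y c \<open>c \<noteq> c'\<close> by auto
  have "\<exists>w. {x, w} \<in> E \<and> msg s w x = Some j" if "j \<in> {1..3}" "j \<noteq> f x" for j
    using third[OF that] m assms(2,3) by blast
  then have "B x = Some (f x)" unfolding output_eq[OF y(3)] by simp
  then show False using assms(1) by simp
qed

end

text \<open>Charge each edge inside \<open>S\<close> to its endpoint of larger \<open>h\<close>. By
  \<open>h_unique\<close> no vertex is charged twice, and a vertex of least \<open>h\<close> is
  never charged.\<close>

lemma forest_on_Z: "forest_on E Z"
  unfolding forest_on_def
proof (intro allI impI)
  fix S assume S: "S \<subseteq> Z" "S \<noteq> {}"
  have fin: "finite S" using S(1) Z_sub finite_subset[of S "{1..n}"] by auto
  define p where "p x = (SOME y. y \<in> nbs E x \<inter> Z \<and> h y < h x)" for x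
  obtain r where r: "r \<in> S" "\<And>x. x \<in> S \<Longrightarrow> h r \<le> h x"
    using ex_min_if_finite[of "h ` S"] fin S(2) by (auto simp: not_less)
  have "{e\<in>E. e \<subseteq> S} \<subseteq> (\<lambda>x. {x, p x}) ` (S - {r})"
  proof
    fix e assume e: "e \<in> {e\<in>E. e \<subseteq> S}"
    then obtain u v where "e = {u, v}" using cross unfolding cross_pairs_def by blast
    moreover have "h u \<noteq> h v" using h_edge[of u v] e calculation S(1) by auto
    ultimately obtain x y where xy: "e = {x, y}" "h y < h x"
      by (metis insert_commute neqE)
    have mem: "x \<in> S" "y \<in> S" "x \<in> Z" "y \<in> nbs E x \<inter> Z" using e xy S(1) by (auto simp: nbs_iff)
    have "p x \<in> nbs E x \<inter> Z \<and> h (p x) < h x"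
      unfolding p_def by (rule someI[of _ y]) (use mem xy in simp)
    then have "p x = y" using h_unique[OF mem(3)] mem(4) xy(2) by blast
    moreover have "x \<noteq> r" using r(2)[OF mem(2)] xy(2) by auto
    ultimately show "e \<in> (\<lambda>x. {x, p x}) ` (S - {r})" using mem(1) xy(1) by auto
  qed
  then have "card {e\<in>E. e \<subseteq> S} \<le> card (S - {r})"
    using surj_card_le[of "S - {r}"] fin by simp
  also have "\<dots> < card S" using fin r(1) by (rule card_Diff1_less)
  finally show "card {e\<in>E. e \<subseteq> S} < card S" .
qed

end

section \<open>The vertices outside the core\<close>

text \<open>A rooted spanning tree of \<open>K\<close> is encoded by its parent map, the root being the fixed point.\<close>

definition tree_edges :: "nat set \<Rightarrow> (nat \<Rightarrow> nat) \<Rightarrow> nat set set" where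
  "tree_edges K \<pi> = (\<lambda>v. {v, \<pi> v}) ` {v\<in>K. \<pi> v \<noteq> v}"

text \<open>\<open>h\<close> is the depth; its growth by one along parents excludes cycles of
  \<open>\<pi>\<close>. The bound by \<open>card K\<close> later turns small components into small
  delays.\<close>

definition rooted_tree :: "nat set set \<Rightarrow> nat set \<Rightarrow> nat \<Rightarrow> (nat \<Rightarrow> nat) \<Rightarrow> (nat \<Rightarrow> nat) \<Rightarrow> bool" where
  "rooted_tree E K r \<pi> h \<longleftrightarrow> finite K \<and> r \<in> K \<and> \<pi> r = r \<and>
     (\<forall>v\<in>K - {r}. \<pi> v \<in> K \<and> {v, \<pi> v} \<in> E \<and> h v = Suc (h (\<pi> v))) \<and> (\<forall>v\<in>K. h v < card K)"

lemma rooted_tree_nonroot: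
  assumes "rooted_tree E K r \<pi> h"
  shows "{v\<in>K. \<pi> v \<noteq> v} = K - {r}"
proof (intro equalityI subsetI)
  fix v assume v: "v \<in> K - {r}"
  then have "h v = Suc (h (\<pi> v))" using assms unfolding rooted_tree_def by blast
  then have "\<pi> v \<noteq> v" by auto
  then show "v \<in> {v\<in>K. \<pi> v \<noteq> v}" using v by simp
qed (use assms in \<open>auto simp: rooted_tree_def\<close>)

lemma rooted_tree_edges:
  assumes "rooted_tree E K r \<pi> h"
  shows "tree_edges K \<pi> \<subseteq> E" "\<pi> \<in> K \<rightarrow> K" "card (tree_edges K \<pi>) = card K - 1"
proof -
  have t: "\<pi> v \<in> K" "{v, \<pi> v} \<in> E" "h v = Suc (h (\<pi> v))" if "v \<in> K - {r}" for v
    using assms that unfolding rooted_tree_def by blast+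
  have r: "finite K" "r \<in> K" "\<pi> r = r" using assms unfolding rooted_tree_def by blast+
  show "tree_edges K \<pi> \<subseteq> E"
    unfolding tree_edges_def rooted_tree_nonroot[OF assms] using t(2) by blast
  show "\<pi> \<in> K \<rightarrow> K"
  proof
    fix v assume "v \<in> K"
    then show "\<pi> v \<in> K" using t(1)[of v] r by (cases "v = r") auto
  qed
  have "inj_on (\<lambda>v. {v, \<pi> v}) (K - {r})"
  proof (rule inj_onI)
    fix u v assume uv: "u \<in> K - {r}" "v \<in> K - {r}" "{u, \<pi> u} = {v, \<pi> v}"
    show "u = v"
    proof (rule ccontr)
      assume "u \<noteq> v"
      then have "u = \<pi> v" "v = \<pi> u" using uv(3) by (auto simp: doubleton_eq_iff)
      then show False using t(3)[OF uv(1)] t(3)[OF uv(2)] by simp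
    qed
  qed
  then show "card (tree_edges K \<pi>) = card K - 1"
    unfolding tree_edges_def rooted_tree_nonroot[OF assms] using r by (simp add: card_image)
qed

lemma rooted_tree_extend:
  assumes t: "rooted_tree E K r \<pi> h" and x: "x \<in> K" "z \<notin> K" "{x, z} \<in> E"
  shows "rooted_tree E (insert z K) r (\<pi>(z := x)) (h(z := Suc (h x)))"
proof -
  have p: "\<pi> v \<in> K" "{v, \<pi> v} \<in> E" "h v = Suc (h (\<pi> v))" if "v \<in> K - {r}" for v
    using t that unfolding rooted_tree_def by blast+
  have r: "finite K" "r \<in> K" "\<pi> r = r" and b: "\<And>v. v \<in> K \<Longrightarrow> h v < card K"
    using t unfolding rooted_tree_def by blast+
  have ne: "\<pi> v \<noteq> z" if "v \<in> K - {r}" for v using p(1)[OF that] x(2) by auto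
  have rz: "r \<noteq> z" using r x(2) by auto
  have xz: "x \<noteq> z" using x by auto
  have "{z, x} \<in> E" using x(3) by (simp add: insert_commute)
  moreover have "h v < Suc (card K)" if "v \<in> K" for v using b[OF that] by simp
  ultimately show ?thesis
    unfolding rooted_tree_def using p r b ne rz xz x by (auto simp: fun_upd_def)
qed

text \<open>A tree in \<open>W\<close> rooted at \<open>r\<close> with the largest number of
  vertices cannot be extended, hence spans the component of \<open>r\<close>.\<close>

lemma rooted_tree_maximal:
  assumes "finite W" "r \<in> W"
  obtains K \<pi> h where "rooted_tree E K r \<pi> h" "K \<subseteq> W"
    "\<And>x y. x \<in> K \<Longrightarrow> y \<in> W \<Longrightarrow> {x, y} \<in> E \<Longrightarrow> y \<in> K"
proof -
  define good where "good K \<longleftrightarrow> K \<subseteq> W \<and> (\<exists>\<pi> h. rooted_tree E K r \<pi> h)" for K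
  have "rooted_tree E {r} r (\<lambda>_. r) (\<lambda>_. 0)" unfolding rooted_tree_def by simp
  then have "good {r}" unfolding good_def using assms(2) by blast
  moreover have "\<And>K. good K \<Longrightarrow> card K \<le> card W"
    unfolding good_def using assms(1) by (auto intro: card_mono)
  ultimately have "\<exists>K. good K \<and> (\<forall>K'. good K' \<longrightarrow> card K' \<le> card K)"
    using ex_has_greatest_nat[of good "{r}" card "Suc (card W)"] by (simp add: less_Suc_eq_le)
  then obtain K where K: "good K" "\<And>K'. good K' \<Longrightarrow> card K' \<le> card K" by blast
  then obtain \<pi> h where t: "rooted_tree E K r \<pi> h" and sub: "K \<subseteq> W" unfolding good_def by blast
  have "y \<in> K" if "x \<in> K" "y \<in> W" "{x, y} \<in> E" for x y
  proof (rule ccontr)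
    assume "y \<notin> K"
    have "good (insert y K)"
      unfolding good_def using rooted_tree_extend[OF t that(1) \<open>y \<notin> K\<close> that(3)] that(2) sub by blast
    moreover have "finite K" using sub assms(1) by (rule finite_subset)
    ultimately show False using K(2)[of "insert y K"] \<open>y \<notin> K\<close> by simp
  qed
  with t sub show ?thesis by (rule that)
qed

definition height_function :: "nat set set \<Rightarrow> nat set \<Rightarrow> nat \<Rightarrow> (nat \<Rightarrow> nat) \<Rightarrow> bool" where
  "height_function E W M h \<longleftrightarrow> (\<forall>x\<in>W. \<forall>y\<in>W. {x, y} \<in> E \<longrightarrow> h x \<noteq> h y) \<and>
    (\<forall>x\<in>W. \<forall>y\<in>W. \<forall>y'\<in>W. {x, y} \<in> E \<longrightarrow> {x, y'} \<in> E \<longrightarrow> h y < h x \<longrightarrow> h y' < h x \<longrightarrow> y = y') \<and>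
    (\<forall>x\<in>W. h x \<le> M)"

lemma height_functionD:
  assumes "height_function E W M h"
  shows "x \<in> W \<Longrightarrow> y \<in> W \<Longrightarrow> {x, y} \<in> E \<Longrightarrow> h x \<noteq> h y"
    and "x \<in> W \<Longrightarrow> y \<in> W \<Longrightarrow> y' \<in> W \<Longrightarrow> {x, y} \<in> E \<Longrightarrow> {x, y'} \<in> E \<Longrightarrow>
      h y < h x \<Longrightarrow> h y' < h x \<Longrightarrow> y = y'"
    and "x \<in> W \<Longrightarrow> h x \<le> M"
  using assms unfolding height_function_def by simp_all

section \<open>Typical graphs: low vertices, expansion and components outside the core\<close>

definition low :: "nat \<Rightarrow> nat set set \<Rightarrow> (nat \<Rightarrow> nat) \<Rightarrow> real \<Rightarrow> nat set" where
  "low n E f d = {x\<in>{1..n}. \<exists>j\<in>{1..3}. j \<noteq> f x \<and> real (card {y\<in>nbs E x. f y = j}) < d / 4}"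

definition heavy :: "nat \<Rightarrow> nat set set \<Rightarrow> real \<Rightarrow> nat set \<Rightarrow> nat set" where
  "heavy n E d F = {x\<in>{1..n}. d / 17 \<le> real (card (nbs E x \<inter> F))}"

definition expanding :: "nat \<Rightarrow> nat set set \<Rightarrow> real \<Rightarrow> bool" where
  "expanding n E d \<longleftrightarrow> (\<forall>F\<subseteq>{1..n}. 120 * card F \<le> n \<longrightarrow> 2 * card (heavy n E d F) \<le> card F)"

text \<open>The event for the union bound, reduced to what is paid for: the number of edges named by
  \<open>\<pi>\<close> and the low vertices in \<open>K\<close>, without connectedness or
  acyclicity. The bound on \<open>card K\<close> leaves enough of each class outside
  \<open>K\<close>.\<close>

definition low_tree :: "nat \<Rightarrow> nat set set \<Rightarrow> (nat \<Rightarrow> nat) \<Rightarrow> real \<Rightarrow> nat set \<Rightarrow> (nat \<Rightarrow> nat) \<Rightarrow> bool" where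
  "low_tree n E f d K \<pi> \<longleftrightarrow> K \<subseteq> {1..n} \<and> K \<noteq> {} \<and> 120 * card K \<le> n \<and> \<pi> \<in> K \<rightarrow> K \<and>
     tree_edges K \<pi> \<subseteq> E \<and> card (tree_edges K \<pi>) = card K - 1 \<and> card K \<le> 2 * card (K \<inter> low n E f d)"

lemma heavy_mono: "finite F' \<Longrightarrow> F \<subseteq> F' \<Longrightarrow> heavy n E d F \<subseteq> heavy n E d F'"
  unfolding heavy_def
proof safe
  fix x assume "finite F'" "F \<subseteq> F'" and le: "d / 17 \<le> real (card (nbs E x \<inter> F))"
  then have "card (nbs E x \<inter> F) \<le> card (nbs E x \<inter> F')" by (intro card_mono) auto
  then show "d / 17 \<le> real (card (nbs E x \<inter> F'))" using le by linarith
qed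

locale typical_graph =
  fixes n :: nat and E :: "nat set set" and f :: "nat \<Rightarrow> nat" and M :: nat and d :: real
  assumes cross: "E \<subseteq> cross_pairs n f"
    and f_range: "\<And>x. x \<in> {1..n} \<Longrightarrow> f x \<in> {1..3}"
    and d_large: "d \<ge> 100" "exp (- d / 240) \<le> 1 / 120"
    and expanding: "expanding n E d"
    and few_low: "2 * real (card (low n E f d)) \<le> exp (- d / 240) * n"
    and acyclic: "\<And>K \<pi>. low_tree n E f d K \<pi> \<Longrightarrow> {e\<in>E. e \<subseteq> K} \<subseteq> tree_edges K \<pi>"
    and small: "\<And>K \<pi>. low_tree n E f d K \<pi> \<Longrightarrow> card K \<le> M"
    and degrees: "(\<Sum>v\<in>{1..n}. exp (real (card (nbs E v)))) \<le> n * exp (3 * d)"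
begin

abbreviation "L \<equiv> low n E f d"

lemma low_card: "240 * card L \<le> n"
proof -
  have "exp (- d / 240) * n \<le> 1 / 120 * n" using d_large(2) by (intro mult_right_mono) auto
  then have "240 * real (card L) \<le> n" using few_low by simp
  then show ?thesis by linarith
qed

text \<open>A largest \<open>S\<close> with \<open>S \<subseteq> L \<union> heavy n E d S\<close>
  and at most twice the size of \<open>L\<close> is a fixed point. Expansion gives
  \<open>heavy n E d S\<close> at most half the size of \<open>S\<close>, so passing to
  \<open>L \<union> heavy n E d S\<close> keeps both conditions and can only enlarge the
  set.\<close>

lemma exists_noncore:
  obtains Z where "Z = L \<union> heavy n E d Z" "card Z \<le> 2 * card L" "Z \<subseteq> {1..n}"
proof -
  have L: "L \<subseteq> {1..n}" unfolding low_def by auto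
  define good where "good S \<longleftrightarrow> S \<subseteq> L \<union> heavy n E d S \<and> card S \<le> 2 * card L" for S
  have "good L" unfolding good_def by auto
  moreover have "\<And>S. good S \<Longrightarrow> card S \<le> 2 * card L" unfolding good_def by blast
  ultimately have "\<exists>Z. good Z \<and> (\<forall>S. good S \<longrightarrow> card S \<le> card Z)"
    using ex_has_greatest_nat[of good L card "Suc (2 * card L)"] by (simp add: less_Suc_eq_le)
  then obtain Z where Z: "good Z" "\<And>S. good S \<Longrightarrow> card S \<le> card Z" by blast
  have sub: "L \<union> heavy n E d S \<subseteq> {1..n}" for S using L unfolding heavy_def by auto
  have Zn: "Z \<subseteq> {1..n}" using Z(1) sub unfolding good_def by blast
  let ?S = "L \<union> heavy n E d Z"
  have fin: "finite ?S" using sub finite_subset by blast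
  have "2 * card (heavy n E d Z) \<le> card Z"
    using expanding Zn Z(1) low_card unfolding expanding_def good_def by simp
  then have "card ?S \<le> 2 * card L"
    using card_Un_le[of L "heavy n E d Z"] Z(1) unfolding good_def by linarith
  moreover have ZS: "Z \<subseteq> ?S" using Z(1) unfolding good_def by blast
  then have "?S \<subseteq> L \<union> heavy n E d ?S" using heavy_mono[OF fin ZS] by blast
  ultimately have "good ?S" unfolding good_def by blast
  then have "card ?S \<le> card Z" by (rule Z(2))
  then have "Z = ?S" using card_seteq[OF fin ZS] by blast
  then show ?thesis using that Z(1) Zn unfolding good_def by blast
qed

text \<open>A vertex of \<open>K - L\<close> is heavy for \<open>Z\<close>, and since all its
  neighbors in \<open>Z\<close> lie in \<open>K\<close>, it is heavy for \<open>K\<close>. Expansion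
  applied to \<open>K\<close> itself bounds such vertices by half of \<open>K\<close>.\<close>

lemma component_low_tree:
  assumes Z: "Z = L \<union> heavy n E d Z" "card Z \<le> 2 * card L" "Z \<subseteq> {1..n}"
    and t: "rooted_tree E K r \<pi> h" and K: "K \<subseteq> Z"
    and closed: "\<And>x y. x \<in> K \<Longrightarrow> y \<in> Z \<Longrightarrow> {x, y} \<in> E \<Longrightarrow> y \<in> K"
  shows "low_tree n E f d K \<pi>"
proof -
  have fin: "finite K" and ne: "K \<noteq> {}" using t unfolding rooted_tree_def by blast+
  have "finite Z" using Z(3) finite_subset by blast
  then have "card K \<le> card Z" using K by (intro card_mono)
  then have 120: "120 * card K \<le> n" using Z(2) low_card by linarith
  have Kn: "K \<subseteq> {1..n}" using K Z(3) by blast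
  have "K - L \<subseteq> heavy n E d K"
  proof
    fix x assume x: "x \<in> K - L"
    then have "x \<in> heavy n E d Z" using K Z(1) by blast
    moreover have "nbs E x \<inter> Z = nbs E x \<inter> K" using closed x K unfolding nbs_def by blast
    ultimately show "x \<in> heavy n E d K" unfolding heavy_def by simp
  qed
  then have "card (K - L) \<le> card (heavy n E d K)"
    by (intro card_mono) (auto simp: heavy_def)
  moreover have "2 * card (heavy n E d K) \<le> card K"
    using expanding Kn 120 unfolding expanding_def by blast
  moreover have "card (K \<inter> L) + card (K - L) = card K"
    using fin by (metis card_Int_Diff)
  ultimately have "card K \<le> 2 * card (K \<inter> L)" by linarith
  then show ?thesis
    unfolding low_tree_def using Kn ne 120 rooted_tree_edges[OF t] by blast
qed

text \<open>Components are peeled off one at a time. As \<open>W\<close> is closed within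
  \<open>Z\<close>, a maximal tree in \<open>W\<close> spans a component of the graph on
  \<open>Z\<close>, and by \<open>acyclic\<close> its parent map accounts for all edges
  there.\<close>

lemma heights:
  assumes Z: "Z = L \<union> heavy n E d Z" "card Z \<le> 2 * card L" "Z \<subseteq> {1..n}"
    and "W \<subseteq> Z" and closed: "\<And>x y. x \<in> W \<Longrightarrow> y \<in> Z \<Longrightarrow> {x, y} \<in> E \<Longrightarrow> y \<in> W"
  shows "\<exists>h. height_function E W M h"
proof -
  have "finite W" using assms(3,4) finite_subset by (metis finite_atLeastAtMost)
  then show ?thesis using assms(4) closed
  proof (induction W rule: finite_psubset_induct)
    case (psubset W)
    show ?case
    proof (cases "W = {}")
      case False
      then obtain r where "r \<in> W" by blast
      obtain K \<pi> h where K: "rooted_tree E K r \<pi> h" "K \<subseteq> W"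
        "\<And>x y. x \<in> K \<Longrightarrow> y \<in> W \<Longrightarrow> {x, y} \<in> E \<Longrightarrow> y \<in> K"
        using rooted_tree_maximal[OF psubset(1) \<open>r \<in> W\<close>] by metis
      have r: "r \<in> K" using K(1) unfolding rooted_tree_def by blast
      have lt: "low_tree n E f d K \<pi>"
        using psubset.prems K by (intro component_low_tree[OF Z K(1)]) blast+
      have K_sym: "\<not> {x, y} \<in> E" if "x \<in> W - K" "y \<in> K" for x y
        using K(3)[of y x] that by (auto simp: insert_commute)
      have "W - K \<subset> W" using r K(2) by blast
      moreover have "W - K \<subseteq> Z" using psubset.prems by blast
      moreover have "y \<in> W - K" if "x \<in> W - K" "y \<in> Z" "{x, y} \<in> E" for x y
        using psubset.prems(2)[of x y] K_sym that by blast
      ultimately obtain h' where h': "height_function E (W - K) M h'"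
        using psubset.IH[of "W - K"] by blast
      have par: "y = \<pi> x \<and> h x = Suc (h y) \<or> x = \<pi> y \<and> h y = Suc (h x)"
        if "x \<in> K" "y \<in> K" "{x, y} \<in> E" for x y
      proof -
        have "{x, y} \<in> tree_edges K \<pi>" using acyclic[OF lt] that by blast
        then obtain v where v: "v \<in> K - {r}" "{x, y} = {v, \<pi> v}"
          unfolding tree_edges_def rooted_tree_nonroot[OF K(1)] by blast
        then have "h v = Suc (h (\<pi> v))" using K(1) unfolding rooted_tree_def by blast
        then show ?thesis using v(2) by (auto simp: doubleton_eq_iff)
      qed
      have hM: "h x \<le> M" if "x \<in> K" for x
        using small[OF lt] K(1) that unfolding rooted_tree_def by fastforce
      define g where "g x = (if x \<in> K then h x else h' x)" for x
      have same: "x \<in> K \<longleftrightarrow> y \<in> K" if "x \<in> W" "y \<in> W" "{x, y} \<in> E" for x y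
        using K(3) K_sym that by blast
      have "g x \<noteq> g y" if "x \<in> W" "y \<in> W" "{x, y} \<in> E" for x y
        using same[OF that] par[OF _ _ that(3)] height_functionD(1)[OF h' _ _ that(3)] that(1,2)
        unfolding g_def by (cases "x \<in> K") auto
      moreover have "y = y'" if "x \<in> W" "y \<in> W" "y' \<in> W" "{x, y} \<in> E" "{x, y'} \<in> E"
        "g y < g x" "g y' < g x" for x y y'
      proof (cases "x \<in> K")
        case True
        have K': "y \<in> K" "y' \<in> K" using same[OF that(1,2,4)] same[OF that(1,3,5)] True by blast+
        have "h y < h x" "h y' < h x" using that(6,7) True K' unfolding g_def by simp_all
        then have "h y \<noteq> Suc (h x)" "h y' \<noteq> Suc (h x)" by linarith+
        then have "y = \<pi> x" "y' = \<pi> x"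
          using par[OF True K'(1) that(4)] par[OF True K'(2) that(5)] by blast+
        then show ?thesis by simp
      next
        case False
        have K': "y \<notin> K" "y' \<notin> K" using same[OF that(1,2,4)] same[OF that(1,3,5)] False by blast+
        have "h' y < h' x" "h' y' < h' x" using that(6,7) False K' unfolding g_def by simp_all
        then show ?thesis using height_functionD(2)[OF h' _ _ _ that(4,5)] False K' that(1-3) by blast
      qed
      moreover have "g x \<le> M" if "x \<in> W" for x
        using hM height_functionD(3)[OF h'] that unfolding g_def by auto
      ultimately have "height_function E W M g" unfolding height_function_def by blast
      then show ?thesis by blast
    qed (simp add: height_function_def)
  qed
qed

text \<open>This makes the running time linear uniformly in \<open>d\<close>. The share
  \<open>3 * d\<close> per vertex is paid by the smallness of \<open>Z\<close>, as 3d exp(-d/240) <=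
  720; larger degrees are charged to the exponential sum, which adds at most
  \<open>n\<close>.\<close>

lemma degree_sum:
  assumes "Z \<subseteq> {1..n}" "card Z \<le> 2 * card L"
  shows "(\<Sum>x\<in>Z. real (card (nbs E x))) \<le> 721 * n"
proof -
  have fin: "finite Z" using assms(1) finite_subset by blast
  have "real (card (nbs E x)) \<le> 3 * d + exp (- (3 * d)) * exp (real (card (nbs E x)))" for x
  proof -
    have "exp (- (3 * d)) * exp (real (card (nbs E x))) = exp (real (card (nbs E x)) - 3 * d)"
      by (simp flip: exp_add)
    then show ?thesis
      using exp_ge_add_one_self[of "real (card (nbs E x)) - 3 * d"] by linarith
  qed
  then have "(\<Sum>x\<in>Z. real (card (nbs E x))) \<le>
      (\<Sum>x\<in>Z. 3 * d + exp (- (3 * d)) * exp (real (card (nbs E x))))"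
    by (intro sum_mono)
  also have "\<dots> = card Z * (3 * d) + exp (- (3 * d)) * (\<Sum>x\<in>Z. exp (real (card (nbs E x))))"
    by (simp add: sum.distrib sum_distrib_left)
  also have "(\<Sum>x\<in>Z. exp (real (card (nbs E x)))) \<le> (\<Sum>x\<in>{1..n}. exp (real (card (nbs E x))))"
    using assms(1) by (intro sum_mono2) auto
  also have "\<dots> \<le> n * exp (3 * d)" by (rule degrees)
  also have "exp (- (3 * d)) * (n * exp (3 * d)) = n" by (simp add: exp_minus field_simps)
  also have "card Z * (3 * d) \<le> exp (- d / 240) * n * (3 * d)"
    using assms(2) few_low d_large by (intro mult_right_mono) auto
  also have "\<dots> = 720 * n * (d / 240 * exp (- (d / 240)))" by simp
  also have "d / 240 * exp (- (d / 240)) \<le> 1"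
    using exp_ge_add_one_self[of "d / 240"] by (simp add: exp_minus field_simps)
  finally show ?thesis by (simp add: mult_left_mono)
qed

theorem gallager_typical:
  assumes close: "120 * card {v\<in>{1..n}. \<phi> v \<noteq> f v} \<le> n"
    and exec: "gallager_execution 3 1 E \<phi> \<rho>" and l: "n < 2 ^ l" and n: "n \<ge> 1"
  shows "\<exists>T\<le>l + 2 * M + 4. halts_after E \<rho> T \<and>
    (\<forall>\<phi>'. gallager_output n 3 1 E (\<rho> T) \<phi>' \<longrightarrow>
      (let VA = {v\<in>{1..n}. \<phi>' v = Some (f v)} in
        real (card VA) \<ge> (1 - exp (- d / 240)) * real n \<and>
        (\<forall>v \<in> {1..n} - VA. \<phi>' v = None) \<and>
        proper_coloring 3 VA E (\<lambda>v. the (\<phi>' v)) \<and>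
        completes_within greedy_prog (4356 * real n) n 3 E VA \<phi>'))"
proof -
  obtain Z where Z: "Z = L \<union> heavy n E d Z" "card Z \<le> 2 * card L" "Z \<subseteq> {1..n}"
    by (rule exists_noncore)
  obtain h where h: "height_function E Z M h"
    using heights[OF Z order_refl] by blast
  interpret planted_execution n E f Z h M d \<phi> \<rho>
  proof unfold_locales
    show "E \<subseteq> cross_pairs n f" by (rule cross)
    show "x \<in> {1..n} \<Longrightarrow> f x \<in> {1..3}" for x by (rule f_range)
    show "Z \<subseteq> {1..n}" by (rule Z)
    show "d / 4 \<le> real (card {y\<in>nbs E x. f y = j})"
      if "x \<in> {1..n} - Z" "j \<in> {1..3}" "j \<noteq> f x" for x j
    proof (rule ccontr)
      assume "\<not> ?thesis"
      then have "x \<in> L" using that unfolding low_def by auto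
      then show False using that(1) Z(1) by blast
    qed
    show "real (card (nbs E x \<inter> Z)) < d / 17" if "x \<in> {1..n} - Z" for x
    proof (rule ccontr)
      assume "\<not> ?thesis"
      then have "x \<in> heavy n E d Z" using that unfolding heavy_def by auto
      then show False using that Z(1) by blast
    qed
    show "2 * card {x\<in>{1..n}. d / 17 \<le> real (card (nbs E x \<inter> F))} \<le> card F"
      if "F \<subseteq> {1..n}" "120 * card F \<le> n" for F
      using expanding that unfolding expanding_def heavy_def by blast
    show "x \<in> Z \<Longrightarrow> y \<in> Z \<Longrightarrow> {x, y} \<in> E \<Longrightarrow> h x \<noteq> h y" for x y by (rule height_functionD(1)[OF h])
    show "x \<in> Z \<Longrightarrow> y \<in> nbs E x \<inter> Z \<Longrightarrow> y' \<in> nbs E x \<inter> Z \<Longrightarrow> h y < h x \<Longrightarrow> h y' < h x \<Longrightarrow> y = y'"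
      for x y y' using height_functionD(2)[OF h] unfolding nbs_def by blast
    show "x \<in> Z \<Longrightarrow> h x \<le> M" for x by (rule height_functionD(3)[OF h])
    show "d \<ge> 100" by (rule d_large)
  qed (use close exec in auto)
  obtain T where T: "T \<le> l + 2 * M + 4" "halts_after E \<rho> T" "final (\<rho> T)"
    using halts[OF l] by blast
  have "let VA = {v\<in>{1..n}. B v = Some (f v)} in
        real (card VA) \<ge> (1 - exp (- d / 240)) * real n \<and>
        (\<forall>v \<in> {1..n} - VA. B v = None) \<and>
        proper_coloring 3 VA E (\<lambda>v. the (B v)) \<and>
        completes_within greedy_prog (4356 * real n) n 3 E VA B"
    if out: "gallager_output n 3 1 E (\<rho> T) B" for B
  proof -
    let ?s = "\<rho> T"
    have s: "gallager_step 3 1 E ?s ?s"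
      "\<And>x y. {x, y} \<in> E \<Longrightarrow> msg ?s x y \<in> {None, Some (f x)}"
      "\<And>x y. {x, y} \<in> E \<Longrightarrow> x \<notin> Z \<Longrightarrow> msg ?s x y = Some (f x)"
      using T(3) unfolding final_def by blast+
    have B_cases: "B x = None \<or> B x = Some (f x)" if "x \<in> {1..n}" for x
      by (rule output_correct[where s = ?s]) (use s out that in blast)+
    have B_core: "B x = Some (f x)" if "x \<in> {1..n}" "x \<notin> Z" for x
      by (rule output_core[where s = ?s]) (use s out that in blast)+
    have B_list: "c = c'" if "B x = None" "{x, y} \<in> E" "{x, y'} \<in> E" "B y = Some c" "B y' = Some c'"
      for x y y' c c'
      by (rule undecided_neighbors[where s = ?s and B = B]) (use s out that in blast)+
    define VA where "VA = {v\<in>{1..n}. B v = Some (f v)}"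
    define U where "U = {v\<in>{1..n}. B v = None}"
    have U: "U \<subseteq> Z" unfolding U_def using B_core by force
    have undec: "\<forall>v \<in> {1..n} - VA. B v = None"
    proof
      fix v assume "v \<in> {1..n} - VA"
      then have "v \<in> {1..n}" "B v \<noteq> Some (f v)" unfolding VA_def by auto
      then show "B v = None" using B_cases by blast
    qed
    have "{1..n} - Z \<subseteq> VA" unfolding VA_def using B_core by auto
    then have "card ({1..n} - Z) \<le> card VA" by (intro card_mono) (auto simp: VA_def)
    moreover have "card ({1..n} - Z) = n - card Z"
      using card_Diff_subset[OF finite_subset[OF Z(3)] Z(3)] by simp
    ultimately have "real n - card Z \<le> card VA" by linarith
    moreover have "real (card Z) \<le> exp (- d / 240) * n"
      using Z(2) few_low by linarith
    ultimately have VA_card: "(1 - exp (- d / 240)) * real n \<le> card VA"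
      by (simp add: algebra_simps)
    have VA_proper: "proper_coloring 3 VA E (\<lambda>v. the (B v))"
      unfolding proper_coloring_def VA_def using f_range edge(3) by auto
    have "completes_within greedy_prog (4356 * real n) n 3 E VA B"
      unfolding completes_within_def
    proof (intro allI impI)
      fix adj assume adj: "adjacency_lists n E adj"
      have "\<exists>t st. exec greedy_prog (input_store n adj B) t st \<and>
         t \<le> 23 * n + 7 + 6 * (\<Sum>x\<in>U. length (adj x)) \<and>
         proper_coloring 3 {1..n} E (st 1) \<and> (\<forall>v\<in>{1..n}. \<forall>c. B v = Some c \<longrightarrow> st 1 v = c)"
      proof (rule greedy_prog_correct[OF _ adj _ _ _ U_def])
        show "\<exists>u\<in>{1..n}. \<exists>v\<in>{1..n}. u \<noteq> v \<and> e = {u, v}" if e: "e \<in> E" for e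
        proof -
          obtain u v where "u \<in> {1..n}" "v \<in> {1..n}" "f u \<noteq> f v" "e = {u, v}"
            using subsetD[OF cross e] unfolding cross_pairs_def by blast
          then show ?thesis by (intro bexI[of _ u] bexI[of _ v]) auto
        qed
        show "c \<in> {1..3}" if "v \<in> {1..n}" "B v = Some c" for v c
          using B_cases[OF that(1)] that f_range[OF that(1)] by simp
        show "B v \<noteq> Some c" if "{u, v} \<in> E" "B u = Some c" for u v c
          using B_cases[OF edge(1)[OF that(1)]] B_cases[OF edge(2)[OF that(1)]] edge(3)[OF that(1)] that(2)
          by auto
        show "c = c'" if "x \<in> {1..n}" "B x = None" "{x, y} \<in> E" "{x, y'} \<in> E"
          "B y = Some c" "B y' = Some c'" for x y y' c c'
          using B_list[OF that(2-)] .
        show "forest_on E U" using forest_on_Z U unfolding forest_on_def by blast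
      qed
      then obtain t st where run: "exec greedy_prog (input_store n adj B) t st"
         "t \<le> 23 * n + 7 + 6 * (\<Sum>x\<in>U. length (adj x))"
         "proper_coloring 3 {1..n} E (st 1)" "\<forall>v\<in>{1..n}. \<forall>c. B v = Some c \<longrightarrow> st 1 v = c"
        by blast
      have "length (adj x) = card (nbs E x)" if "x \<in> {1..n}" for x
        using adj that distinct_card[of "adj x"] unfolding adjacency_lists_def nbs_def by auto
      then have "real (\<Sum>x\<in>U. length (adj x)) = (\<Sum>x\<in>U. real (card (nbs E x)))"
        unfolding U_def by simp
      also have "\<dots> \<le> (\<Sum>x\<in>Z. real (card (nbs E x)))"
        using U Z(3) by (intro sum_mono2) (auto intro: finite_subset)
      also have "\<dots> \<le> 721 * n" by (rule degree_sum[OF Z(3,2)])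
      \<comment> \<open>4356 = 6 * 721 + 23 + 7.\<close>
      finally have "real t \<le> 4356 * real n" using run(2) n by linarith
      moreover have "\<forall>v\<in>VA. B v = Some (st 1 v)" using run(4) unfolding VA_def by auto
      ultimately show "\<exists>t st. exec greedy_prog (input_store n adj B) t st \<and> real t \<le> 4356 * real n \<and>
          proper_coloring 3 {1..n} E (st 1) \<and> (\<forall>v\<in>VA. B v = Some (st 1 v))"
        using run by blast
    qed
    with VA_card undec VA_proper show ?thesis
      unfolding Let_def VA_def[symmetric] by (intro conjI)
  qed
  then show ?thesis using T(1,2) by blast
qed

end

section \<open>The random edge set\<close>

lemma prob_UN_le:
  fixes b :: real
  assumes "finite I" "\<And>i. i \<in> I \<Longrightarrow> measure_pmf.prob M (X i) \<le> b"
  shows "measure_pmf.prob M (\<Union>i\<in>I. X i) \<le> card I * b"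
proof -
  have "measure_pmf.prob M (\<Union>i\<in>I. X i) \<le> (\<Sum>i\<in>I. measure_pmf.prob M (X i))"
    using assms(1) by (intro measure_pmf.finite_measure_subadditive_finite) auto
  also have "\<dots> \<le> (\<Sum>i\<in>I. b)" by (intro sum_mono assms(2))
  finally show ?thesis by simp
qed

lemma prob_mono: "(\<And>x. x \<in> set_pmf M \<Longrightarrow> x \<in> X \<Longrightarrow> x \<in> Y) \<Longrightarrow> measure_pmf.prob M X \<le> measure_pmf.prob M Y"
  by (rule measure_pmf.finite_measure_mono_AE) (auto simp: AE_measure_pmf_iff)

definition edge_pmf :: "'a set \<Rightarrow> real \<Rightarrow> 'a set pmf" where
  "edge_pmf A p = map_pmf (\<lambda>b. {C\<in>A. b C}) (Pi_pmf A False (\<lambda>_. bernoulli_pmf p))"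

lemma set_edge_pmf: "E \<in> set_pmf (edge_pmf A p) \<Longrightarrow> E \<subseteq> A"
  unfolding edge_pmf_def by auto

lemma finite_set_edge_pmf: "finite A \<Longrightarrow> finite (set_pmf (edge_pmf A p))"
  by (rule finite_subset[of _ "Pow A"]) (auto dest: set_edge_pmf)

text \<open>By independence the expectation factorizes: an edge of \<open>T\<close> contributes
  \<open>p\<close>, any other pair 1 + p (exp w - 1), bounded by an exponential.\<close>

lemma edge_expectation:
  fixes w :: "'a \<Rightarrow> real"
  assumes "finite A" "T \<subseteq> A" "0 \<le> p" "p \<le> 1"
  shows "measure_pmf.expectation (edge_pmf A p) (\<lambda>E. of_bool (T \<subseteq> E) * exp (\<Sum>C\<in>E - T. w C))
    \<le> p ^ card T * exp (p * (\<Sum>C\<in>A - T. exp (w C) - 1))"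
proof -
  define g where "g C b = (if C \<in> T then of_bool b else if b then exp (w C) else (1::real))" for C b
  have finT: "finite T" using assms finite_subset by blast
  have eq: "of_bool (T \<subseteq> {C\<in>A. b C}) * exp (\<Sum>C\<in>{C\<in>A. b C} - T. w C) = (\<Prod>C\<in>A. g C (b C))" for b
  proof -
    have "(\<Prod>C\<in>A. g C (b C)) = (\<Prod>C\<in>T. g C (b C)) * (\<Prod>C\<in>A - T. g C (b C))"
      using prod.subset_diff[OF assms(2,1)] by (simp add: mult.commute)
    also have "(\<Prod>C\<in>T. g C (b C)) = (\<Prod>C\<in>T. of_bool (b C))"
      by (intro prod.cong) (auto simp: g_def)
    also have "\<dots> = of_bool (T \<subseteq> {C\<in>A. b C})"
    proof (cases "T \<subseteq> {C\<in>A. b C}")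
      case False
      then obtain C where "C \<in> T" "\<not> b C" using assms(2) by auto
      then have "(\<Prod>C\<in>T. of_bool (b C)) = (0::real)" using finT by (intro prod_zero) auto
      then show ?thesis using False by simp
    next
      case True
      then have "(\<Prod>C\<in>T. of_bool (b C)) = (1::real)" by (intro prod.neutral) auto
      then show ?thesis using True by simp
    qed
    also have "(\<Prod>C\<in>A - T. g C (b C)) = (\<Prod>C\<in>A - T. if b C then exp (w C) else 1)"
      by (intro prod.cong) (auto simp: g_def)
    also have "\<dots> = (\<Prod>C\<in>{C\<in>A - T. b C}. exp (w C))"
      using assms(1) by (subst prod.inter_filter) auto
    also have "{C\<in>A - T. b C} = {C\<in>A. b C} - T" by auto
    also have "(\<Prod>C\<in>{C\<in>A. b C} - T. exp (w C)) = exp (\<Sum>C\<in>{C\<in>A. b C} - T. w C)"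
      using assms(1) by (simp add: exp_sum)
    finally show ?thesis ..
  qed
  have "measure_pmf.expectation (edge_pmf A p) (\<lambda>E. of_bool (T \<subseteq> E) * exp (\<Sum>C\<in>E - T. w C)) =
      measure_pmf.expectation (Pi_pmf A False (\<lambda>_. bernoulli_pmf p)) (\<lambda>b. \<Prod>C\<in>A. g C (b C))"
    unfolding edge_pmf_def integral_map_pmf eq ..
  also have "\<dots> = (\<Prod>C\<in>A. measure_pmf.expectation (bernoulli_pmf p) (g C))"
    using assms(1) by (intro expectation_prod_Pi_pmf) (auto simp: g_def integrable_measure_pmf_finite)
  also have "\<dots> = (\<Prod>C\<in>A. if C \<in> T then p else 1 + p * (exp (w C) - 1))"
    using assms(3,4) by (intro prod.cong refl) (auto simp: g_def algebra_simps)
  also have "\<dots> = (\<Prod>C\<in>T. if C \<in> T then p else 1 + p * (exp (w C) - 1)) *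
      (\<Prod>C\<in>A - T. if C \<in> T then p else 1 + p * (exp (w C) - 1))"
    by (subst prod.subset_diff[OF assms(2,1)]) (rule mult.commute)
  also have "\<dots> = p ^ card T * (\<Prod>C\<in>A - T. 1 + p * (exp (w C) - 1))"
    by simp
  also have "(\<Prod>C\<in>A - T. 1 + p * (exp (w C) - 1)) \<le> (\<Prod>C\<in>A - T. exp (p * (exp (w C) - 1)))"
  proof (intro prod_mono conjI)
    fix C
    have "0 \<le> p * exp (w C)" "p * 1 \<le> 1" using assms(3,4) by auto
    then show "0 \<le> 1 + p * (exp (w C) - 1)" by (simp add: algebra_simps)
  qed (rule exp_ge_add_one_self)
  also have "\<dots> = exp (p * (\<Sum>C\<in>A - T. exp (w C) - 1))"
    using assms(1) by (simp add: exp_sum sum_distrib_left)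
  finally show ?thesis using assms(3) by (simp add: mult_left_mono)
qed

lemma prob_le_expectation:
  assumes "finite (set_pmf M)" "\<And>x. x \<in> set_pmf M \<Longrightarrow> 0 \<le> X x" "\<And>x. x \<in> set_pmf M \<Longrightarrow> x \<in> S \<Longrightarrow> 1 \<le> X x"
  shows "measure_pmf.prob M S \<le> measure_pmf.expectation M X"
proof -
  have "measure_pmf.prob M S = measure_pmf.expectation M (indicator S)" by simp
  also have "\<dots> \<le> measure_pmf.expectation M X"
    using assms by (intro integral_mono_AE integrable_measure_pmf_finite)
      (auto simp: AE_measure_pmf_iff indicator_def)
  finally show ?thesis .
qed

lemma markov_pmf:
  assumes "finite (set_pmf M)" "\<And>x. x \<in> set_pmf M \<Longrightarrow> 0 \<le> X x" "0 < a"
  shows "measure_pmf.prob M {x. a \<le> X x} \<le> measure_pmf.expectation M X / a"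
proof -
  have "measure_pmf.prob M {x. a \<le> X x} \<le> measure_pmf.expectation M (\<lambda>x. X x / a)"
    using assms by (intro prob_le_expectation) auto
  then show ?thesis by simp
qed

lemma edge_chernoff:
  fixes w :: "'a \<Rightarrow> real"
  assumes "finite A" "T \<subseteq> A" "0 \<le> p" "p \<le> 1"
  shows "measure_pmf.prob (edge_pmf A p) {E. T \<subseteq> E \<and> t \<le> (\<Sum>C\<in>E - T. w C)}
    \<le> p ^ card T * exp (p * (\<Sum>C\<in>A - T. exp (w C) - 1) - t)"
proof -
  have "measure_pmf.prob (edge_pmf A p) {E. T \<subseteq> E \<and> t \<le> (\<Sum>C\<in>E - T. w C)} \<le>
      measure_pmf.expectation (edge_pmf A p) (\<lambda>E. (of_bool (T \<subseteq> E) * exp (\<Sum>C\<in>E - T. w C)) / exp t)"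
    by (intro prob_le_expectation finite_set_edge_pmf assms) auto
  also have "\<dots> = measure_pmf.expectation (edge_pmf A p) (\<lambda>E. of_bool (T \<subseteq> E) * exp (\<Sum>C\<in>E - T. w C)) / exp t"
    by simp
  also have "\<dots> \<le> p ^ card T * exp (p * (\<Sum>C\<in>A - T. exp (w C) - 1)) / exp t"
    by (intro divide_right_mono edge_expectation assms) auto
  finally show ?thesis by (simp add: exp_diff)
qed

text \<open>The sign of \<open>u\<close> selects the tail: \<open>low_prob\<close> takes it negative
  for few edges in \<open>W\<close>, \<open>prob_heavy_pair\<close> nonnegative for many. The
  presence of \<open>T\<close> is carried along as an independent factor.\<close>

lemma edge_chernoff_subset:
  assumes "finite A" "T \<subseteq> A" "0 \<le> p" "p \<le> 1" "W \<subseteq> A" "W \<inter> T = {}"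
  shows "measure_pmf.prob (edge_pmf A p) {E. T \<subseteq> E \<and> t \<le> u * real (card (E \<inter> W))}
    \<le> p ^ card T * exp (p * (real (card W) * (exp u - 1)) - t)"
proof -
  let ?w = "\<lambda>C. if C \<in> W then u else 0"
  have "measure_pmf.prob (edge_pmf A p) {E. T \<subseteq> E \<and> t \<le> u * real (card (E \<inter> W))} \<le>
      measure_pmf.prob (edge_pmf A p) {E. T \<subseteq> E \<and> t \<le> (\<Sum>C\<in>E - T. ?w C)}"
  proof (rule prob_mono)
    fix E assume E: "E \<in> set_pmf (edge_pmf A p)" "E \<in> {E. T \<subseteq> E \<and> t \<le> u * real (card (E \<inter> W))}"
    have "finite (E - T)" using set_edge_pmf[OF E(1)] assms(1) finite_subset by blast
    then have "(\<Sum>C\<in>E - T. ?w C) = (\<Sum>C\<in>(E - T) \<inter> W. u)"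
      by (rule sum.inter_restrict[symmetric])
    also have "(E - T) \<inter> W = E \<inter> W" using assms(6) by blast
    finally show "E \<in> {E. T \<subseteq> E \<and> t \<le> (\<Sum>C\<in>E - T. ?w C)}" using E(2) by (simp add: mult.commute)
  qed
  also have "\<dots> \<le> p ^ card T * exp (p * (\<Sum>C\<in>A - T. exp (?w C) - 1) - t)"
    by (rule edge_chernoff[OF assms(1-4)])
  also have "(\<Sum>C\<in>A - T. exp (?w C) - 1) = (\<Sum>C\<in>A - T. if C \<in> W then exp u - 1 else 0)"
    by (intro sum.cong) auto
  also have "\<dots> = (\<Sum>C\<in>(A - T) \<inter> W. exp u - 1)"
    using assms(1) by (intro sum.inter_restrict[symmetric]) auto
  also have "(A - T) \<inter> W = W" using assms(5,6) by blast
  finally show ?thesis by simp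
qed

text \<open>With y = a/n, a single term of the binomial expansion is at most (1 + y)^n <= exp
  a.\<close>

lemma choose_le:
  assumes "a > 0"
  shows "real (n choose a) \<le> (exp 1 * n / a) ^ a"
proof (cases "a \<le> n")
  case True
  let ?y = "real a / real n"
  have y: "?y > 0" using assms True by simp
  have "real (n choose a) * ?y ^ a \<le> (\<Sum>k\<le>n. real (n choose k) * ?y ^ k)"
    using True y by (intro member_le_sum[where f = "\<lambda>k. real (n choose k) * ?y ^ k"]) auto
  also have "\<dots> = (1 + ?y) ^ n"
    using binomial_ring[of ?y "1::real" n] by (simp add: add.commute)
  also have "\<dots> \<le> exp ?y ^ n"
    using y by (intro power_mono exp_ge_add_one_self) auto
  also have "\<dots> = exp 1 ^ a" using assms True by (simp flip: exp_of_nat_mult)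
  finally have "real (n choose a) \<le> exp 1 ^ a / ?y ^ a" using y by (simp add: pos_le_divide_eq)
  also have "\<dots> = (exp 1 * n / a) ^ a" by (simp flip: power_divide)
  finally show ?thesis .
qed (simp add: binomial_eq_0)

lemma geometric_sum_le:
  fixes q :: real
  assumes "0 \<le> q" "q \<le> 1 / 2"
  shows "(\<Sum>a\<in>{1..n}. q ^ a) \<le> 2 * q"
proof -
  \<comment> \<open>The extra term \<open>2 * q ^ Suc n\<close> bounds the remaining tail and
    carries the induction.\<close>
  have "(\<Sum>a\<in>{1..n}. q ^ a) + 2 * q ^ Suc n \<le> 2 * q"
  proof (induction n)
    case (Suc n)
    have "q * q ^ Suc n \<le> 1 / 2 * q ^ Suc n" using assms by (intro mult_right_mono) auto
    then show ?case using Suc by simp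
  qed simp
  moreover have "0 \<le> q ^ Suc n" using assms by simp
  ultimately show ?thesis by linarith
qed

section \<open>The planted graph is typical\<close>

lemma prob_UN_sum:
  assumes "finite I"
  shows "measure_pmf.prob M (\<Union>i\<in>I. X i) \<le> (\<Sum>i\<in>I. measure_pmf.prob M (X i))"
  using assms by (intro measure_pmf.finite_measure_subadditive_finite) auto

lemma finite_cross_pairs: "finite (cross_pairs n f)"
  by (rule finite_subset[of _ "Pow {1..n}"]) (auto simp: cross_pairs_def)

lemma finite_nbs_cross:
  assumes "E \<subseteq> cross_pairs n f"
  shows "finite (nbs E x)" "nbs E x \<subseteq> {1..n}"
proof -
  show "nbs E x \<subseteq> {1..n}"
  proof
    fix y assume "y \<in> nbs E x"
    then have "{x, y} \<in> cross_pairs n f" using assms unfolding nbs_def by blast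
    then show "y \<in> {1..n}" unfolding cross_pairs_def by (auto simp: doubleton_eq_iff)
  qed
  then show "finite (nbs E x)" using finite_subset by blast
qed

locale planted_classes =
  fixes n :: nat and f :: "nat \<Rightarrow> nat" and p d :: real
  assumes div3: "3 dvd n" and balanced: "f \<in> balanced_colorings n 3"
    and p: "0 \<le> p" "p \<le> 1" and d: "d = real n * p" and d_pos: "d > 0"
begin

abbreviation "G \<equiv> edge_pmf (cross_pairs n f) p"

lemma n_pos: "n > 0" and p_pos: "p > 0"
  using d d_pos p by (auto simp: zero_less_mult_iff)

lemma f_range: "x \<in> {1..n} \<Longrightarrow> f x \<in> {1..3}"
  using balanced unfolding balanced_colorings_def by (blast dest: PiE_mem)

lemma card_class: "i \<in> {1..3} \<Longrightarrow> real (card {v\<in>{1..n}. f v = i}) = n / 3"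
proof -
  assume "i \<in> {1..3}"
  then have "card {v\<in>{1..n}. f v = i} = n div 3"
    using balanced unfolding balanced_colorings_def by blast
  then show ?thesis using real_of_nat_div[OF div3] by simp
qed

lemma set_G: "E \<in> set_pmf G \<Longrightarrow> E \<subseteq> cross_pairs n f"
  by (rule set_edge_pmf)

text \<open>Only edges leaving \<open>K\<close> are used for bounding the degrees. They are independent of each other
  for different vertices of \<open>K\<close>, and independent of \<open>T\<close>.\<close>

lemma low_prob:
  assumes K: "K \<subseteq> {1..n}" "120 * card K \<le> n" and T: "T \<subseteq> Pow K" and A: "A \<subseteq> K"
    and J: "\<And>v. v \<in> A \<Longrightarrow> J v \<in> {1..3} \<and> J v \<noteq> f v"
  shows "measure_pmf.prob G {E. T \<subseteq> E \<and> (\<forall>v\<in>A. real (card {y\<in>nbs E v. f y = J v}) < d / 4)}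
    \<le> p ^ card T * exp (- d / 120) ^ card A"
proof (cases "T \<subseteq> cross_pairs n f")
  case True
  define N where "N v = {y\<in>{1..n}. f y = J v} - K" for v
  define W where "W = (\<lambda>(v, y). {v, y}) ` (SIGMA v:A. N v)"
  have finK: "finite K" using finite_subset[OF K(1)] by simp
  have finA: "finite A" by (rule finite_subset[OF A finK])
  have finN: "finite (N v)" for v unfolding N_def by simp
  \<comment> \<open>\<open>N v\<close> avoids \<open>K\<close>, so exactly one endpoint lies in
    \<open>K\<close> and the pair determines it.\<close>
  have inj: "inj_on (\<lambda>(v, y). {v, y}) (SIGMA v:A. N v)"
    using A by (auto simp: inj_on_def N_def doubleton_eq_iff)
  have W: "W \<subseteq> cross_pairs n f"
  proof
    fix C assume "C \<in> W"
    then obtain v y where vy: "v \<in> A" "y \<in> N v" "C = {v, y}" unfolding W_def by auto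
    then have "v \<in> {1..n}" "y \<in> {1..n}" "f v \<noteq> f y" using A K J[of v] by (auto simp: N_def)
    then show "C \<in> cross_pairs n f" unfolding cross_pairs_def vy(3) by blast
  qed
  have WT: "W \<inter> T = {}" using T unfolding W_def N_def by auto
  \<comment> \<open>39/120 = 1/3 - 1/120: a class without \<open>K\<close>.\<close>
  have "39 / 120 * real n \<le> real (card (N v))" if v: "v \<in> A" for v
  proof -
    have "card {y\<in>{1..n}. f y = J v} - card K \<le> card (N v)"
      unfolding N_def by (rule diff_card_le_card_Diff[OF finK])
    then have "real (card {y\<in>{1..n}. f y = J v}) - real (card K) \<le> real (card (N v))" by linarith
    then show ?thesis using card_class[of "J v"] J[OF v] K(2) by simp
  qed
  then have "(\<Sum>v\<in>A. 39 / 120 * real n) \<le> (\<Sum>v\<in>A. real (card (N v)))" by (rule sum_mono)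
  also have "\<dots> = real (card W)"
    unfolding W_def card_image[OF inj] using finA finN by (simp add: card_SigmaI)
  finally have cardW: "39 / 120 * (real n * real (card A)) \<le> real (card W)" by (simp add: mult_ac)
  let ?t = "- (d / 20 * real (card A))"
  have "measure_pmf.prob G {E. T \<subseteq> E \<and> (\<forall>v\<in>A. real (card {y\<in>nbs E v. f y = J v}) < d / 4)} \<le>
      measure_pmf.prob G {E. T \<subseteq> E \<and> ?t \<le> (- 1 / 5) * real (card (E \<inter> W))}"
  proof (rule prob_mono)
    fix E assume E: "E \<in> set_pmf G"
      "E \<in> {E. T \<subseteq> E \<and> (\<forall>v\<in>A. real (card {y\<in>nbs E v. f y = J v}) < d / 4)}"
    have "E \<inter> W = (\<lambda>(v, y). {v, y}) ` (SIGMA v:A. {y\<in>N v. {v, y} \<in> E})"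
      unfolding W_def by auto
    then have "card (E \<inter> W) \<le> card (SIGMA v:A. {y\<in>N v. {v, y} \<in> E})"
      using finA finN by (simp only:) (intro card_image_le finite_SigmaI; simp)
    also have "\<dots> = (\<Sum>v\<in>A. card {y\<in>N v. {v, y} \<in> E})"
      using finA finN by (intro card_SigmaI) auto
    also have "\<dots> \<le> (\<Sum>v\<in>A. card {y\<in>nbs E v. f y = J v})"
      using finite_nbs_cross(1)[OF set_G[OF E(1)]]
      by (intro sum_mono card_mono) (auto simp: N_def nbs_def)
    finally have "real (card (E \<inter> W)) \<le> (\<Sum>v\<in>A. real (card {y\<in>nbs E v. f y = J v}))"
      by (simp flip: of_nat_sum)
    also have "\<dots> \<le> (\<Sum>v\<in>A. d / 4)" using E(2) by (intro sum_mono) auto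
    finally show "E \<in> {E. T \<subseteq> E \<and> ?t \<le> (- 1 / 5) * real (card (E \<inter> W))}"
      using E(2) by (simp add: mult_ac)
  qed
  also have "\<dots> \<le> p ^ card T * exp (p * (real (card W) * (exp (- 1 / 5) - 1)) - ?t)"
    by (rule edge_chernoff_subset[OF finite_cross_pairs True p W WT])
  also have "\<dots> \<le> p ^ card T * exp (- d / 120 * real (card A))"
  proof -
    have "1 + 1 / 5 + (1 / 5)\<^sup>2 / 2 \<le> exp (1 / 5 :: real)" by (rule exp_lower_Taylor_quadratic) simp
    then have "inverse (exp (1 / 5)) \<le> inverse (1.22 :: real)"
      by (intro le_imp_inverse_le) (simp_all add: power2_eq_square)
    then have e: "exp (- 1 / 5) - 1 \<le> (- 0.18 :: real)" by (simp flip: exp_minus)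
    \<comment> \<open>0.18 * 39/120 = 0.0585 exceeds 1/20 + 1/120, where 1/20 = 1/5 * 1/4 comes from
      the threshold d/4 and 1/120 is what remains.\<close>
    have "39 / 120 * (d * real (card A)) \<le> p * real (card W)"
      using mult_left_mono[OF cardW p(1)] by (simp add: d mult_ac)
    moreover have "p * real (card W) * (exp (- 1 / 5) - 1) \<le> p * real (card W) * (- 0.18)"
      using e p(1) by (intro mult_left_mono) auto
    moreover have "0 \<le> d * real (card A)" using d_pos by simp
    ultimately have "p * (real (card W) * (exp (- 1 / 5) - 1)) - ?t \<le> - d / 120 * real (card A)"
      unfolding mult.assoc[symmetric] by (simp add: field_simps)
    then show ?thesis using p(1) by (intro mult_left_mono) auto
  qed
  also have "exp (- d / 120 * real (card A)) = exp (- d / 120) ^ card A"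
    by (simp flip: exp_of_nat2_mult)
  finally show ?thesis .
next
  \<comment> \<open>A \<open>T\<close> containing a pair within one class is never present.\<close>
  case False
  have "measure_pmf.prob G {E. T \<subseteq> E \<and> (\<forall>v\<in>A. real (card {y\<in>nbs E v. f y = J v}) < d / 4)} \<le>
      measure_pmf.prob G {}"
    by (rule prob_mono) (use False in \<open>auto dest!: set_G\<close>)
  moreover have "0 \<le> p ^ card T * exp (- d / 120) ^ card A" using p(1) by simp
  ultimately show ?thesis by simp
qed

text \<open>The expected number of low vertices is at most 3n exp(-d/120). Markov's inequality
  splits the exponent evenly between the size bound and the failure probability.\<close>

lemma prob_few_low:
  assumes "120 \<le> n"
  shows "measure_pmf.prob G {E. \<not> 2 * real (card (low n E f d)) \<le> exp (- d / 240) * n} \<le> 6 * exp (- d / 240)"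
proof -
  have finG: "finite (set_pmf G)" by (rule finite_set_edge_pmf[OF finite_cross_pairs])
  have v: "measure_pmf.prob G {E. v \<in> low n E f d} \<le> 3 * exp (- d / 120)" if v: "v \<in> {1..n}" for v
  proof -
    have "measure_pmf.prob G {E. v \<in> low n E f d} \<le>
        measure_pmf.prob G (\<Union>j\<in>{1..3} - {f v}. {E. real (card {y\<in>nbs E v. f y = j}) < d / 4})"
      by (rule prob_mono) (auto simp: low_def)
    also have "\<dots> \<le> card ({1..3} - {f v}) * exp (- d / 120)"
    proof (rule prob_UN_le)
      fix j assume "j \<in> {1..3} - {f v}"
      then show "measure_pmf.prob G {E. real (card {y\<in>nbs E v. f y = j}) < d / 4} \<le> exp (- d / 120)"
        using low_prob[of "{v}" "{}" "{v}" "\<lambda>_. j"] v assms by simp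
    qed simp
    also have "real (card ({1..3} - {f v})) \<le> real (card {1..3::nat})"
      by (intro of_nat_mono card_mono) auto
    finally show ?thesis by (simp add: mult_right_mono)
  qed
  have low: "real (card (low n E f d)) = (\<Sum>v\<in>{1..n}. indicator {E. v \<in> low n E f d} E)" for E
  proof -
    have "low n E f d = {v\<in>{1..n}. v \<in> low n E f d}" unfolding low_def by auto
    then have "real (card (low n E f d)) = (\<Sum>v\<in>{v\<in>{1..n}. v \<in> low n E f d}. 1)" by simp
    also have "\<dots> = (\<Sum>v\<in>{1..n}. if v \<in> low n E f d then 1 else 0)"
      by (rule sum.inter_filter) simp
    also have "\<dots> = (\<Sum>v\<in>{1..n}. indicator {E. v \<in> low n E f d} E)"
      by (intro sum.cong) (auto simp: indicator_def)
    finally show ?thesis .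
  qed
  have "measure_pmf.expectation G (\<lambda>E. real (card (low n E f d))) =
      (\<Sum>v\<in>{1..n}. measure_pmf.prob G {E. v \<in> low n E f d})"
    unfolding low by (subst Bochner_Integration.integral_sum)
      (auto intro: integrable_measure_pmf_finite[OF finG])
  also have "\<dots> \<le> (\<Sum>v\<in>{1..n}. 3 * exp (- d / 120))" by (intro sum_mono v)
  finally have E: "measure_pmf.expectation G (\<lambda>E. real (card (low n E f d))) \<le> 3 * n * exp (- d / 120)"
    by simp
  let ?a = "exp (- d / 240) * n / 2"
  have "measure_pmf.prob G {E. \<not> 2 * real (card (low n E f d)) \<le> exp (- d / 240) * n} \<le>
      measure_pmf.prob G {E. ?a \<le> real (card (low n E f d))}"
    by (rule prob_mono) auto
  also have "\<dots> \<le> measure_pmf.expectation G (\<lambda>E. real (card (low n E f d))) / ?a"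
    using n_pos by (intro markov_pmf[OF finG]) auto
  also have "\<dots> \<le> 3 * n * exp (- d / 120) / ?a"
    using E n_pos by (intro divide_right_mono) auto
  also have "\<dots> = 6 * (exp (- d / 120) / exp (- d / 240))" using n_pos by simp
  also have "exp (- d / 120) / exp (- d / 240) = exp (- d / 240)" by (simp flip: exp_diff)
  finally show ?thesis .
qed

text \<open>Since exp 1 - 1 <= 2, each \<open>exp (real (card (nbs E v)))\<close> has expectation at
  most exp(2d); Markov's inequality with exp(3d) leaves exp(-d).\<close>

lemma prob_degrees:
  "measure_pmf.prob G {E. \<not> (\<Sum>v\<in>{1..n}. exp (real (card (nbs E v)))) \<le> n * exp (3 * d)} \<le> exp (- d)"
proof -
  have finG: "finite (set_pmf G)" by (rule finite_set_edge_pmf[OF finite_cross_pairs])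
  have v: "measure_pmf.expectation G (\<lambda>E. exp (real (card (nbs E v)))) \<le> exp (2 * d)" for v
  proof -
    let ?W = "{C\<in>cross_pairs n f. v \<in> C}"
    let ?w = "\<lambda>C. if v \<in> C then 1 else (0::real)"
    have "exp (real (card (nbs E v))) = of_bool ({} \<subseteq> E) * exp (\<Sum>C\<in>E - {}. ?w C)"
      if "E \<in> set_pmf G" for E
    proof -
      have E: "E \<subseteq> cross_pairs n f" using set_G that .
      then have "finite E" using finite_cross_pairs finite_subset by blast
      have "{C\<in>E. v \<in> C} = (\<lambda>y. {v, y}) ` nbs E v"
      proof (intro equalityI subsetI)
        fix C assume C: "C \<in> {C\<in>E. v \<in> C}"
        then obtain a b where "C = {a, b}" using E unfolding cross_pairs_def by blast
        then obtain y where "C = {v, y}" using C by auto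
        then show "C \<in> (\<lambda>y. {v, y}) ` nbs E v" using C by (auto simp: nbs_def)
      qed (auto simp: nbs_def)
      moreover have "inj_on (\<lambda>y. {v, y}) (nbs E v)" by (auto simp: inj_on_def doubleton_eq_iff)
      ultimately have "real (card (nbs E v)) = (\<Sum>C\<in>{C\<in>E. v \<in> C}. 1)" by (simp add: card_image)
      also have "\<dots> = (\<Sum>C\<in>E. ?w C)" by (rule sum.inter_filter[OF \<open>finite E\<close>])
      finally show ?thesis by simp
    qed
    then have "measure_pmf.expectation G (\<lambda>E. exp (real (card (nbs E v)))) =
        measure_pmf.expectation G (\<lambda>E. of_bool ({} \<subseteq> E) * exp (\<Sum>C\<in>E - {}. ?w C))"
      by (intro integral_cong_AE) (auto simp: AE_measure_pmf_iff)
    also have "\<dots> \<le> p ^ card ({} :: nat set set) * exp (p * (\<Sum>C\<in>cross_pairs n f - {}. exp (?w C) - 1))"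
      by (rule edge_expectation[OF finite_cross_pairs _ p]) simp
    also have "(\<Sum>C\<in>cross_pairs n f - {}. exp (?w C) - 1) = (\<Sum>C\<in>cross_pairs n f. if v \<in> C then exp 1 - 1 else 0)"
      by (intro sum.cong) auto
    also have "\<dots> = (\<Sum>C\<in>?W. exp 1 - 1)"
      by (rule sum.inter_filter[OF finite_cross_pairs, symmetric])
    also have "\<dots> = card ?W * (exp 1 - 1)" by simp
    also have "p ^ card ({} :: nat set set) * exp (p * (card ?W * (exp 1 - 1))) \<le> exp (p * (real n * 2))"
    proof -
      have "?W \<subseteq> (\<lambda>y. {v, y}) ` {1..n}"
        unfolding cross_pairs_def by (auto simp: insert_commute)
      then have "card ?W \<le> card {1..n}" by (intro surj_card_le) auto
      moreover have "exp 1 - 1 \<le> (2::real)" using exp_le by simp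
      ultimately have "real (card ?W) * (exp 1 - 1) \<le> real n * 2" by (intro mult_mono) auto
      then show ?thesis using p by (simp add: mult_left_mono)
    qed
    also have "p * (real n * 2) = 2 * d" using d by simp
    finally show ?thesis .
  qed
  let ?X = "\<lambda>E. \<Sum>v\<in>{1..n}. exp (real (card (nbs E v)))"
  have "measure_pmf.expectation G ?X = (\<Sum>v\<in>{1..n}. measure_pmf.expectation G (\<lambda>E. exp (real (card (nbs E v)))))"
    by (intro Bochner_Integration.integral_sum integrable_measure_pmf_finite[OF finG])
  also have "\<dots> \<le> (\<Sum>v\<in>{1..n}. exp (2 * d))" by (intro sum_mono v)
  finally have E: "measure_pmf.expectation G ?X \<le> n * exp (2 * d)" by simp
  have "measure_pmf.prob G {E. \<not> ?X E \<le> n * exp (3 * d)} \<le> measure_pmf.prob G {E. n * exp (3 * d) \<le> ?X E}"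
    by (rule prob_mono) auto
  also have "\<dots> \<le> measure_pmf.expectation G ?X / (n * exp (3 * d))"
    using n_pos by (intro markov_pmf[OF finG]) (auto intro: sum_nonneg)
  also have "\<dots> \<le> n * exp (2 * d) / (n * exp (3 * d))"
    using E by (intro divide_right_mono) auto
  also have "\<dots> = exp (2 * d - 3 * d)" unfolding exp_diff using n_pos by simp
  finally show ?thesis by simp
qed

text \<open>\<open>F\<close> and \<open>F'\<close> may overlap, so an edge can be counted from both
  ends and only d/34 edges per vertex of \<open>F'\<close> are guaranteed. The choice exp u = n /
  (34 card F) bounds the mean term of the Chernoff exponent by d card F' / 34, which gives the -1
  beside the logarithm.\<close>

lemma prob_heavy_pair:
  assumes F: "F \<subseteq> {1..n}" "F \<noteq> {}" "34 * card F \<le> n" and F': "F' \<subseteq> {1..n}"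
  shows "measure_pmf.prob G {E. \<forall>x\<in>F'. d / 17 \<le> real (card (nbs E x \<inter> F))} \<le>
    exp (- (d * card F' / 34) * (ln (n / (34 * card F)) - 1))"
proof -
  define W where "W = {C\<in>cross_pairs n f. \<exists>x\<in>F'. \<exists>y\<in>F. C = {x, y}}"
  define u where "u = ln (n / (34 * card F))"
  have finF: "finite F" and finF': "finite F'"
    using finite_subset[OF F(1)] finite_subset[OF F'] by simp_all
  have cardF: "card F > 0" using F(2) finF by (simp add: card_gt_0_iff)
  have u: "u \<ge> 0" "exp u = n / (34 * card F)"
    using F(3) cardF n_pos by (simp_all add: u_def)
  have "W \<subseteq> (\<lambda>(x, y). {x, y}) ` (F' \<times> F)" unfolding W_def by auto
  then have "card W \<le> card (F' \<times> F)" using finF finF' by (intro surj_card_le) auto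
  then have cardW: "real (card W) \<le> real (card F') * real (card F)"
    by (simp add: card_cartesian_product flip: of_nat_mult)
  let ?t = "u * (d * card F' / 34)"
  have "measure_pmf.prob G {E. \<forall>x\<in>F'. d / 17 \<le> real (card (nbs E x \<inter> F))} \<le>
      measure_pmf.prob G {E. {} \<subseteq> E \<and> ?t \<le> u * real (card (E \<inter> W))}"
  proof (rule prob_mono)
    fix E assume E: "E \<in> set_pmf G" "E \<in> {E. \<forall>x\<in>F'. d / 17 \<le> real (card (nbs E x \<inter> F))}"
    have finE: "finite (E \<inter> W)"
      using finite_subset[OF set_G[OF E(1)] finite_cross_pairs] by simp
    let ?X = "\<lambda>C. {q\<in>F' \<times> F. {fst q, snd q} = C}"
    have 2: "card (?X C) \<le> 2" if C: "C \<in> E \<inter> W" for C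
    proof -
      obtain a b where "C = {a, b}" using C unfolding W_def by blast
      then have "?X C \<subseteq> {(a, b), (b, a)}" by (auto simp: doubleton_eq_iff)
      from card_mono[OF _ this] have "card (?X C) \<le> card {(a, b), (b, a)}" by simp
      also have "\<dots> \<le> 2" using card_length[of "[(a, b), (b, a)]"] by (simp only: list.set list.size)
      finally show ?thesis .
    qed
    have "(\<Sum>x\<in>F'. d / 17) \<le> (\<Sum>x\<in>F'. real (card (nbs E x \<inter> F)))"
      using E(2) by (intro sum_mono) auto
    also have "\<dots> = real (card (SIGMA x:F'. nbs E x \<inter> F))"
      using finF finF' by (simp add: card_SigmaI)
    also have "card (SIGMA x:F'. nbs E x \<inter> F) \<le> card (\<Union>C\<in>E \<inter> W. ?X C)"
    proof (rule card_mono)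
      show "finite (\<Union>C\<in>E \<inter> W. ?X C)" using finE finF finF' by auto
      show "(SIGMA x:F'. nbs E x \<inter> F) \<subseteq> (\<Union>C\<in>E \<inter> W. ?X C)"
      proof
        fix q assume "q \<in> (SIGMA x:F'. nbs E x \<inter> F)"
        then obtain x y where q: "q = (x, y)" "x \<in> F'" "y \<in> F" "{x, y} \<in> E" by (auto simp: nbs_def)
        then have "{x, y} \<in> E \<inter> W" using set_G[OF E(1)] unfolding W_def by blast
        then show "q \<in> (\<Union>C\<in>E \<inter> W. ?X C)" using q by force
      qed
    qed
    also have "card (\<Union>C\<in>E \<inter> W. ?X C) \<le> (\<Sum>C\<in>E \<inter> W. card (?X C))"
      by (rule card_UN_le[OF finE])
    also have "\<dots> \<le> (\<Sum>C\<in>E \<inter> W. 2)" by (intro sum_mono 2)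
    finally have "d * card F' / 34 \<le> real (card (E \<inter> W))" by (simp add: mult.commute)
    from mult_left_mono[OF this u(1)]
    show "E \<in> {E. {} \<subseteq> E \<and> ?t \<le> u * real (card (E \<inter> W))}" by simp
  qed
  also have "\<dots> \<le> p ^ card ({} :: nat set set) * exp (p * (real (card W) * (exp u - 1)) - ?t)"
    by (rule edge_chernoff_subset[OF finite_cross_pairs _ p]) (auto simp: W_def)
  also have "\<dots> \<le> exp (- (d * card F' / 34) * (u - 1))"
  proof -
    have "real (card W) * (exp u - 1) \<le> real (card F') * real (card F) * exp u"
      using cardW u(1) by (intro mult_mono) auto
    also have "\<dots> = real (card F') * n / 34" using cardF by (simp add: u(2))
    finally have "p * (real (card W) * (exp u - 1)) \<le> p * (real (card F') * n / 34)"
      using p(1) by (rule mult_left_mono)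
    also have "\<dots> = d * card F' / 34" using d by simp
    finally have "p * (real (card W) * (exp u - 1)) - ?t \<le> d * card F' / 34 - ?t" by simp
    also have "\<dots> = - (d * card F' / 34) * (u - 1)" by (simp only: algebra_simps)
    finally show ?thesis by simp
  qed
  finally show ?thesis unfolding u_def .
qed

text \<open>\<open>a'\<close> is the least size violating expansion for a set of size
  \<open>a\<close>. The Chernoff gain has the factor x - 1, so x = ln (n / (34 a)) must stay away
  from 1: the bound 120 a <= n gives x >= ln (60/17) >= 5/4.\<close>

lemma expansion_count:
  assumes a: "a > 0" "120 * a \<le> n" and d_large: "d \<ge> 5440"
  defines "a' \<equiv> a div 2 + 1"
  shows "real (n choose a) * (real (n choose a') * exp (- (d * a' / 34) * (ln (n / (34 * a)) - 1)))
    \<le> exp (- d / 544) ^ (a + 1)"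
proof -
  define x where "x = ln (n / (34 * a))"
  have ratio: "60 / 17 \<le> n / (34 * a)" using a by (simp add: field_simps)
  have exp_x: "exp x = n / (34 * a)" using a n_pos by (simp add: x_def)
  have e: "(2.5::real) \<le> exp 1" "exp 1 \<le> (2.72::real)"
    using exp_lower_Taylor_quadratic[of 1] e_less_272 by simp_all
  have "exp (5 / 4) ^ 4 = exp (1::real) ^ 5" by (simp flip: exp_of_nat_mult)
  also have "\<dots> \<le> 2.72 ^ 5" using e by (intro power_mono) auto
  also have "\<dots> \<le> (60 / 17) ^ 4" by (simp add: power_divide)
  finally have "exp (5 / 4) ^ Suc 3 \<le> (60 / 17 :: real) ^ Suc 3" by simp
  then have "exp (5 / 4) \<le> (60 / 17 :: real)" by (rule power_le_imp_le_base) simp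
  also have "\<dots> \<le> exp x" using ratio exp_x by simp
  finally have x: "5 / 4 \<le> x" by simp
  have "34 \<le> (2.5::real) ^ 4" by (simp add: power_divide)
  also have "(2.5::real) ^ 4 \<le> exp 1 ^ 4" using e by (intro power_mono) auto
  finally have 34: "34 \<le> exp (4::real)" by (simp flip: exp_of_nat_mult)
  have "68 \<le> (2.5::real) ^ 5" by (simp add: power_divide)
  also have "(2.5::real) ^ 5 \<le> exp 1 ^ 5" using e by (intro power_mono) auto
  finally have 68: "68 \<le> exp (5::real)" by (simp flip: exp_of_nat_mult)
  have a': "a' > 0" "a \<le> 2 * a'" "a + 1 \<le> 2 * a'" unfolding a'_def by auto
  have n_a: "n / a = 34 * exp x" using a by (simp add: exp_x)
  have "exp 1 * n / a = exp 1 * (34 * exp x)" by (simp only: n_a times_divide_eq_right[symmetric])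
  also have "\<dots> \<le> exp 1 * (exp 4 * exp x)" using 34 by (intro mult_left_mono mult_right_mono) auto
  also have "\<dots> = exp (5 + x)" by (simp flip: exp_add)
  finally have 1: "exp 1 * n / a \<le> exp (5 + x)" .
  have "real n * real a \<le> real n * (2 * real a')" using a'(2) by (intro mult_left_mono) linarith+
  then have "n / a' \<le> 2 * (n / a)" using a a' by (simp add: field_simps)
  then have "n / a' \<le> 68 * exp x" unfolding n_a by simp
  then have "exp 1 * (n / a') \<le> exp 1 * (68 * exp x)" by (rule mult_left_mono) simp
  also have "\<dots> \<le> exp 1 * (exp 5 * exp x)" using 68 by (intro mult_left_mono mult_right_mono) auto
  also have "\<dots> = exp (6 + x)" by (simp flip: exp_add)
  finally have 2: "exp 1 * n / a' \<le> exp (6 + x)" by simp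
  have "real (n choose a) \<le> (exp 1 * n / a) ^ a" by (rule choose_le[OF a(1)])
  also have "\<dots> \<le> exp (5 + x) ^ a" using 1 by (intro power_mono) auto
  also have "\<dots> = exp (a * (5 + x))" by (simp add: exp_of_nat_mult)
  also have "\<dots> \<le> exp (real a' * (10 + 2 * x))"
  proof -
    have "real a * (5 + x) \<le> (2 * real a') * (5 + x)" using a'(2) x by (intro mult_right_mono) auto
    then show ?thesis by (simp add: algebra_simps)
  qed
  finally have c1: "real (n choose a) \<le> exp (real a' * (10 + 2 * x))" .
  have "real (n choose a') \<le> (exp 1 * n / a') ^ a'" by (rule choose_le[OF a'(1)])
  also have "\<dots> \<le> exp (6 + x) ^ a'" using 2 by (intro power_mono) auto
  also have "\<dots> = exp (a' * (6 + x))" by (simp add: exp_of_nat_mult)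
  finally have c2: "real (n choose a') \<le> exp (a' * (6 + x))" .
  \<comment> \<open>From x >= 5/4 follow x - 1 >= x/5 and 16 + 3x <= 16x, so the gain is at least
    dx/170. One half of it is at least 16x by d >= 5440, the other half dx/340 at least
    d/272.\<close>
  have "16 + 3 * x - d / 34 * (x - 1) \<le> - (d / 272)"
  proof -
    define y where "y = d * x"
    define z where "z = d / 34 * (x - 1)"
    have "d / 34 * (x / 5) \<le> z" unfolding z_def using x d_large by (intro mult_left_mono) auto
    then have "y / 170 \<le> z" by (simp add: y_def)
    moreover have "16 + 3 * x \<le> 16 * x" using x by simp
    moreover have "5440 * x \<le> y" unfolding y_def using x d_large by (intro mult_right_mono) auto
    moreover have "d * (5 / 4) \<le> y" unfolding y_def using x d_large by (intro mult_left_mono) auto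
    ultimately have "16 + 3 * x - z \<le> - (d / 272)" by simp
    then show ?thesis unfolding z_def .
  qed
  then have final: "real a' * (16 + 3 * x - d / 34 * (x - 1)) \<le> real a' * (- (d / 272))"
    by (intro mult_left_mono) auto
  have "real (n choose a) * (real (n choose a') * exp (- (d * a' / 34) * (x - 1))) \<le>
      exp (real a' * (10 + 2 * x)) * (exp (a' * (6 + x)) * exp (- (d * a' / 34) * (x - 1)))"
    by (intro mult_mono c1 c2) auto
  also have "\<dots> = exp (real a' * (16 + 3 * x - d / 34 * (x - 1)))"
    by (simp add: algebra_simps flip: exp_add)
  also have "\<dots> \<le> exp (real a' * (- (d / 272)))" using final by simp
  also have "\<dots> \<le> exp (real (a + 1) * (- d / 544))"
  proof -
    have "d / 544 * real (a + 1) \<le> d / 544 * (2 * real a')"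
      using a'(3) d_large by (intro mult_left_mono) linarith+
    then show ?thesis by (simp add: algebra_simps)
  qed
  also have "\<dots> = exp (- d / 544) ^ (a + 1)" by (rule exp_of_nat_mult)
  finally show ?thesis unfolding x_def by simp
qed

text \<open>The exponent \<open>a + 1\<close> instead of \<open>a\<close> supplies a spare factor,
  which absorbs the 2 of the geometric sum.\<close>

lemma prob_expanding:
  assumes d_large: "d \<ge> 5440" and q: "exp (- d / 544) \<le> 1 / 2"
  shows "measure_pmf.prob G {E. \<not> expanding n E d} \<le> exp (- d / 544)"
proof -
  define I where "I = {a\<in>{1..n}. 120 * a \<le> n}"
  define FS where "FS a = {F. F \<subseteq> {1..n} \<and> card F = a}" for a
  let ?X = "\<lambda>F F'. {E. \<forall>x\<in>F'. d / 17 \<le> real (card (nbs E x \<inter> F))}"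
  have finFS: "finite (FS a)" for a
    unfolding FS_def by (rule finite_subset[of _ "Pow {1..n}"]) auto
  have cardFS: "card (FS a) = n choose a" for a
    using n_subsets[of "{1..n}" a] unfolding FS_def by simp
  have "measure_pmf.prob G {E. \<not> expanding n E d} \<le>
      measure_pmf.prob G (\<Union>a\<in>I. \<Union>F\<in>FS a. \<Union>F'\<in>FS (a div 2 + 1). ?X F F')"
  proof (rule prob_mono)
    fix E assume "E \<in> {E. \<not> expanding n E d}"
    then obtain F where F: "F \<subseteq> {1..n}" "120 * card F \<le> n" "card F < 2 * card (heavy n E d F)"
      unfolding expanding_def by (auto simp: not_le)
    have "F \<noteq> {}"
    proof
      assume "F = {}"
      then have "heavy n E d F = {}" unfolding heavy_def using d_pos by simp
      then show False using F(3) by simp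
    qed
    then have "card F > 0" using finite_subset[OF F(1)] by (simp add: card_gt_0_iff)
    moreover have "card F \<le> card {1..n}" using F(1) by (intro card_mono) auto
    ultimately have I: "card F \<in> I" unfolding I_def using F(2) by simp
    have "card F div 2 + 1 \<le> card (heavy n E d F)" using F(3) by simp
    then obtain F' where F': "F' \<subseteq> heavy n E d F" "card F' = card F div 2 + 1"
      by (rule obtain_subset_with_card_n)
    have "F' \<in> FS (card F div 2 + 1)" "E \<in> ?X F F'"
      using F' unfolding FS_def heavy_def by auto
    moreover have "F \<in> FS (card F)" using F(1) unfolding FS_def by simp
    ultimately show "E \<in> (\<Union>a\<in>I. \<Union>F\<in>FS a. \<Union>F'\<in>FS (a div 2 + 1). ?X F F')"
      using I by blast
  qed
  also have "\<dots> \<le> (\<Sum>a\<in>I. measure_pmf.prob G (\<Union>F\<in>FS a. \<Union>F'\<in>FS (a div 2 + 1). ?X F F'))"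
    by (rule prob_UN_sum) (simp add: I_def)
  also have "\<dots> \<le> (\<Sum>a\<in>I. exp (- d / 544) ^ (a + 1))"
  proof (rule sum_mono)
    fix a assume a: "a \<in> I"
    have "measure_pmf.prob G (\<Union>F\<in>FS a. \<Union>F'\<in>FS (a div 2 + 1). ?X F F') \<le>
        card (FS a) * (card (FS (a div 2 + 1)) * exp (- (d * (a div 2 + 1) / 34) * (ln (n / (34 * a)) - 1)))"
    proof (intro prob_UN_le finFS)
      fix F F' assume FF: "F \<in> FS a" "F' \<in> FS (a div 2 + 1)"
      have "F \<noteq> {}" "34 * card F \<le> n" using FF(1) a unfolding FS_def I_def by auto
      then show "measure_pmf.prob G (?X F F') \<le> exp (- (d * (a div 2 + 1) / 34) * (ln (n / (34 * a)) - 1))"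
        using prob_heavy_pair[of F F'] FF unfolding FS_def by auto
    qed
    also have "\<dots> \<le> exp (- d / 544) ^ (a + 1)"
      unfolding cardFS using expansion_count[of a] a d_large unfolding I_def by simp
    finally show "measure_pmf.prob G (\<Union>F\<in>FS a. \<Union>F'\<in>FS (a div 2 + 1). ?X F F') \<le> exp (- d / 544) ^ (a + 1)" .
  qed
  also have "\<dots> \<le> (\<Sum>a\<in>{1..n}. exp (- d / 544) ^ (a + 1))"
    by (intro sum_mono2) (auto simp: I_def)
  also have "\<dots> = exp (- d / 544) * (\<Sum>a\<in>{1..n}. exp (- d / 544) ^ a)"
    by (simp add: sum_distrib_left)
  also have "\<dots> \<le> exp (- d / 544) * (2 * exp (- d / 544))"
    using q by (intro mult_left_mono geometric_sum_le) auto
  also have "\<dots> \<le> exp (- d / 544) * 1"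
    using q by (intro mult_left_mono) auto
  finally show ?thesis by simp
qed

end

text \<open>A choice \<open>(K, \<pi>, J)\<close> consists of a vertex set, a parent map and, for each vertex of \<open>K\<close>, the
  color of a class in which it has few neighbors, or 0.\<close>

definition tree_choices :: "nat \<Rightarrow> nat \<Rightarrow> (nat set \<times> (nat \<Rightarrow> nat) \<times> (nat \<Rightarrow> nat)) set" where
  "tree_choices n s = (SIGMA K:{K. K \<subseteq> {1..n} \<and> card K = s}. (K \<rightarrow>\<^sub>E K) \<times> (K \<rightarrow>\<^sub>E {0..3}))"

lemma tree_choices_bound:
  assumes "s > 0"
  shows "finite (tree_choices n s)" "real (card (tree_choices n s)) \<le> (4 * exp 1 * n) ^ s"
proof -
  have finK: "finite {K. K \<subseteq> {1..n} \<and> card K = s}"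
    by (rule finite_subset[of _ "Pow {1..n}"]) auto
  have K: "finite ((K \<rightarrow>\<^sub>E K) \<times> (K \<rightarrow>\<^sub>E {0..3::nat}))" "card ((K \<rightarrow>\<^sub>E K) \<times> (K \<rightarrow>\<^sub>E {0..3::nat})) = s ^ s * 4 ^ s"
    if "K \<subseteq> {1..n} \<and> card K = s" for K
  proof -
    have "finite K" using that finite_subset[of K "{1..n}"] by simp
    then show "finite ((K \<rightarrow>\<^sub>E K) \<times> (K \<rightarrow>\<^sub>E {0..3::nat}))" by (intro finite_cartesian_product finite_PiE) auto
    show "card ((K \<rightarrow>\<^sub>E K) \<times> (K \<rightarrow>\<^sub>E {0..3::nat})) = s ^ s * 4 ^ s"
      using \<open>finite K\<close> that by (simp add: card_cartesian_product card_PiE)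
  qed
  show "finite (tree_choices n s)"
    unfolding tree_choices_def by (rule finite_SigmaI[OF finK K(1)]) simp
  have "card (tree_choices n s) = (\<Sum>K\<in>{K. K \<subseteq> {1..n} \<and> card K = s}. s ^ s * 4 ^ s)"
    unfolding tree_choices_def
  proof (subst card_SigmaI[OF finK])
    show "\<forall>K\<in>{K. K \<subseteq> {1..n} \<and> card K = s}. finite ((K \<rightarrow>\<^sub>E K) \<times> (K \<rightarrow>\<^sub>E {0..3::nat}))"
      using K(1) by blast
  qed (intro sum.cong refl K(2); simp)
  also have "\<dots> = (n choose s) * (s ^ s * 4 ^ s)"
    using n_subsets[of "{1..n}" s] by simp
  finally have "real (card (tree_choices n s)) = real (n choose s) * (real s * 4) ^ s"
    by (simp add: power_mult_distrib)
  also have "\<dots> \<le> (exp 1 * n / s) ^ s * (real s * 4) ^ s"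
    by (intro mult_right_mono choose_le[OF assms]) auto
  also have "\<dots> = (exp 1 * n / s * (real s * 4)) ^ s"
    by (rule power_mult_distrib[symmetric])
  also have "exp 1 * n / s * (real s * 4) = 4 * exp 1 * n" using assms by simp
  finally show "real (card (tree_choices n s)) \<le> (4 * exp 1 * n) ^ s" .
qed

section \<open>Union bounds over trees with many low vertices\<close>

context planted_classes begin

definition low_event :: "nat set set \<Rightarrow> nat set \<Rightarrow> (nat \<Rightarrow> nat) \<Rightarrow> nat set set set" where
  "low_event T K J = {E. T \<subseteq> E \<and> (\<forall>v\<in>{v\<in>K. J v \<noteq> 0}. real (card {y\<in>nbs E v. f y = J v}) < d / 4)}"

text \<open>The conditions on a choice that do not depend on the random edges.\<close>

definition choice_ok :: "nat set \<Rightarrow> (nat \<Rightarrow> nat) \<Rightarrow> (nat \<Rightarrow> nat) \<Rightarrow> bool" where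
  "choice_ok K \<pi> J \<longleftrightarrow> card (tree_edges K \<pi>) = card K - 1 \<and> card K \<le> 2 * card {v\<in>K. J v \<noteq> 0} \<and>
     (\<forall>v\<in>K. J v \<noteq> 0 \<longrightarrow> J v \<noteq> f v)"

text \<open>At least \<open>s / 2\<close> vertices of \<open>K\<close> are required to be low, each
  with factor exp(-d/120); this gives exp(-d/240) per vertex of \<open>K\<close>.\<close>

lemma low_event_prob:
  assumes c: "(K, \<pi>, J) \<in> tree_choices n s" and s: "120 * s \<le> n" and ok: "choice_ok K \<pi> J"
    and T: "T \<subseteq> Pow K"
  shows "measure_pmf.prob G (low_event T K J) \<le> p ^ card T * exp (- d / 240) ^ s"
proof -
  let ?A = "{v\<in>K. J v \<noteq> 0}"
  have J: "J v \<in> {0..3}" if "v \<in> K" for v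
    using c that unfolding tree_choices_def by (auto dest: PiE_mem)
  have K: "K \<subseteq> {1..n}" "card K = s" using c unfolding tree_choices_def by auto
  have "measure_pmf.prob G (low_event T K J) \<le> p ^ card T * exp (- d / 120) ^ card ?A"
    unfolding low_event_def
  proof (rule low_prob)
    fix v assume v: "v \<in> ?A"
    then show "J v \<in> {1..3} \<and> J v \<noteq> f v" using J[of v] ok unfolding choice_ok_def by auto
  qed (use K s T in auto)
  also have "exp (- d / 120) ^ card ?A = exp (- (d / 120 * card ?A))"
    by (simp flip: exp_of_nat2_mult)
  also have "\<dots> \<le> exp (- (d / 240 * s))"
  proof -
    have "d / 240 * real s \<le> d / 240 * (2 * real (card ?A))"
      using ok K d_pos unfolding choice_ok_def by (intro mult_left_mono) linarith+
    then show ?thesis by simp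
  qed
  also have "\<dots> = exp (- d / 240) ^ s" by (simp flip: exp_of_nat2_mult)
  finally show ?thesis using p by (simp add: mult_left_mono)
qed

text \<open>Each low vertex selects a witnessing class. Restricting both maps to \<open>K\<close>
  makes the number of choices finite without changing the edges.\<close>

lemma low_tree_choice:
  assumes E: "E \<subseteq> cross_pairs n f" and t: "low_tree n E f d K \<pi>" and s: "card K = s"
  obtains \<pi>' J where "(K, \<pi>', J) \<in> tree_choices n s" "choice_ok K \<pi>' J"
    "tree_edges K \<pi>' = tree_edges K \<pi>" "E \<in> low_event (tree_edges K \<pi>) K J"
proof -
  define Q where "Q v j \<longleftrightarrow> j \<in> {1..3} \<and> j \<noteq> f v \<and> real (card {y\<in>nbs E v. f y = j}) < d / 4" for v j
  define J where "J = restrict (\<lambda>v. if v \<in> low n E f d then SOME j. Q v j else 0) K"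
  have Q: "Q v (J v)" if "v \<in> K \<inter> low n E f d" for v
  proof -
    have "\<exists>j. Q v j" using that unfolding low_def Q_def by blast
    then have "Q v (SOME j. Q v j)" by (rule someI_ex)
    then show ?thesis using that unfolding J_def by simp
  qed
  have J0: "J v = 0" if "v \<in> K" "v \<notin> low n E f d" for v using that unfolding J_def by simp
  have A: "{v\<in>K. J v \<noteq> 0} = K \<inter> low n E f d"
  proof (intro equalityI subsetI)
    fix v assume "v \<in> K \<inter> low n E f d"
    then show "v \<in> {v\<in>K. J v \<noteq> 0}" using Q[of v] unfolding Q_def by auto
  next
    fix v assume "v \<in> {v\<in>K. J v \<noteq> 0}"
    then have "v \<in> K" "J v \<noteq> 0" by simp_all
    then show "v \<in> K \<inter> low n E f d" using J0[of v] by (cases "v \<in> low n E f d") simp_all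
  qed
  have J_range: "J v \<in> {0..3}" if "v \<in> K" for v
    using Q[of v] J0[of v] that unfolding Q_def by (cases "v \<in> low n E f d") auto
  have edges: "tree_edges K (restrict \<pi> K) = tree_edges K \<pi>"
    unfolding tree_edges_def by (auto simp: image_def)
  have "J \<in> K \<rightarrow>\<^sub>E {0..3}"
    using J_range unfolding PiE_def extensional_def J_def by auto
  moreover have "restrict \<pi> K \<in> K \<rightarrow>\<^sub>E K" using t unfolding low_tree_def by auto
  ultimately have "(K, restrict \<pi> K, J) \<in> tree_choices n s"
    using t s unfolding tree_choices_def low_tree_def by simp
  moreover have "choice_ok K (restrict \<pi> K) J"
    unfolding choice_ok_def edges A using t Q A unfolding low_tree_def Q_def by blast
  moreover have "E \<in> low_event (tree_edges K \<pi>) K J"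
    unfolding low_event_def A using t Q unfolding low_tree_def Q_def by blast
  ultimately show ?thesis using edges by (intro that)
qed

lemma tree_edges_sub: "\<pi> \<in> K \<rightarrow> K \<Longrightarrow> tree_edges K \<pi> \<subseteq> Pow K"
  unfolding tree_edges_def by auto

lemma tree_choices_maps: "(K, \<pi>, J) \<in> tree_choices n s \<Longrightarrow> \<pi> \<in> K \<rightarrow> K \<and> finite K \<and> card K = s"
  unfolding tree_choices_def using finite_subset[of K "{1..n}"] by auto

lemma prob_tree:
  assumes s: "s > 0" "120 * s \<le> n"
  shows "measure_pmf.prob G {E. \<exists>K \<pi>. low_tree n E f d K \<pi> \<and> card K = s} \<le>
    (4 * exp 1 * n) ^ s * (p ^ (s - 1) * exp (- d / 240) ^ s)"
proof -
  let ?X = "\<lambda>(K, \<pi>, J). if choice_ok K \<pi> J then low_event (tree_edges K \<pi>) K J else {}"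
  have "measure_pmf.prob G {E. \<exists>K \<pi>. low_tree n E f d K \<pi> \<and> card K = s} \<le>
      measure_pmf.prob G (\<Union>c\<in>tree_choices n s. ?X c)"
  proof (rule prob_mono)
    fix E assume E: "E \<in> set_pmf G" "E \<in> {E. \<exists>K \<pi>. low_tree n E f d K \<pi> \<and> card K = s}"
    then obtain K \<pi> where t: "low_tree n E f d K \<pi>" "card K = s" by blast
    obtain \<pi>' J where "(K, \<pi>', J) \<in> tree_choices n s" "choice_ok K \<pi>' J"
      "tree_edges K \<pi>' = tree_edges K \<pi>" "E \<in> low_event (tree_edges K \<pi>) K J"
      by (rule low_tree_choice[OF set_G[OF E(1)] t])
    then show "E \<in> (\<Union>c\<in>tree_choices n s. ?X c)"
      by (intro UN_I[of "(K, \<pi>', J)"]) simp_all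
  qed
  also have "\<dots> \<le> card (tree_choices n s) * (p ^ (s - 1) * exp (- d / 240) ^ s)"
  proof (rule prob_UN_le[OF tree_choices_bound(1)[OF s(1)]])
    fix c assume c: "c \<in> tree_choices n s"
    obtain K \<pi> J where K: "c = (K, \<pi>, J)" by (cases c)
    have c': "(K, \<pi>, J) \<in> tree_choices n s" using c K by simp
    note maps = tree_choices_maps[OF c']
    show "measure_pmf.prob G (?X c) \<le> p ^ (s - 1) * exp (- d / 240) ^ s"
    proof (cases "choice_ok K \<pi> J")
      case True
      have "measure_pmf.prob G (low_event (tree_edges K \<pi>) K J) \<le>
          p ^ card (tree_edges K \<pi>) * exp (- d / 240) ^ s"
        using maps by (intro low_event_prob[OF c' s(2) True] tree_edges_sub) simp
      moreover have "card (tree_edges K \<pi>) = s - 1"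
        using True maps unfolding choice_ok_def by simp
      ultimately show ?thesis using True K by simp
    qed (use p K in simp)
  qed
  also have "\<dots> \<le> (4 * exp 1 * n) ^ s * (p ^ (s - 1) * exp (- d / 240) ^ s)"
    using p by (intro mult_right_mono tree_choices_bound s) auto
  finally show ?thesis .
qed

lemma prob_cycle:
  assumes s: "s > 0" "120 * s \<le> n"
  shows "measure_pmf.prob G {E. \<exists>K \<pi>. low_tree n E f d K \<pi> \<and> card K = s \<and>
      \<not> {e\<in>E. e \<subseteq> K} \<subseteq> tree_edges K \<pi>} \<le>
    (4 * exp 1 * n) ^ s * (real (s * s) * (p ^ s * exp (- d / 240) ^ s))"
proof -
  let ?Y = "\<lambda>K \<pi> J q. if {fst q, snd q} \<notin> tree_edges K \<pi>
    then low_event (insert {fst q, snd q} (tree_edges K \<pi>)) K J else {}"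
  let ?X = "\<lambda>(K, \<pi>, J). if choice_ok K \<pi> J then (\<Union>q\<in>K \<times> K. ?Y K \<pi> J q) else {}"
  have "measure_pmf.prob G {E. \<exists>K \<pi>. low_tree n E f d K \<pi> \<and> card K = s \<and>
      \<not> {e\<in>E. e \<subseteq> K} \<subseteq> tree_edges K \<pi>} \<le> measure_pmf.prob G (\<Union>c\<in>tree_choices n s. ?X c)"
  proof (rule prob_mono)
    fix E assume E: "E \<in> set_pmf G" "E \<in> {E. \<exists>K \<pi>. low_tree n E f d K \<pi> \<and> card K = s \<and>
      \<not> {e\<in>E. e \<subseteq> K} \<subseteq> tree_edges K \<pi>}"
    then obtain K \<pi> e where t: "low_tree n E f d K \<pi>" "card K = s" and
      e: "e \<in> E" "e \<subseteq> K" "e \<notin> tree_edges K \<pi>" by blast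
    obtain \<pi>' J where c: "(K, \<pi>', J) \<in> tree_choices n s" "choice_ok K \<pi>' J"
      "tree_edges K \<pi>' = tree_edges K \<pi>" "E \<in> low_event (tree_edges K \<pi>) K J"
      by (rule low_tree_choice[OF set_G[OF E(1)] t])
    obtain a b where ab: "e = {a, b}" using subsetD[OF set_G[OF E(1)] e(1)] unfolding cross_pairs_def by blast
    have "E \<in> ?Y K \<pi>' J (a, b)" using c(3,4) e ab unfolding low_event_def by simp
    moreover have "(a, b) \<in> K \<times> K" using e(2) ab by simp
    ultimately have "E \<in> (\<Union>q\<in>K \<times> K. ?Y K \<pi>' J q)" by blast
    then show "E \<in> (\<Union>c\<in>tree_choices n s. ?X c)"
      using c(1,2) by (intro UN_I[of "(K, \<pi>', J)"]) simp_all
  qed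
  also have "\<dots> \<le> card (tree_choices n s) * (real (s * s) * (p ^ s * exp (- d / 240) ^ s))"
  proof (rule prob_UN_le[OF tree_choices_bound(1)[OF s(1)]])
    fix c assume c: "c \<in> tree_choices n s"
    obtain K \<pi> J where K: "c = (K, \<pi>, J)" by (cases c)
    have c': "(K, \<pi>, J) \<in> tree_choices n s" using c K by simp
    have maps: "\<pi> \<in> K \<rightarrow> K" "finite K" "card K = s" using tree_choices_maps[OF c'] by simp_all
    show "measure_pmf.prob G (?X c) \<le> real (s * s) * (p ^ s * exp (- d / 240) ^ s)"
    proof (cases "choice_ok K \<pi> J")
      case True
      have "measure_pmf.prob G (\<Union>q\<in>K \<times> K. ?Y K \<pi> J q) \<le> card (K \<times> K) * (p ^ s * exp (- d / 240) ^ s)"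
      proof (rule prob_UN_le)
        show "finite (K \<times> K)" using maps by simp
        fix q assume q: "q \<in> K \<times> K"
        show "measure_pmf.prob G (?Y K \<pi> J q) \<le> p ^ s * exp (- d / 240) ^ s"
        proof (cases "{fst q, snd q} \<in> tree_edges K \<pi>")
          case False
          let ?T = "insert {fst q, snd q} (tree_edges K \<pi>)"
          have "?T \<subseteq> Pow K" using tree_edges_sub[OF maps(1)] q by auto
          then have "measure_pmf.prob G (low_event ?T K J) \<le> p ^ card ?T * exp (- d / 240) ^ s"
            by (rule low_event_prob[OF c' s(2) True])
          moreover have "finite (tree_edges K \<pi>)" using maps unfolding tree_edges_def by simp
          then have "card ?T = s"
            using True False maps s(1) unfolding choice_ok_def by simp
          ultimately show ?thesis using False by simp
        qed (use p in simp)
      qed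
      then show ?thesis using True K maps by (simp add: card_cartesian_product)
    qed (use p K in simp)
  qed
  also have "\<dots> \<le> (4 * exp 1 * n) ^ s * (real (s * s) * (p ^ s * exp (- d / 240) ^ s))"
    using p by (intro mult_right_mono tree_choices_bound s) auto
  finally show ?thesis .
qed

text \<open>The extra edge makes the number of edges equal \<open>s\<close>, so (4en)^s p^s =
  (4ed)^s and no power of \<open>n\<close> is left over. The s^2 places for that edge are absorbed
  by 4^s, which turns 4 into 16.\<close>

lemma prob_acyclic:
  assumes q: "16 * exp 1 * d * exp (- d / 240) \<le> exp (- d / 480)" "exp (- d / 480) \<le> 1 / 2"
  shows "measure_pmf.prob G {E. \<exists>K \<pi>. low_tree n E f d K \<pi> \<and> \<not> {e\<in>E. e \<subseteq> K} \<subseteq> tree_edges K \<pi>}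
    \<le> 2 * exp (- d / 480)"
proof -
  let ?X = "\<lambda>s. {E. \<exists>K \<pi>. low_tree n E f d K \<pi> \<and> card K = s \<and> \<not> {e\<in>E. e \<subseteq> K} \<subseteq> tree_edges K \<pi>}"
  let ?I = "{s\<in>{1..n}. 120 * s \<le> n}"
  have "measure_pmf.prob G {E. \<exists>K \<pi>. low_tree n E f d K \<pi> \<and> \<not> {e\<in>E. e \<subseteq> K} \<subseteq> tree_edges K \<pi>}
    \<le> measure_pmf.prob G (\<Union>s\<in>?I. ?X s)"
  proof (rule prob_mono)
    fix E assume "E \<in> {E. \<exists>K \<pi>. low_tree n E f d K \<pi> \<and> \<not> {e\<in>E. e \<subseteq> K} \<subseteq> tree_edges K \<pi>}"
    then obtain K \<pi> where K: "low_tree n E f d K \<pi>" "\<not> {e\<in>E. e \<subseteq> K} \<subseteq> tree_edges K \<pi>" by blast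
    then have "card K \<in> ?I"
      using finite_subset[of K "{1..n}"] unfolding low_tree_def by (auto simp: Suc_le_eq card_gt_0_iff)
    then show "E \<in> (\<Union>s\<in>?I. ?X s)" using K by blast
  qed
  also have "\<dots> \<le> (\<Sum>s\<in>?I. measure_pmf.prob G (?X s))" by (rule prob_UN_sum) simp
  also have "\<dots> \<le> (\<Sum>s\<in>?I. exp (- d / 480) ^ s)"
  proof (rule sum_mono)
    fix s assume s: "s \<in> ?I"
    have "measure_pmf.prob G (?X s) \<le> (4 * exp 1 * n) ^ s * (real (s * s) * (p ^ s * exp (- d / 240) ^ s))"
      using s by (intro prob_cycle) auto
    also have "\<dots> = real (s * s) * (4 * exp 1 * d * exp (- d / 240)) ^ s"
      by (simp add: d power_mult_distrib mult_ac)
    also have "\<dots> \<le> 4 ^ s * (4 * exp 1 * d * exp (- d / 240)) ^ s"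
    proof -
      have "s \<le> 2 ^ s" using less_exp[of s] by linarith
      then have "s * s \<le> 2 ^ s * 2 ^ s" by (intro mult_mono) auto
      also have "\<dots> = 4 ^ s" by (simp flip: power_mult_distrib)
      finally have "real (s * s) \<le> 4 ^ s" by (metis of_nat_le_iff of_nat_numeral of_nat_power)
      then show ?thesis using d_pos by (intro mult_right_mono) auto
    qed
    also have "\<dots> = (4 * (4 * exp 1 * d * exp (- d / 240))) ^ s"
      by (rule power_mult_distrib[symmetric])
    also have "4 * (4 * exp 1 * d * exp (- d / 240)) = 16 * exp 1 * d * exp (- d / 240)" by simp
    also have "(16 * exp 1 * d * exp (- d / 240)) ^ s \<le> exp (- d / 480) ^ s"
      using q d_pos by (intro power_mono) auto
    finally show "measure_pmf.prob G (?X s) \<le> exp (- d / 480) ^ s" .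
  qed
  also have "\<dots> \<le> (\<Sum>s\<in>{1..n}. exp (- d / 480) ^ s)" by (intro sum_mono2) auto
  also have "\<dots> \<le> 2 * exp (- d / 480)" using q by (intro geometric_sum_le) auto
  finally show ?thesis .
qed

text \<open>With only \<open>s - 1\<close> edges a factor 1/p <= n remains, and summing over sizes
  costs another \<open>n\<close>. Sizes above 1440 ln n contribute exp(-3 d ln n), as 1440 = 3 *
  480, which pays for n^2 and still leaves exp(-d).\<close>

lemma prob_small:
  assumes q: "16 * exp 1 * d * exp (- d / 240) \<le> exp (- d / 480)"
    and d_large: "d \<ge> 2" and n: "ln n \<ge> 1" and M: "1440 * ln n \<le> Suc M"
  shows "measure_pmf.prob G {E. \<exists>K \<pi>. low_tree n E f d K \<pi> \<and> \<not> card K \<le> M} \<le> exp (- d)"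
proof -
  let ?X = "\<lambda>s. {E. \<exists>K \<pi>. low_tree n E f d K \<pi> \<and> card K = s}"
  let ?I = "{s\<in>{1..n}. Suc M \<le> s \<and> 120 * s \<le> n}"
  have b: "measure_pmf.prob G (?X s) \<le> n * exp (- d / 480) ^ Suc M" if s: "s \<in> ?I" for s
  proof -
    have "measure_pmf.prob G (?X s) \<le> (4 * exp 1 * n) ^ s * (p ^ (s - 1) * exp (- d / 240) ^ s)"
      using s by (intro prob_tree) auto
    also have "\<dots> = (4 * exp 1 * n) ^ s * (p ^ s * exp (- d / 240) ^ s) / p"
      using s p_pos by (cases s) auto
    also have "\<dots> = (4 * exp 1 * d * exp (- d / 240)) ^ s / p"
      by (simp add: d power_mult_distrib mult_ac)
    also have "\<dots> \<le> exp (- d / 480) ^ s / p"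
    proof -
      have "4 * exp 1 * d * exp (- d / 240) \<le> 16 * exp 1 * d * exp (- d / 240)"
        using d_pos by simp
      then have "4 * exp 1 * d * exp (- d / 240) \<le> exp (- d / 480)" using q by (rule order.trans)
      then show ?thesis using d_pos p_pos by (intro divide_right_mono power_mono) auto
    qed
    also have "\<dots> \<le> exp (- d / 480) ^ Suc M / p"
      using s d_pos p_pos by (intro divide_right_mono power_decreasing) auto
    also have "\<dots> \<le> n * exp (- d / 480) ^ Suc M"
    proof -
      have "1 / p = n / d" using d d_pos p_pos n_pos by simp
      also have "\<dots> \<le> n"
        using d_large mult_right_mono[of 1 d "real n"] by (simp add: pos_divide_le_eq mult.commute)
      finally have "1 / p * exp (- d / 480) ^ Suc M \<le> n * exp (- d / 480) ^ Suc M"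
        by (intro mult_right_mono) auto
      then show ?thesis by simp
    qed
    finally show ?thesis .
  qed
  have "measure_pmf.prob G {E. \<exists>K \<pi>. low_tree n E f d K \<pi> \<and> \<not> card K \<le> M} \<le>
      measure_pmf.prob G (\<Union>s\<in>?I. ?X s)"
  proof (rule prob_mono)
    fix E assume "E \<in> {E. \<exists>K \<pi>. low_tree n E f d K \<pi> \<and> \<not> card K \<le> M}"
    then obtain K \<pi> where K: "low_tree n E f d K \<pi>" "\<not> card K \<le> M" by blast
    then have "card K \<in> ?I"
      using finite_subset[of K "{1..n}"] unfolding low_tree_def by (auto simp: Suc_le_eq card_gt_0_iff)
    then show "E \<in> (\<Union>s\<in>?I. ?X s)" using K by blast
  qed
  also have "\<dots> \<le> card ?I * (n * exp (- d / 480) ^ Suc M)" by (rule prob_UN_le[OF _ b]) simp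
  also have "\<dots> \<le> n * (n * exp (- d / 480) ^ Suc M)"
  proof -
    have "card ?I \<le> card {1..n}" by (intro card_mono) auto
    then show ?thesis by (intro mult_right_mono) auto
  qed
  also have "\<dots> = exp (2 * ln n + real (Suc M) * (- d / 480))"
  proof -
    have "exp (2 * ln n) = exp (ln n) * exp (ln n)" unfolding exp_add[symmetric] by simp
    also have "\<dots> = real n * real n" using n_pos by simp
    finally show ?thesis unfolding exp_add exp_of_nat_mult by simp
  qed
  also have "\<dots> \<le> exp (- d)"
  proof -
    define z where "z = d * real (Suc M)"
    have "1440 * (d * ln n) \<le> z"
      unfolding z_def using mult_left_mono[OF M, of d] d_pos by (simp add: mult_ac)
    moreover have "2 * ln n \<le> d * ln n" using d_large n by (intro mult_right_mono) auto
    moreover have "d * 1 \<le> d * ln n" using d_pos n by (intro mult_left_mono) auto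
    ultimately have "2 * ln n + - (z / 480) \<le> - d" using d_pos by linarith
    moreover have "real (Suc M) * (- d / 480) = - (z / 480)" unfolding z_def by simp
    ultimately show ?thesis by (simp only: exp_le_cancel_iff)
  qed
  finally show ?thesis .
qed

lemma prob_typical:
  assumes q: "16 * exp 1 * d * exp (- d / 240) \<le> exp (- d / 480)" "exp (- d / 480) \<le> 1 / 2"
    and q': "exp (- d / 544) \<le> 1 / 2" "exp (- d / 240) \<le> 1 / 120"
    and d_large: "d \<ge> 5440" and n: "ln n \<ge> 1" and M: "1440 * ln n \<le> Suc M"
  shows "1 - (exp (- d / 544) + 6 * exp (- d / 240) + 2 * exp (- d / 480) + 2 * exp (- d)) \<le>
    measure_pmf.prob G {E. typical_graph n E f M d}"
proof -
  define B1 where "B1 = {E. \<not> expanding n E d}"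
  define B2 where "B2 = {E. \<not> 2 * real (card (low n E f d)) \<le> exp (- d / 240) * n}"
  define B3 where "B3 = {E. \<exists>K \<pi>. low_tree n E f d K \<pi> \<and> \<not> {e\<in>E. e \<subseteq> K} \<subseteq> tree_edges K \<pi>}"
  define B4 where "B4 = {E. \<exists>K \<pi>. low_tree n E f d K \<pi> \<and> \<not> card K \<le> M}"
  define B5 where "B5 = {E. \<not> (\<Sum>v\<in>{1..n}. exp (real (card (nbs E v)))) \<le> n * exp (3 * d)}"
  define T where "T = {E. typical_graph n E f M d}"
  \<comment> \<open>Since p <= 1, a large \<open>d\<close> already makes \<open>n\<close>
    large.\<close>
  have "d \<le> n" using d p by (simp add: mult_left_le)
  then have n120: "120 \<le> n" using d_large by linarith
  have typical: "E \<in> T"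
    if E: "E \<subseteq> cross_pairs n f" and B: "E \<notin> B1" "E \<notin> B2" "E \<notin> B3" "E \<notin> B4" "E \<notin> B5" for E
  proof -
    have "typical_graph n E f M d"
    proof unfold_locales
      show "E \<subseteq> cross_pairs n f" by (rule E)
      show "x \<in> {1..n} \<Longrightarrow> f x \<in> {1..3}" for x by (rule f_range)
      show "d \<ge> 100" "exp (- d / 240) \<le> 1 / 120" using d_large q' by simp_all
      show "expanding n E d" using B(1) unfolding B1_def by simp
      show "2 * real (card (low n E f d)) \<le> exp (- d / 240) * n" using B(2) unfolding B2_def by simp
      show "{e\<in>E. e \<subseteq> K} \<subseteq> tree_edges K \<pi>" if "low_tree n E f d K \<pi>" for K \<pi>
        using B(3) that unfolding B3_def by blast
      show "card K \<le> M" if "low_tree n E f d K \<pi>" for K \<pi>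
        using B(4) that unfolding B4_def by blast
      show "(\<Sum>v\<in>{1..n}. exp (real (card (nbs E v)))) \<le> n * exp (3 * d)"
        using B(5) unfolding B5_def by simp
    qed
    then show ?thesis unfolding T_def by simp
  qed
  have "measure_pmf.prob G UNIV \<le> measure_pmf.prob G (T \<union> (B1 \<union> (B2 \<union> (B3 \<union> (B4 \<union> B5)))))"
    by (rule prob_mono) (use typical set_G in blast)
  also have "\<dots> \<le> measure_pmf.prob G T + (measure_pmf.prob G B1 + (measure_pmf.prob G B2 +
      (measure_pmf.prob G B3 + (measure_pmf.prob G B4 + measure_pmf.prob G B5))))"
    by (intro order.trans[OF measure_Un_le] add_left_mono) auto
  finally have "1 \<le> measure_pmf.prob G T + (measure_pmf.prob G B1 + (measure_pmf.prob G B2 +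
      (measure_pmf.prob G B3 + (measure_pmf.prob G B4 + measure_pmf.prob G B5))))"
    by simp
  moreover have "measure_pmf.prob G B1 \<le> exp (- d / 544)"
    unfolding B1_def by (rule prob_expanding[OF d_large q'(1)])
  moreover have "measure_pmf.prob G B2 \<le> 6 * exp (- d / 240)"
    unfolding B2_def by (rule prob_few_low[OF n120])
  moreover have "measure_pmf.prob G B3 \<le> 2 * exp (- d / 480)"
    unfolding B3_def by (rule prob_acyclic[OF q])
  moreover have "measure_pmf.prob G B4 \<le> exp (- d)"
    unfolding B4_def using d_large by (intro prob_small[OF q(1) _ n M]) simp
  moreover have "measure_pmf.prob G B5 \<le> exp (- d)"
    unfolding B5_def by (rule prob_degrees)
  ultimately show ?thesis unfolding T_def by linarith
qed

end

section \<open>Averaging over the planted coloring and choice of constants\<close>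

lemma balanced_coloring_exists:
  assumes "3 dvd n"
  shows "balanced_colorings n 3 \<noteq> {}"
proof -
  obtain m where m: "n = 3 * m" using assms by blast
  define f where "f = restrict (\<lambda>v. if v \<le> m then 1 else if v \<le> 2 * m then 2 else 3 :: nat) {1..n}"
  have f: "{v\<in>{1..n}. f v = 1} = {1..m}" "{v\<in>{1..n}. f v = 2} = {m + 1..2 * m}"
    "{v\<in>{1..n}. f v = 3} = {2 * m + 1..3 * m}"
    unfolding f_def m by auto
  have "card {v\<in>{1..n}. f v = i} = n div 3" if i: "i \<in> {1..3}" for i
  proof -
    have "i = 1 \<or> i = 2 \<or> i = 3" using i by auto
    then show ?thesis
    proof (elim disjE)
      assume "i = 1"
      then show ?thesis unfolding \<open>i = 1\<close> f by (simp add: m)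
    next
      assume "i = 2"
      then show ?thesis unfolding \<open>i = 2\<close> f by (simp add: m)
    next
      assume "i = 3"
      then show ?thesis unfolding \<open>i = 3\<close> f by (simp add: m)
    qed
  qed
  moreover have "f \<in> {1..n} \<rightarrow>\<^sub>E {1..3}" unfolding f_def by auto
  ultimately have "f \<in> balanced_colorings n 3" unfolding balanced_colorings_def by blast
  then show ?thesis by blast
qed

text \<open>It suffices to bound the probability for each fixed planted coloring, with a bound
  independent of it.\<close>

lemma prob_planted_ge:
  assumes "3 dvd n" and b: "\<And>f. f \<in> balanced_colorings n 3 \<Longrightarrow>
    b \<le> measure_pmf.prob (edge_pmf (cross_pairs n f) p) {E. (f, E) \<in> S}"
  shows "b \<le> measure_pmf.prob (planted n p 3) S"
proof -
  have fin: "finite (balanced_colorings n 3)"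
    by (rule finite_subset[of _ "{1..n} \<rightarrow>\<^sub>E {1..3}"]) (auto simp: balanced_colorings_def intro: finite_PiE)
  have planted: "planted n p 3 = bind_pmf (pmf_of_set (balanced_colorings n 3))
      (\<lambda>f. map_pmf (Pair f) (edge_pmf (cross_pairs n f) p))"
    unfolding planted_def edge_pmf_def by (simp add: map_pmf_comp)
  have "ennreal b = (\<integral>\<^sup>+f. ennreal b \<partial>pmf_of_set (balanced_colorings n 3))"
    by simp
  also have "\<dots> \<le> (\<integral>\<^sup>+f. emeasure (map_pmf (Pair f) (edge_pmf (cross_pairs n f) p)) S
      \<partial>pmf_of_set (balanced_colorings n 3))"
  proof (intro nn_integral_mono_AE AE_pmfI)
    fix f assume "f \<in> set_pmf (pmf_of_set (balanced_colorings n 3))"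
    then have "f \<in> balanced_colorings n 3"
      using fin balanced_coloring_exists[OF assms(1)] by simp
    from b[OF this] show "ennreal b \<le> emeasure (map_pmf (Pair f) (edge_pmf (cross_pairs n f) p)) S"
      by (simp add: measure_pmf.emeasure_eq_measure vimage_def)
  qed
  also have "\<dots> = emeasure (planted n p 3) S" unfolding planted by simp
  finally show ?thesis by (simp add: measure_pmf.emeasure_eq_measure)
qed

text \<open>The slowest decay among the failure probabilities is exp(-d/544); the smaller rate
  1/1000 absorbs all constant factors once \<open>d\<close> is large.\<close>

lemma large_constant:
  obtains C :: real where "C \<ge> 5440" and "\<And>d. d \<ge> C \<Longrightarrow>
    16 * exp 1 * d * exp (- d / 240) \<le> exp (- d / 480) \<and> exp (- d / 480) \<le> 1 / 2 \<and>
    exp (- d / 544) \<le> 1 / 2 \<and> exp (- d / 240) \<le> 1 / 120 \<and>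
    exp (- d / 544) + 6 * exp (- d / 240) + 2 * exp (- d / 480) + 2 * exp (- d) \<le> exp (- d / 1000)"
proof -
  have "eventually (\<lambda>d::real. 16 * exp 1 * d * exp (- d / 240) \<le> exp (- d / 480)) at_top"
    "eventually (\<lambda>d::real. exp (- d / 480) \<le> 1 / 2) at_top"
    "eventually (\<lambda>d::real. exp (- d / 544) \<le> 1 / 2) at_top"
    "eventually (\<lambda>d::real. exp (- d / 240) \<le> 1 / 120) at_top"
    "eventually (\<lambda>d::real. exp (- d / 544) + 6 * exp (- d / 240) + 2 * exp (- d / 480) + 2 * exp (- d) \<le>
       exp (- d / 1000)) at_top"
    by real_asymp+
  then have "eventually (\<lambda>d::real. 16 * exp 1 * d * exp (- d / 240) \<le> exp (- d / 480) \<and> exp (- d / 480) \<le> 1 / 2 \<and>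
    exp (- d / 544) \<le> 1 / 2 \<and> exp (- d / 240) \<le> 1 / 120 \<and>
    exp (- d / 544) + 6 * exp (- d / 240) + 2 * exp (- d / 480) + 2 * exp (- d) \<le> exp (- d / 1000)) at_top"
    by (intro eventually_conj)
  then obtain C :: real where C: "\<And>d. d \<ge> C \<Longrightarrow>
    16 * exp 1 * d * exp (- d / 240) \<le> exp (- d / 480) \<and> exp (- d / 480) \<le> 1 / 2 \<and>
    exp (- d / 544) \<le> 1 / 2 \<and> exp (- d / 240) \<le> 1 / 120 \<and>
    exp (- d / 544) + 6 * exp (- d / 240) + 2 * exp (- d / 480) + 2 * exp (- d) \<le> exp (- d / 1000)"
    unfolding eventually_at_top_linorder by blast
  show ?thesis by (rule that[of "max 5440 C"]) (use C in auto)
qed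

theorem theorem1:
  fixes \<epsilon> :: real
  assumes "\<epsilon> \<le> 1 / 120"
  shows "\<exists>(C0::real) (c1::real) (c2::real) (K1::real) (K2::real) (P::prog). c1 > 0 \<and> c2 > 0 \<and>
    (\<forall>(n::nat) (p::real). 3 dvd n \<and> 0 \<le> p \<and> p \<le> 1 \<and> real n * p \<ge> C0 \<longrightarrow>
      measure_pmf.prob (planted n p 3)
        {(\<phi>s, E).
          \<forall>\<phi> \<in> {1..n} \<rightarrow> {1..3}. real (card {v\<in>{1..n}. \<phi> v \<noteq> \<phi>s v}) \<le> \<epsilon> * real n \<longrightarrow>
            (\<forall>\<rho>. gallager_execution 3 1 E \<phi> \<rho> \<longrightarrow>
              (\<exists>T. halts_after E \<rho> T \<and> real T \<le> K1 * ln (real n) \<and>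
                (\<forall>\<phi>'. gallager_output n 3 1 E (\<rho> T) \<phi>' \<longrightarrow>
                  (let VA = {v\<in>{1..n}. \<phi>' v = Some (\<phi>s v)} in
                    real (card VA) \<ge> (1 - exp (- c2 * (real n * p))) * real n \<and>
                    (\<forall>v \<in> {1..n} - VA. \<phi>' v = None) \<and>
                    proper_coloring 3 VA E (\<lambda>v. the (\<phi>' v)) \<and>
                    completes_within P (K2 * real n) n 3 E VA \<phi>'))))}
        \<ge> 1 - exp (- c1 * (real n * p)))"
proof -
  obtain C :: real where C: "C \<ge> 5440" "\<And>d. d \<ge> C \<Longrightarrow>
    16 * exp 1 * d * exp (- d / 240) \<le> exp (- d / 480) \<and> exp (- d / 480) \<le> 1 / 2 \<and>
    exp (- d / 544) \<le> 1 / 2 \<and> exp (- d / 240) \<le> 1 / 120 \<and>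
    exp (- d / 544) + 6 * exp (- d / 240) + 2 * exp (- d / 480) + 2 * exp (- d) \<le> exp (- d / 1000)"
    using large_constant by blast
  show ?thesis
  \<comment> \<open>2887 collects \<open>l + 2 * M + 4\<close>, at most 2882 ln n + 5, using ln n >=
    1.\<close>
  proof (rule exI[of _ C], rule exI[of _ "1 / 1000"], rule exI[of _ "1 / 240"], rule exI[of _ 2887],
      rule exI[of _ 4356], rule exI[of _ greedy_prog], intro conjI allI impI)
    fix n :: nat and p :: real
    assume np: "3 dvd n \<and> 0 \<le> p \<and> p \<le> 1 \<and> real n * p \<ge> C"
    define d where "d = real n * p"
    have p: "0 \<le> p" "p \<le> 1" and dC: "d \<ge> C" using np unfolding d_def by auto
    note large = C(2)[OF dC]
    have "d \<le> n" unfolding d_def using p by (simp add: mult_left_le)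
    then have n: "real n \<ge> 5440" using dC C(1) by linarith
    have "exp 1 \<le> real n" using exp_le n by linarith
    then have ln_n: "ln n \<ge> 1" using n by (subst ln_ge_iff) auto
    define M where "M = nat \<lfloor>1440 * ln n\<rfloor>"
    define l where "l = nat \<lfloor>2 * ln n\<rfloor> + 1"
    have M: "1440 * ln n \<le> Suc M" "M \<le> 1440 * ln n" unfolding M_def using ln_n by linarith+
    have l: "2 * ln n < l" "l \<le> 2 * ln n + 1" unfolding l_def using ln_n by linarith+
    \<comment> \<open>2 ln 2 > 1, so \<open>l\<close> > 2 ln n halvings bring a set of at most
      \<open>n\<close> vertices below size one.\<close>
    have "ln n \<le> (2 * ln n) * ln 2" using ln_n ln2_ge_two_thirds by simp
    also have "\<dots> < l * ln 2" using l(1) by (intro mult_strict_right_mono) auto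
    also have "\<dots> = ln (2 ^ l)" by (simp add: ln_realpow)
    finally have "real n < 2 ^ l" using n by simp
    then have n_l: "n < 2 ^ l" by (metis of_nat_less_iff of_nat_numeral of_nat_power)
    let ?S = "{(\<phi>s, E).
          \<forall>\<phi> \<in> {1..n} \<rightarrow> {1..3}. real (card {v\<in>{1..n}. \<phi> v \<noteq> \<phi>s v}) \<le> \<epsilon> * real n \<longrightarrow>
            (\<forall>\<rho>. gallager_execution 3 1 E \<phi> \<rho> \<longrightarrow>
              (\<exists>T. halts_after E \<rho> T \<and> real T \<le> 2887 * ln (real n) \<and>
                (\<forall>\<phi>'. gallager_output n 3 1 E (\<rho> T) \<phi>' \<longrightarrow>
                  (let VA = {v\<in>{1..n}. \<phi>' v = Some (\<phi>s v)} in
                    real (card VA) \<ge> (1 - exp (- (1 / 240) * (real n * p))) * real n \<and>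
                    (\<forall>v \<in> {1..n} - VA. \<phi>' v = None) \<and>
                    proper_coloring 3 VA E (\<lambda>v. the (\<phi>' v)) \<and>
                    completes_within greedy_prog (4356 * real n) n 3 E VA \<phi>'))))}"
    have "1 - exp (- d / 1000) \<le> measure_pmf.prob (planted n p 3) ?S"
    proof (rule prob_planted_ge)
      show "3 dvd n" using np by simp
      fix f assume f: "f \<in> balanced_colorings n 3"
      interpret planted_classes n f p d
        by unfold_locales (use np f p dC C(1) in \<open>auto simp: d_def\<close>)
      have "1 - exp (- d / 1000) \<le> measure_pmf.prob G {E. typical_graph n E f M d}"
        using prob_typical[OF _ _ _ _ _ ln_n M(1)] large dC C(1) by linarith
      also have "\<dots> \<le> measure_pmf.prob G {E. (f, E) \<in> ?S}"
      proof (rule prob_mono)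
        fix E assume "E \<in> {E. typical_graph n E f M d}"
        then interpret typical_graph n E f M d by simp
        have "\<exists>T. halts_after E \<rho> T \<and> real T \<le> 2887 * ln (real n) \<and>
                (\<forall>\<phi>'. gallager_output n 3 1 E (\<rho> T) \<phi>' \<longrightarrow>
                  (let VA = {v\<in>{1..n}. \<phi>' v = Some (f v)} in
                    real (card VA) \<ge> (1 - exp (- (1 / 240) * (real n * p))) * real n \<and>
                    (\<forall>v \<in> {1..n} - VA. \<phi>' v = None) \<and>
                    proper_coloring 3 VA E (\<lambda>v. the (\<phi>' v)) \<and>
                    completes_within greedy_prog (4356 * real n) n 3 E VA \<phi>'))"
          if close: "real (card {v\<in>{1..n}. \<phi> v \<noteq> f v}) \<le> \<epsilon> * real n"
            and exec: "gallager_execution 3 1 E \<phi> \<rho>" for \<phi> \<rho>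
        proof -
          have "\<epsilon> * real n \<le> 1 / 120 * real n" using assms by (intro mult_right_mono) auto
          then have "120 * card {v\<in>{1..n}. \<phi> v \<noteq> f v} \<le> n" using close by linarith
          moreover have "1 \<le> n" using n by linarith
          ultimately obtain T where T: "T \<le> l + 2 * M + 4" "halts_after E \<rho> T"
            "\<forall>\<phi>'. gallager_output n 3 1 E (\<rho> T) \<phi>' \<longrightarrow>
              (let VA = {v\<in>{1..n}. \<phi>' v = Some (f v)} in
                real (card VA) \<ge> (1 - exp (- d / 240)) * real n \<and>
                (\<forall>v \<in> {1..n} - VA. \<phi>' v = None) \<and>
                proper_coloring 3 VA E (\<lambda>v. the (\<phi>' v)) \<and>
                completes_within greedy_prog (4356 * real n) n 3 E VA \<phi>')"
            using gallager_typical[OF _ exec n_l] by blast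
          have "real T \<le> real (l + 2 * M + 4)" using T(1) by (simp only: of_nat_le_iff)
          then have "real T \<le> 2887 * ln n" using M(2) l(2) ln_n by simp
          moreover have "- d / 240 = - (1 / 240) * (real n * p)" unfolding d_def by simp
          ultimately show ?thesis using T(2,3) by (intro exI[of _ T]) (simp only:)
        qed
        then show "E \<in> {E. (f, E) \<in> ?S}" by blast
      qed
      finally show "1 - exp (- d / 1000) \<le> measure_pmf.prob G {E. (f, E) \<in> ?S}" .
    qed
    then show "1 - exp (- (1 / 1000) * (real n * p)) \<le> measure_pmf.prob (planted n p 3) ?S"
      by (simp add: d_def)
  qed simp_all
qed

end
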